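(* Let $(a_n)$ be a sequence with $\frac{a_n}{\log n}\to\infty$ and let $t_\star(a_n):=\frac{2}{\pi^2}n^2\log a_n$. For the continuous-time Glauber dynamics of the discrete Gaussian free field (DGFF) on $\Lambda_n$ with zero boundary conditions, put $d_{\mathrm{TV}}^{(n)}(t)=\max_{\vec h(0):\,\|\vec h(0)\|_\infty\le a_n}\|P_t\delta_{\vec h(0)}-\pi_n\|_{\mathrm{TV}}$. Then, for every (fixed) $s\in\mathbb R$, $$\liminf_{n\to\infty} d_{\mathrm{TV}}^{(n)}\big(t_\star(a_n)+sn^2\big)\ \ge\ \operatorname{erf}\Big(\frac{2}{\pi}e^{-\pi^2 s/2}\Big).$$
   Context: $\operatorname{erf}(x)$ is the probability that a mean-zero Gaussian with variance $1/2$ lies in $[-x,x]$. $\Lambda_n=\{1,\dots,n-1\}^2\subset\mathbb Z^2$ with nearest-neighbor edges; $x\sim y$ means $d(x,y)=1$; $\partial\Lambda_n=\{v\in\mathbb Z^2\setminus\Lambda_n: d(v,\Lambda_n)=1\}$. A height function is $\vec h=(h(x))_{x\in\Lambda_n}\in\mathbb R^{\Lambda_n}$, extended by $h=0$ on $\partial\Lambda_n$ (zero boundary conditions). $\pi_n$ is the DGFF law on $\mathbb R^{\Lambda_n}$ with zero boundary conditions: the probability measure with density proportional to $\exp\big(-\frac18\sum (h(x)-h(y))^2\big)$, where the sum runs over nearest-neighbor pairs $x\sim y$ in $\Lambda_n\cup\partial\Lambda_n$, each edge counted once (so that, conditionally on all other heights, $h(x)$ is Gaussian with variance $1$ and mean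 the average of its four neighbors). Glauber dynamics: each $x\in\Lambda_n$ has an independent rate-1 Poisson clock; when the clock at $x$ rings at time $t$, the heights at all other sites are unchanged and $h(x,t)$ is set to $\frac14\sum_{y\sim x}h(y,t^-)$ plus an independent standard Gaussian. $P_t\delta_{\vec h(0)}$ is the law of $\vec h(t)=(h(x,t))_{x\in\Lambda_n}$ started from $\vec h(0)$. $\|\cdot\|_{\mathrm{TV}}$ is total-variation distance; the max over initial states is understood as a supremum. *)

theory Defs
  imports "HOL-Probability.Probability"
begin

text \<open>\<open>normal_density\<close> takes the standard deviation, not the variance.\<close>

definition erf :: "real \<Rightarrow> real" where
  "erf x = measure (density lborel (normal_density 0 (sqrt (1/2)))) {-x..x}"

definition tv_dist :: "'a measure \<Rightarrow> 'a measure \<Rightarrow> real" where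
  "tv_dist \<mu> \<nu> = (SUP A\<in>sets \<mu>. \<bar>measure \<mu> A - measure \<nu> A\<bar>)"


subsection \<open>The lattice box\<close>

type_synonym site = "int \<times> int"

type_synonym height = "site \<Rightarrow> real"

definition site_dist :: "site \<Rightarrow> site \<Rightarrow> int" where
  "site_dist x y = \<bar>fst x - fst y\<bar> + \<bar>snd x - snd y\<bar>"

definition adj :: "site \<Rightarrow> site \<Rightarrow> bool" where
  "adj x y \<longleftrightarrow> site_dist x y = 1"

definition Lam :: "nat \<Rightarrow> site set" where
  "Lam n = {1..int n - 1} \<times> {1..int n - 1}"

definition bdry :: "nat \<Rightarrow> site set" where
  "bdry n = {v. v \<notin> Lam n \<and> (\<exists>x\<in>Lam n. site_dist v x = 1)}"

definition zero_ext :: "nat \<Rightarrow> height \<Rightarrow> height" where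
  "zero_ext n h x = (if x \<in> Lam n then h x else 0)"

text \<open>
  As usual for product measures, \<open>\<real>\<^sup>\<Lambda>\<close> is the set of functions that are \<open>undefined\<close> outside
  of \<open>\<Lambda>\<close>.
\<close>

abbreviation height_space :: "nat \<Rightarrow> height measure" where
  "height_space n \<equiv> (\<Pi>\<^sub>M x\<in>Lam n. borel)"


subsection \<open>The discrete Gaussian free field\<close>

text \<open>The sum runs over ordered pairs, so that every edge occurs twice; hence the factor 1/2.\<close>

definition gradient_energy :: "nat \<Rightarrow> height \<Rightarrow> real" where
  "gradient_energy n h =
     (\<Sum>(x, y) \<in> {(x, y). x \<in> Lam n \<union> bdry n \<and> y \<in> Lam n \<union> bdry n \<and> adj x y}.
        (zero_ext n h x - zero_ext n h y)\<^sup>2) / 2"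

definition dgff_weight :: "nat \<Rightarrow> height \<Rightarrow> real" where
  "dgff_weight n h = exp (- (1/8) * gradient_energy n h)"

definition dgff :: "nat \<Rightarrow> height measure" where
  "dgff n = density (\<Pi>\<^sub>M x\<in>Lam n. lborel)
     (\<lambda>h. ennreal (dgff_weight n h / (\<integral>g. dgff_weight n g \<partial>(\<Pi>\<^sub>M x\<in>Lam n. lborel))))"


subsection \<open>Glauber dynamics\<close>

text \<open>
  The counting process of a rate-1 Poisson clock. Paths are almost surely monotone, so the
  truncated subtraction on \<open>nat\<close> is harmless.
\<close>

definition poisson_clock :: "'w measure \<Rightarrow> (real \<Rightarrow> 'w \<Rightarrow> nat) \<Rightarrow> bool" where
  "poisson_clock M N \<longleftrightarrow>
     (\<forall>t\<ge>0. N t \<in> M \<rightarrow>\<^sub>M count_space UNIV) \<and>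
     (AE \<omega> in M. N 0 \<omega> = 0 \<and> mono_on {0..} (\<lambda>t. N t \<omega>) \<and>
        (\<forall>t\<ge>0. continuous (at_right t) (\<lambda>u. N u \<omega>))) \<and>
     (\<forall>s t. 0 \<le> s \<and> s < t \<longrightarrow>
        distr M (count_space UNIV) (\<lambda>\<omega>. N t \<omega> - N s \<omega>) = measure_pmf (poisson_pmf (t - s))) \<and>
     (\<forall>\<tau> :: nat \<Rightarrow> real. 0 \<le> \<tau> 0 \<and> mono \<tau> \<longrightarrow>
        prob_space.indep_vars M (\<lambda>_. count_space UNIV)
          (\<lambda>i \<omega>. N (\<tau> (Suc i)) \<omega> - N (\<tau> i) \<omega>) UNIV)"

definition rings :: "(real \<Rightarrow> nat) \<Rightarrow> real \<Rightarrow> bool" where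
  "rings N t \<longleftrightarrow> \<not> (\<forall>\<^sub>F u in at_left t. N u = N t)"

definition process_sets :: "'w measure \<Rightarrow> (real \<Rightarrow> 'w \<Rightarrow> nat) \<Rightarrow> 'w set set" where
  "process_sets M N =
     {(\<lambda>\<omega>. \<lambda>t\<in>{0..}. N t \<omega>) -` A \<inter> space M | A. A \<in> sets (\<Pi>\<^sub>M t\<in>{0..}. count_space UNIV)}"

definition variable_sets :: "'w measure \<Rightarrow> ('w \<Rightarrow> real) \<Rightarrow> 'w set set" where
  "variable_sets M X = {X -` A \<inter> space M | A. A \<in> sets borel}"

text \<open>
  \<open>H\<close> is a version of the Glauber dynamics started from \<open>h0\<close>, driven by the clocks \<open>N x\<close> and the
  Gaussian noise \<open>Z\<close>: \<open>Z x k\<close> is used at the \<open>k\<close>-th ring (\<open>k \<ge> 1\<close>) of the clock at \<open>x\<close>. The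
  height at \<open>x\<close> is constant on every interval on which the clock at \<open>x\<close> does not ring, that is,
  on which \<open>N x\<close> is constant.
\<close>

definition glauber_dynamics ::
  "'w measure \<Rightarrow> nat \<Rightarrow> height \<Rightarrow> (site \<Rightarrow> real \<Rightarrow> 'w \<Rightarrow> nat) \<Rightarrow> (site \<Rightarrow> nat \<Rightarrow> 'w \<Rightarrow> real)
     \<Rightarrow> (real \<Rightarrow> 'w \<Rightarrow> height) \<Rightarrow> bool" where
  "glauber_dynamics M n h0 N Z H \<longleftrightarrow>
     prob_space M \<and>
     (\<forall>x\<in>Lam n. poisson_clock M (N x)) \<and>
     (\<forall>x\<in>Lam n. \<forall>k. distributed M lborel (Z x k) std_normal_density) \<and>
     prob_space.indep_sets M
       (case_sum (\<lambda>x. process_sets M (N x)) (\<lambda>(x, k). variable_sets M (Z x k)))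
       (Lam n <+> (Lam n \<times> UNIV)) \<and>
     (\<forall>t\<ge>0. H t \<in> M \<rightarrow>\<^sub>M height_space n) \<and>
     (AE \<omega> in M. \<forall>x\<in>Lam n.
        H 0 \<omega> x = h0 x \<and>
        (\<forall>s t. 0 \<le> s \<and> s \<le> t \<and> N x s \<omega> = N x t \<omega> \<longrightarrow> H s \<omega> x = H t \<omega> x) \<and>
        (\<forall>t>0. rings (\<lambda>u. N x u \<omega>) t \<longrightarrow>
           H t \<omega> x = (\<Sum>y | adj x y. Lim (at_left t) (\<lambda>u. zero_ext n (H u \<omega>) y)) / 4
                       + Z x (N x t \<omega>) \<omega>))"

text \<open>
  The argument \<open>P\<close> maps an initial state to the law at the time under consideration. The maximum
  over initial states is a supremum.
\<close>

definition worst_tv :: "nat \<Rightarrow> real \<Rightarrow> (height \<Rightarrow> height measure) \<Rightarrow> real" where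
  "worst_tv n a P =
     (SUP h0 \<in> {h \<in> extensional (Lam n). \<forall>x\<in>Lam n. \<bar>h x\<bar> \<le> a}. tv_dist (P h0) (dgff n))"

definition t_star :: "nat \<Rightarrow> real \<Rightarrow> real" where
  "t_star n a = 2 / pi\<^sup>2 * (real n)\<^sup>2 * ln a"

end

theory Submission
  imports Defs "HOL-Real_Asymp.Real_Asymp"
begin

text \<open>
  Project the field onto the ground state \<open>\<phi>\<close> of the discrete Laplacian and write \<open>gap\<close> for its
  eigenvalue. Under the DGFF the coefficient \<open>\<langle>\<phi>, h\<rangle>\<close> is centred Gaussian with
  variance \<open>\<sigma>\<^sup>2 = |\<phi>|\<^sup>2 / gap\<close>. Given the clocks, \<open>\<langle>\<phi>, h(t)\<rangle>\<close> is Gaussian as well: its mean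
  is \<open>\<langle>\<psi>, h(0)\<rangle>\<close>, where \<open>\<psi>\<close> arises from \<open>\<phi>\<close> by the transposed averaging steps, and its variance
  is at most \<open>\<sigma>\<^sup>2\<close>, because a step at \<open>x\<close> lowers the Green energy of \<open>\<psi>\<close> by exactly \<open>\<psi>(x)\<^sup>2\<close>. So a
  half-line separates the two laws as soon as the conditional mean is large with high probability.

  Since \<open>log a\<^sub>n\<close> may be much larger than any power of \<open>n\<close>, second moments do not control the mean of
  \<open>\<psi>\<close>. Instead, the logarithm of \<open>\<langle>\<psi>, \<phi>\<rangle>\<close> is compared in expectation with its Jensen upper bound.
  The defect is of order \<open>n\<^sup>-\<^sup>4 + t n\<^sup>-\<^sup>6\<close> because the spectral gap above the ground state prevents \<open>\<psi>\<close>
  from concentrating, and for large \<open>t\<close> it is beaten by the gain \<open>t n\<^sup>-\<^sup>4\<close> in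
  \<open>gap < \<pi>\<^sup>2 / (2 n\<^sup>2)\<close>. The initial state is \<open>a\<^sub>n\<close> times a product of trigonometric polynomials
  approximating the constant 1; all modes other than the ground state are negligible in \<open>\<psi>\<close>.
\<close>


subsection \<open>Discrete sine modes on the box\<close>

text \<open>The constant in the limit comes from comparing a centred Gaussian of standard deviation
  \<sigma> with one of no larger variance around the conditional mean, cut halfway between the
  centres. The product square wave has ground-state amplitude (4/pi)^2, and \<open>t * gap\<close>
  is about log a_n + pi^2 s/2, so the mean is about (16/pi^2) E \<open>msq\<close> with E =
  exp(-pi^2 s/2). Divided by \<sigma> = sqrt(\<open>msq\<close> / \<open>gap\<close>), with
  \<open>msq * gap\<close> tending to pi^2/8, this is 4 sqrt 2 E/pi. Half of it is sqrt 2 times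
  2E/pi, and the sqrt 2 is absorbed by the variance 1/2 in the definition of erf. Conditioning on
  the clocks is made elementary by cutting time into finitely many intervals. A word of rings fixes
  the order of the updates, so on its event the coefficient is an explicit affine function of the
  noise, and conditional expectations become finite sums over words. The number of intervals is sent
  to infinity while \<open>n\<close> and \<open>t\<close> stay fixed.\<close>

definition mode :: "nat \<Rightarrow> site \<Rightarrow> site \<Rightarrow> real" where
  "mode n k x = sin (pi * of_int (fst k) * of_int (fst x) / n) * sin (pi * of_int (snd k) * of_int (snd x) / n)"

text \<open>The eigenvalue of the identity minus the neighbour average: averaging multiplies the
  mode by \<open>1 - eig n k\<close>.\<close>

definition eig :: "nat \<Rightarrow> site \<Rightarrow> real" where
  "eig n k = 1 - (cos (pi * of_int (fst k) / n) + cos (pi * of_int (snd k) / n)) / 2"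

definition coef :: "nat \<Rightarrow> height \<Rightarrow> site \<Rightarrow> real" where
  "coef n \<psi> k = (\<Sum>x\<in>Lam n. \<psi> x * mode n k x)"

text \<open>The common squared Euclidean norm of all modes with frequency in the box.\<close>

definition msq :: "nat \<Rightarrow> real" where
  "msq n = (real n)\<^sup>2 / 4"

text \<open>Multiplying by 2 sin(\<theta>/2) makes the sum telescope. The outcome depends only on
  the parity of \<open>l\<close>; the range of \<open>l\<close> keeps \<theta>/2 strictly between 0
  and pi, so the factor can be cancelled.\<close>

lemma sum_cos_progression:
  assumes "0 < l" "l < 2 * int n"
  shows "(\<Sum>x<n. cos (real x * (pi * of_int l / n))) = (1 - cos (pi * of_int l)) / 2"
proof -
  have n: "n > 0" using assms by auto
  define \<theta> where "\<theta> = pi * of_int l / n"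
  have step: "2 * sin (\<theta>/2) * cos (real x * \<theta>) = sin ((real (Suc x) - 1/2) * \<theta>) - sin ((real x - 1/2) * \<theta>)" for x
  proof -
    have "(real (Suc x) - 1/2) * \<theta> = real x * \<theta> + \<theta>/2" "(real x - 1/2) * \<theta> = real x * \<theta> - \<theta>/2"
      by (simp_all add: algebra_simps)
    thus ?thesis by (simp add: sin_add sin_diff)
  qed
  have "2 * sin (\<theta>/2) * (\<Sum>x<n. cos (real x * \<theta>)) = (\<Sum>x<n. sin ((real (Suc x) - 1/2) * \<theta>) - sin ((real x - 1/2) * \<theta>))"
    unfolding sum_distrib_left step ..
  also have "\<dots> = sin ((real n - 1/2) * \<theta>) - sin ((real 0 - 1/2) * \<theta>)"
    by (rule sum_lessThan_telescope)
  also have "(real n - 1/2) * \<theta> = pi * of_int l - \<theta>/2"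
    using n by (simp add: \<theta>_def field_simps)
  also have "sin (pi * of_int l - \<theta>/2) = - cos (pi * of_int l) * sin (\<theta>/2)"
    by (simp add: sin_diff sin_npi_int)
  finally have e: "sin (\<theta>/2) * (2 * (\<Sum>x<n. cos (real x * \<theta>))) = sin (\<theta>/2) * (1 - cos (pi * of_int l))"
    by (simp add: algebra_simps)
  have "sin (\<theta>/2) > 0"
  proof (rule sin_gt_zero)
    show "0 < \<theta>/2" using assms n by (simp add: \<theta>_def)
    have "real_of_int l < of_int (2 * int n)" using assms(2) of_int_less_iff by blast
    then show "\<theta>/2 < pi" using n by (simp add: \<theta>_def field_simps)
  qed
  with e show ?thesis by (simp add: \<theta>_def)
qed

lemma sum_int_interval:
  fixes f :: "int \<Rightarrow> real"
  assumes "f 0 = 0" "n > 0"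
  shows "(\<Sum>x\<in>{1..int n - 1}. f x) = (\<Sum>x<n. f (int x))"
proof -
  have "(\<Sum>x<n. f (int x)) = (\<Sum>x\<in>{0..<int n}. f x)"
    by (rule sum.reindex_bij_witness[of _ nat int]) auto
  also have "{0..<int n} = insert 0 {1..int n - 1}" using assms by auto
  finally show ?thesis using assms by simp
qed

text \<open>Product-to-sum gives two cosine progressions, of frequencies
  \<open>\<bar>j - k\<bar>\<close> and \<open>j + k\<close>. These have the same parity, so they
  cancel unless \<open>j = k\<close>, where the first degenerates to a sum of ones.\<close>

lemma sin_orthogonal:
  assumes j: "j \<in> {1..int n - 1}" and k: "k \<in> {1..int n - 1}"
  shows "(\<Sum>x\<in>{1..int n - 1}. sin (pi * of_int j * of_int x / n) * sin (pi * of_int k * of_int x / n))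
    = (if j = k then real n / 2 else 0)"
proof -
  have n: "n > 0" using assms by auto
  have "(\<Sum>x\<in>{1..int n - 1}. sin (pi * of_int j * of_int x / n) * sin (pi * of_int k * of_int x / n))
    = (\<Sum>x<n. sin (pi * of_int j * of_int (int x) / n) * sin (pi * of_int k * of_int (int x) / n))"
    by (rule sum_int_interval) (use n in auto)
  also have "\<dots> = (\<Sum>x<n. cos (real x * (pi * of_int \<bar>j - k\<bar> / n)) / 2 - cos (real x * (pi * of_int (j + k) / n)) / 2)"
  proof (rule sum.cong[OF refl])
    fix x
    have a: "cos (real x * (pi * of_int \<bar>j - k\<bar> / n)) = cos (real x * (pi * of_int (j - k) / n))"
      by (cases "j \<le> k") (auto simp: abs_if algebra_simps diff_divide_distrib intro: cos_minus[symmetric, THEN trans])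
    have b: "real x * (pi * of_int (j - k) / n) = pi * of_int j * of_int (int x) / n - pi * of_int k * of_int (int x) / n"
      "real x * (pi * of_int (j + k) / n) = pi * of_int j * of_int (int x) / n + pi * of_int k * of_int (int x) / n"
      by (simp_all add: algebra_simps diff_divide_distrib add_divide_distrib)
    show "sin (pi * of_int j * of_int (int x) / n) * sin (pi * of_int k * of_int (int x) / n) =
      cos (real x * (pi * of_int \<bar>j - k\<bar> / n)) / 2 - cos (real x * (pi * of_int (j + k) / n)) / 2"
      unfolding a b cos_add cos_diff by (simp add: field_simps)
  qed
  also have "\<dots> = (\<Sum>x<n. cos (real x * (pi * of_int \<bar>j - k\<bar> / n))) / 2 - (\<Sum>x<n. cos (real x * (pi * of_int (j + k) / n))) / 2"
    by (simp add: sum_subtractf sum_divide_distrib)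
  also have "(\<Sum>x<n. cos (real x * (pi * of_int (j + k) / n))) = (1 - cos (pi * of_int (j + k))) / 2"
    using assms by (intro sum_cos_progression) auto
  also have "(\<Sum>x<n. cos (real x * (pi * of_int \<bar>j - k\<bar> / n))) = (if j = k then n else (1 - cos (pi * of_int (j + k))) / 2)"
  proof (cases "j = k")
    case False
    have "(\<Sum>x<n. cos (real x * (pi * of_int \<bar>j - k\<bar> / n))) = (1 - cos (pi * of_int \<bar>j - k\<bar>)) / 2"
      using assms False by (intro sum_cos_progression) auto
    also have "cos (pi * of_int \<bar>j - k\<bar>) = cos (pi * of_int (j + k))"
    proof -
      have "even (\<bar>j - k\<bar>) = even (j + k)" by presburger
      thus ?thesis by (simp only: cos_npi_int)
    qed
    finally show ?thesis using False by simp
  qed simp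
  finally show ?thesis
    using cos_npi_int[of "k + k"] by auto
qed

lemma finite_Lam [simp]: "finite (Lam n)"
  by (simp add: Lam_def)

lemma mode_orthogonal:
  assumes "j \<in> Lam n" "k \<in> Lam n"
  shows "(\<Sum>x\<in>Lam n. mode n j x * mode n k x) = (if j = k then msq n else 0)"
proof -
  have "(\<Sum>x\<in>Lam n. mode n j x * mode n k x) =
    (\<Sum>x\<in>{1..int n - 1}. sin (pi * of_int (fst j) * of_int x / n) * sin (pi * of_int (fst k) * of_int x / n)) *
    (\<Sum>x\<in>{1..int n - 1}. sin (pi * of_int (snd j) * of_int x / n) * sin (pi * of_int (snd k) * of_int x / n))"
    unfolding Lam_def sum_product sum.cartesian_product
    by (rule sum.cong) (auto simp: mode_def mult_ac)
  also have "\<dots> = (if fst j = fst k then real n / 2 else 0) * (if snd j = snd k then real n / 2 else 0)"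
    using assms by (subst (1 2) sin_orthogonal) (auto simp: Lam_def)
  also have "\<dots> = (if j = k then msq n else 0)"
    by (auto simp: msq_def power2_eq_square prod_eq_iff)
  finally show ?thesis .
qed

lemma mode_commute: "mode n k x = mode n x k"
  by (simp add: mode_def mult_ac)

text \<open>Frequencies are indexed by the box itself, so the matrix of modes is symmetric and
  orthogonality of its rows is also orthogonality of its columns.\<close>

lemma mode_complete:
  assumes "x \<in> Lam n" "y \<in> Lam n"
  shows "(\<Sum>k\<in>Lam n. mode n k x * mode n k y) = (if x = y then msq n else 0)"
  using mode_orthogonal[OF assms] by (simp add: mode_commute[of n x] mode_commute[of n y])

lemma Lam_msq_pos: "x \<in> Lam n \<Longrightarrow> msq n > 0"
  by (auto simp: Lam_def msq_def)

lemma coef_inversion: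
  assumes "x \<in> Lam n"
  shows "(\<Sum>k\<in>Lam n. coef n \<psi> k * mode n k x) = msq n * \<psi> x"
proof -
  have "(\<Sum>k\<in>Lam n. coef n \<psi> k * mode n k x) = (\<Sum>k\<in>Lam n. \<Sum>y\<in>Lam n. \<psi> y * (mode n k y * mode n k x))"
    unfolding coef_def sum_distrib_right mult.assoc ..
  also have "\<dots> = (\<Sum>y\<in>Lam n. \<psi> y * (\<Sum>k\<in>Lam n. mode n k y * mode n k x))"
    by (subst sum.swap) (simp add: sum_distrib_left)
  also have "\<dots> = (\<Sum>y\<in>Lam n. \<psi> y * (if y = x then msq n else 0))"
    by (intro sum.cong refl) (simp add: mode_complete assms)
  also have "\<dots> = msq n * \<psi> x" using assms by (simp add: if_distrib cong: if_cong)
  finally show ?thesis .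
qed

lemma parseval: "(\<Sum>k\<in>Lam n. (coef n \<psi> k)\<^sup>2) = msq n * (\<Sum>x\<in>Lam n. (\<psi> x)\<^sup>2)"
proof -
  have "(\<Sum>k\<in>Lam n. (coef n \<psi> k)\<^sup>2) = (\<Sum>k\<in>Lam n. \<Sum>x\<in>Lam n. \<psi> x * (coef n \<psi> k * mode n k x))"
  proof (rule sum.cong[OF refl])
    fix k
    show "(coef n \<psi> k)\<^sup>2 = (\<Sum>x\<in>Lam n. \<psi> x * (coef n \<psi> k * mode n k x))"
      unfolding power2_eq_square by (subst (2) coef_def) (simp add: sum_distrib_left mult_ac)
  qed
  also have "\<dots> = (\<Sum>x\<in>Lam n. \<psi> x * (\<Sum>k\<in>Lam n. coef n \<psi> k * mode n k x))"
    by (subst sum.swap) (simp add: sum_distrib_left)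
  also have "\<dots> = (\<Sum>x\<in>Lam n. msq n * (\<psi> x)\<^sup>2)"
    by (intro sum.cong refl) (simp add: coef_inversion power2_eq_square)
  finally show ?thesis by (simp add: sum_distrib_left)
qed

section \<open>Neighbour averages and their transposed single-site steps\<close>

lemma adj_set: "{y. adj x y} = {(fst x + 1, snd x), (fst x - 1, snd x), (fst x, snd x + 1), (fst x, snd x - 1)}"
proof (intro set_eqI iffI)
  fix y assume "y \<in> {y. adj x y}"
  then show "y \<in> {(fst x + 1, snd x), (fst x - 1, snd x), (fst x, snd x + 1), (fst x, snd x - 1)}"
    by (cases y; cases x) (auto simp: adj_def site_dist_def abs_if split: if_splits)
qed (auto simp: adj_def site_dist_def)

lemma finite_adj [simp]: "finite {y. adj x y}" by (simp add: adj_set)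

lemma sum_adj:
  fixes f :: "site \<Rightarrow> 'a::comm_monoid_add"
  shows "(\<Sum>y | adj x y. f y) = f (fst x + 1, snd x) + f (fst x - 1, snd x) + f (fst x, snd x + 1) + f (fst x, snd x - 1)"
  by (simp add: adj_set add.assoc)

lemma mode_zero:
  assumes "x \<in> Lam n" "adj x y" "y \<notin> Lam n" shows "mode n k y = 0"
proof -
  have n: "n > 0" using assms(1) by (auto simp: Lam_def)
  have "y \<in> {(fst x + 1, snd x), (fst x - 1, snd x), (fst x, snd x + 1), (fst x, snd x - 1)}"
    using assms(2) adj_set[of x] by auto
  then have "fst y = 0 \<or> snd y = 0 \<or> fst y = int n \<or> snd y = int n"
    using assms(1,3) by (cases x; cases y) (auto simp: Lam_def)
  then show ?thesis
    using n by (auto simp: mode_def sin_npi_int)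
qed

lemma mode_eigen: "(\<Sum>y | adj x y. mode n k y) / 4 = (1 - eig n k) * mode n k x"
proof -
  have e: "pi * of_int i * (a + 1) / n = pi * of_int i * a / n + pi * of_int i / n"
       "pi * of_int i * (a - 1) / n = pi * of_int i * a / n - pi * of_int i / n" for i a
    by (simp_all add: algebra_simps add_divide_distrib diff_divide_distrib)
  show ?thesis
    unfolding sum_adj mode_def eig_def fst_conv snd_conv of_int_add of_int_diff of_int_1 e sin_add sin_diff
    by (simp add: field_simps)
qed

text \<open>The transpose of a single-site averaging step.\<close>

definition upd :: "nat \<Rightarrow> site \<Rightarrow> height \<Rightarrow> height" where
  "upd n x \<psi> = (\<lambda>y. if y = x then 0 else if adj x y then \<psi> y + \<psi> x / 4 else \<psi> y)"

lemma adj_irrefl [simp]: "\<not> adj x x" by (simp add: adj_def site_dist_def)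

lemma adj_commute: "adj x y = adj y x"
  by (auto simp: adj_def site_dist_def abs_minus_commute)

text \<open>The duality behind the backward process: the right-hand side is the pairing of
  \<open>\<psi>\<close> with \<open>v\<close> after the height at \<open>x\<close> has been replaced
  by its neighbour average. What \<open>upd\<close> sends outside the box is ignored, in accordance
  with the zero boundary heights.\<close>

lemma sum_upd:
  assumes "x \<in> Lam n"
  shows "(\<Sum>y\<in>Lam n. upd n x \<psi> y * v y) =
    (\<Sum>y\<in>Lam n. \<psi> y * v y) - \<psi> x * v x + \<psi> x * (\<Sum>y | adj x y. zero_ext n v y) / 4"
proof -
  have "(\<Sum>y | adj x y. zero_ext n v y) = (\<Sum>y\<in>Lam n. if adj x y then v y else 0)"
  proof -
    have "(\<Sum>y | adj x y. zero_ext n v y) = (\<Sum>y\<in>{y. adj x y} \<inter> Lam n. v y)"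
      unfolding zero_ext_def by (rule sum.inter_restrict[symmetric]) simp
    also have "\<dots> = (\<Sum>y\<in>Lam n \<inter> {y. adj x y}. v y)" by (simp add: Int_commute)
    also have "\<dots> = (\<Sum>y\<in>Lam n. if y \<in> {y. adj x y} then v y else 0)"
      by (rule sum.inter_restrict) simp
    finally show ?thesis by simp
  qed
  moreover have "(\<Sum>y\<in>Lam n. upd n x \<psi> y * v y) =
    (\<Sum>y\<in>Lam n. \<psi> y * v y - (if y = x then \<psi> x * v x else 0) + \<psi> x / 4 * (if adj x y then v y else 0))"
    by (intro sum.cong refl) (auto simp: upd_def algebra_simps)
  moreover have "\<dots> = (\<Sum>y\<in>Lam n. \<psi> y * v y) - (\<Sum>y\<in>Lam n. if y = x then \<psi> x * v x else 0)
      + \<psi> x / 4 * (\<Sum>y\<in>Lam n. if adj x y then v y else 0)"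
    by (simp only: sum.distrib sum_subtractf sum_distrib_left)
  ultimately show ?thesis
    using assms by simp
qed

lemma coef_upd:
  assumes "x \<in> Lam n"
  shows "coef n (upd n x \<psi>) k = coef n \<psi> k - eig n k * \<psi> x * mode n k x"
proof -
  have z: "zero_ext n (mode n k) y = mode n k y" if "adj x y" for y
    using mode_zero[OF assms that] by (auto simp: zero_ext_def)
  have "(\<Sum>y | adj x y. zero_ext n (mode n k) y) = (\<Sum>y | adj x y. mode n k y)"
    by (intro sum.cong refl) (simp add: z)
  also have "\<dots> = 4 * ((1 - eig n k) * mode n k x)" by (simp flip: mode_eigen)
  finally have e: "(\<Sum>y | adj x y. zero_ext n (mode n k) y) = 4 * ((1 - eig n k) * mode n k x)" .
  have cancel: "u * (4 * v) / 4 = u * v" for u v :: real by simp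
  show ?thesis
    unfolding coef_def sum_upd[OF assms] e cancel
    by (simp add: algebra_simps)
qed

text \<open>The quadratic form of the inverse of identity minus average, written in the eigenbasis;
  equivalently, the variance of the pairing of \<open>\<psi>\<close> with a DGFF sample.\<close>

definition green :: "nat \<Rightarrow> height \<Rightarrow> real" where
  "green n \<psi> = (\<Sum>k\<in>Lam n. (coef n \<psi> k)\<^sup>2 / eig n k) / msq n"

lemma sin_npi_pos: assumes "k \<in> {1..int n - 1}" shows "sin (pi * of_int k / n) > 0"
proof (rule sin_gt_zero)
  have "real_of_int k < real_of_int (int n)" using assms by (subst of_int_less_iff) auto
  then have "real_of_int k < real n" by simp
  then show "0 < pi * of_int k / n" "pi * of_int k / n < pi"
    using assms by (auto simp: field_simps)
qed

lemma eig_pos: assumes "k \<in> Lam n" shows "eig n k > 0"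
proof -
  have c: "cos (pi * of_int i / n) < 1" if "i \<in> {1..int n - 1}" for i
  proof -
    have "sin (pi * of_int i / n) > 0" using that by (rule sin_npi_pos)
    then show ?thesis
      by (metis cos_le_one less_eq_real_def cos_one_sin_zero less_irrefl)
  qed
  show ?thesis using c[of "fst k"] c[of "snd k"] assms by (auto simp: eig_def Lam_def)
qed

text \<open>Up to the factor \<open>msq n\<close> this is a diagonal entry of identity minus
  average. The neighbour terms vanish by completeness, since no site is its own neighbour, and only
  the identity contributes.\<close>

lemma sum_eig_mode:
  assumes "x \<in> Lam n"
  shows "(\<Sum>k\<in>Lam n. eig n k * (mode n k x)\<^sup>2) = msq n"
proof -
  have "(\<Sum>k\<in>Lam n. eig n k * (mode n k x)\<^sup>2) =
    (\<Sum>k\<in>Lam n. mode n k x * mode n k x - (\<Sum>y | adj x y. mode n k x * zero_ext n (mode n k) y) / 4)"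
  proof (rule sum.cong[OF refl])
    fix k
    have "(\<Sum>y | adj x y. mode n k x * zero_ext n (mode n k) y) = mode n k x * (\<Sum>y | adj x y. mode n k y)"
      unfolding sum_distrib_left
      by (intro sum.cong refl) (use mode_zero[OF assms] in \<open>auto simp: zero_ext_def\<close>)
    also have "\<dots> = mode n k x * (4 * ((1 - eig n k) * mode n k x))"
      by (simp flip: mode_eigen)
    finally show "eig n k * (mode n k x)\<^sup>2 = mode n k x * mode n k x - (\<Sum>y | adj x y. mode n k x * zero_ext n (mode n k) y) / 4"
      by (simp add: algebra_simps power2_eq_square)
  qed
  also have "\<dots> = msq n - (\<Sum>y | adj x y. \<Sum>k\<in>Lam n. mode n k x * zero_ext n (mode n k) y) / 4"
    by (simp add: sum_subtractf mode_complete assms sum_divide_distrib[symmetric] sum.swap[of _ _ "Lam n"])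
  also have "(\<Sum>y | adj x y. \<Sum>k\<in>Lam n. mode n k x * zero_ext n (mode n k) y) = 0"
  proof (rule sum.neutral, safe)
    fix a b assume adj: "adj x (a, b)"
    then have "x \<noteq> (a, b)" by auto
    then show "(\<Sum>k\<in>Lam n. mode n k x * zero_ext n (mode n k) (a, b)) = 0"
      using mode_complete[OF assms, of "(a, b)"] by (cases "(a, b) \<in> Lam n") (auto simp: zero_ext_def)
  qed
  finally show ?thesis by simp
qed

text \<open>In the expanded squares the cross term contributes
  \<open>- 2 * (\<psi> x)\<^sup>2\<close> by Fourier inversion, and the quadratic term gives back
  \<open>(\<psi> x)\<^sup>2\<close> by the diagonal identity above.\<close>

lemma green_upd:
  assumes "x \<in> Lam n"
  shows "green n (upd n x \<psi>) = green n \<psi> - (\<psi> x)\<^sup>2"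
proof -
  have N: "msq n > 0" using Lam_msq_pos assms by blast
  have "(\<Sum>k\<in>Lam n. (coef n (upd n x \<psi>) k)\<^sup>2 / eig n k) =
    (\<Sum>k\<in>Lam n. (coef n \<psi> k)\<^sup>2 / eig n k - 2 * \<psi> x * (coef n \<psi> k * mode n k x) + (\<psi> x)\<^sup>2 * (eig n k * (mode n k x)\<^sup>2))"
  proof (rule sum.cong[OF refl])
    fix k assume "k \<in> Lam n"
    then have "eig n k > 0" by (rule eig_pos)
    then show "(coef n (upd n x \<psi>) k)\<^sup>2 / eig n k =
      (coef n \<psi> k)\<^sup>2 / eig n k - 2 * \<psi> x * (coef n \<psi> k * mode n k x) + (\<psi> x)\<^sup>2 * (eig n k * (mode n k x)\<^sup>2)"
      unfolding coef_upd[OF assms] by (simp add: field_simps power2_eq_square)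
  qed
  also have "\<dots> = (\<Sum>k\<in>Lam n. (coef n \<psi> k)\<^sup>2 / eig n k) - 2 * \<psi> x * (msq n * \<psi> x) + (\<psi> x)\<^sup>2 * msq n"
    by (simp add: sum.distrib sum_subtractf sum_distrib_left[symmetric] coef_inversion sum_eig_mode assms)
  finally show ?thesis using N
    by (simp add: green_def field_simps power2_eq_square)
qed

lemma green_nonneg: "green n \<psi> \<ge> 0"
  unfolding green_def msq_def using eig_pos
  by (intro divide_nonneg_nonneg sum_nonneg) (auto simp: less_imp_le)

subsection \<open>One update of the dual process\<close>

abbreviation ground :: "nat \<Rightarrow> site \<Rightarrow> real" where
  "ground n \<equiv> mode n (1, 1)"

abbreviation gap :: "nat \<Rightarrow> real" where
  "gap n \<equiv> eig n (1, 1)"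

lemma gap_eq: "gap n = 1 - cos (pi / n)"
  by (simp add: eig_def)

lemma ground_pos: "x \<in> Lam n \<Longrightarrow> ground n x > 0"
  using sin_npi_pos[of "fst x" n] sin_npi_pos[of "snd x" n] by (auto simp: mode_def Lam_def)

lemma ground_le_1: "ground n x \<le> 1"
  by (rule order_trans[OF abs_ge_self]) (auto simp: mode_def abs_mult intro!: mult_le_one)

lemma abs_mode_le_1: "\<bar>mode n k x\<bar> \<le> 1"
  by (auto simp: mode_def abs_mult intro!: mult_le_one)

lemma cos_ge_quadratic: "1 - x\<^sup>2 / 2 \<le> cos (x::real)"
proof -
  have "\<bar>sin (x/2)\<bar> \<le> \<bar>x/2\<bar>" by (rule abs_sin_x_le_abs_x)
  then have "(sin (x/2))\<^sup>2 \<le> (x/2)\<^sup>2" by (simp only: abs_le_square_iff)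
  moreover have "cos x = 1 - 2 * (sin (x/2))\<^sup>2" using cos_double_sin[of "x/2"] by simp
  ultimately show ?thesis by (simp add: power2_eq_square)
qed

text \<open>The threshold 25 makes \<open>gap n\<close> at most 1/100, which is the smallness that
  the numerical constants below rely on.\<close>

locale box =
  fixes n :: nat
  assumes n_ge: "n \<ge> 25"
begin

lemma one_in: "(1, 1) \<in> Lam n"
  using n_ge by (auto simp: Lam_def)

lemma msq_pos: "msq n > 0"
  using Lam_msq_pos one_in by blast

lemma gap_pos: "gap n > 0"
  using eig_pos one_in by blast

lemma gap_le: "gap n \<le> 1 / 100"
proof -
  have "pi / n \<le> 3.15 / 25"
    using n_ge pi_less_4 pi_approx by (intro frac_le) auto
  then have "(pi / n)\<^sup>2 \<le> (3.15 / 25)\<^sup>2" by (intro power_mono) auto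
  then show ?thesis using cos_ge_quadratic[of "pi / n"] by (simp add: gap_eq power2_eq_square)
qed

text \<open>
  The two smallest eigenvalues have ratio \<open>3 / 2 + cos (\<pi> / n)\<close>, which tends to \<open>5 / 2\<close>. What
  matters below is that the ratio stays above 2.
\<close>

lemma gap_ratio:
  assumes "k \<in> Lam n" "k \<noteq> (1, 1)"
  shows "eig n k \<ge> 12 / 5 * gap n"
proof -
  define y where "y = pi / n"
  have y: "0 < y" using n_ge by (simp add: y_def)
  have mono: "cos (pi * of_int i / n) \<le> cos (real j * y)" if "i \<in> {int j..int n - 1}" for i j
  proof -
    have 1: "real j * y \<le> pi * of_int i / n"
    proof -
      have "real j \<le> of_int i" using that by auto
      from mult_left_mono[OF this, of y] y show ?thesis by (simp add: y_def mult_ac)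
    qed
    have "real_of_int i \<le> real n" using that by auto
    then have 2: "pi * of_int i / n \<le> pi" using n_ge by (simp add: field_simps)
    show ?thesis using 1 2 y by (intro cos_monotone_0_pi_le) auto
  qed
  have a: "cos (pi * of_int (fst k) / n) \<le> cos y" "cos (pi * of_int (snd k) / n) \<le> cos y"
    using mono[of "fst k" 1] mono[of "snd k" 1] assms by (auto simp: Lam_def)
  have b: "cos (pi * of_int (fst k) / n) \<le> cos (2*y) \<or> cos (pi * of_int (snd k) / n) \<le> cos (2*y)"
    using mono[of "fst k" 2] mono[of "snd k" 2] assms by (cases k) (auto simp: Lam_def)
  have le: "cos (2*y) \<le> cos y"
    using mono[of 2 1] n_ge by (simp add: y_def mult_ac)
  have "cos (pi * of_int (fst k) / n) + cos (pi * of_int (snd k) / n) \<le> cos y + cos (2*y)"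
    using a b by auto
  then have "eig n k \<ge> 1 - (cos y + cos (2*y)) / 2" by (simp add: eig_def)
  also have "1 - (cos y + cos (2*y)) / 2 = (1 - cos y) * (3/2 + cos y)"
    unfolding cos_double_cos by (simp add: field_simps power2_eq_square)
  also have "\<dots> \<ge> (1 - cos y) * (12/5)"
    using gap_le by (intro mult_left_mono) (auto simp: gap_eq y_def)
  finally show ?thesis by (simp add: gap_eq y_def)
qed

lemma gap_le_eig: "k \<in> Lam n \<Longrightarrow> gap n \<le> eig n k"
  using gap_ratio[of k] gap_pos by (cases "k = (1, 1)") auto

lemma coef_ground: "k \<in> Lam n \<Longrightarrow> coef n (ground n) k = (if k = (1, 1) then msq n else 0)"
  using mode_orthogonal[OF one_in, of k] by (auto simp: coef_def)

lemma green_ground: "green n (ground n) = msq n / gap n"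
proof -
  have "green n (ground n) = (\<Sum>k\<in>Lam n. if k = (1, 1) then (msq n)\<^sup>2 / gap n else 0) / msq n"
    unfolding green_def by (intro arg_cong2[where f="(/)"] sum.cong refl) (auto simp: coef_ground)
  then show ?thesis using msq_pos one_in by (simp add: power2_eq_square)
qed

section \<open>Scale-invariant functionals of the dual state and their one-step drift\<close>

definition mass :: "height \<Rightarrow> real" where
  "mass \<psi> = coef n \<psi> (1, 1)"

definition admissible :: "height \<Rightarrow> bool" where
  "admissible \<psi> \<longleftrightarrow> (\<forall>x\<in>Lam n. \<psi> x \<ge> 0) \<and> mass \<psi> > 0"

text \<open>The dual state decays exponentially, so only quantities normalised by
  \<open>mass\<close> can stay bounded. A small value says that \<open>\<psi>\<close> is spread over
  many sites.\<close>

definition norm_ratio :: "height \<Rightarrow> real" where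
  "norm_ratio \<psi> = (\<Sum>x\<in>Lam n. (\<psi> x)\<^sup>2) / (mass \<psi>)\<^sup>2"

definition green_ratio :: "height \<Rightarrow> real" where
  "green_ratio \<psi> = green n \<psi> / (mass \<psi>)\<^sup>2"

definition coef_ratio :: "site \<Rightarrow> height \<Rightarrow> real" where
  "coef_ratio k \<psi> = (coef n \<psi> k / mass \<psi>)\<^sup>2"

text \<open>For admissible \<open>\<psi>\<close> this is a probability vector on the box. An update
  at \<open>x\<close> multiplies \<open>mass\<close> by \<open>1 - gap n * share \<psi> x\<close>,
  so the fluctuations of \<open>mass\<close> depend on how evenly it is distributed.\<close>

definition share :: "height \<Rightarrow> site \<Rightarrow> real" where
  "share \<psi> x = \<psi> x * ground n x / mass \<psi>"

lemma share_nonneg: "admissible \<psi> \<Longrightarrow> x \<in> Lam n \<Longrightarrow> share \<psi> x \<ge> 0"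
  using ground_pos[of x n] by (auto simp: admissible_def share_def)

lemma sum_share: "admissible \<psi> \<Longrightarrow> (\<Sum>x\<in>Lam n. share \<psi> x) = 1"
  by (simp add: admissible_def share_def mass_def coef_def flip: sum_divide_distrib)

lemma share_le_1: "admissible \<psi> \<Longrightarrow> x \<in> Lam n \<Longrightarrow> share \<psi> x \<le> 1"
  using sum_share[of \<psi>] member_le_sum[of x "Lam n" "share \<psi>"] share_nonneg[of \<psi>] by auto

lemma sum_share_sq: "admissible \<psi> \<Longrightarrow> (\<Sum>x\<in>Lam n. (share \<psi> x)\<^sup>2) \<le> norm_ratio \<psi>"
proof -
  have "(share \<psi> x)\<^sup>2 \<le> (\<psi> x)\<^sup>2 / (mass \<psi>)\<^sup>2" if "x \<in> Lam n" for x
  proof -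
    have "(ground n x)\<^sup>2 \<le> 1"
      using ground_pos[OF that] ground_le_1[of n x] by (simp add: power_le_one)
    then have "(\<psi> x)\<^sup>2 * (ground n x)\<^sup>2 \<le> (\<psi> x)\<^sup>2" by (simp add: mult_left_le)
    then show ?thesis by (simp add: share_def power_divide power_mult_distrib divide_right_mono)
  qed
  then show ?thesis unfolding norm_ratio_def sum_divide_distrib by (intro sum_mono)
qed

lemma mass_upd:
  assumes "admissible \<psi>" "x \<in> Lam n"
  shows "mass (upd n x \<psi>) = mass \<psi> * (1 - gap n * share \<psi> x)"
  using assms by (simp add: mass_def coef_upd share_def field_simps admissible_def)

lemma gap_share:
  assumes "admissible \<psi>" "x \<in> Lam n"
  shows "0 \<le> gap n * share \<psi> x" "gap n * share \<psi> x \<le> 1 / 100" "gap n * share \<psi> x \<le> gap n"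
proof -
  show 0: "0 \<le> gap n * share \<psi> x" using share_nonneg[OF assms] gap_pos by simp
  show "gap n * share \<psi> x \<le> gap n" using share_le_1[OF assms] gap_pos by simp
  then show "gap n * share \<psi> x \<le> 1 / 100" using gap_le by simp
qed

lemma admissible_upd:
  assumes "admissible \<psi>" "x \<in> Lam n"
  shows "admissible (upd n x \<psi>)"
  using assms gap_share[OF assms] mass_upd[OF assms] by (auto simp: admissible_def upd_def)

lemma admissible_ground: "admissible (ground n)"
  using ground_pos coef_ground[OF one_in] msq_pos by (auto simp: admissible_def mass_def less_imp_le)

lemma mass_ground: "mass (ground n) = msq n"
  using coef_ground[OF one_in] by (simp add: mass_def)

lemma norm_ratio_nonneg: "norm_ratio \<psi> \<ge> 0" by (simp add: norm_ratio_def sum_nonneg)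

lemma green_ratio_nonneg: "green_ratio \<psi> \<ge> 0" by (simp add: green_ratio_def green_nonneg)

lemma green_le: "green n \<psi> \<le> (\<Sum>x\<in>Lam n. (\<psi> x)\<^sup>2) / gap n"
proof -
  have "(\<Sum>k\<in>Lam n. (coef n \<psi> k)\<^sup>2 / eig n k) \<le> (\<Sum>k\<in>Lam n. (coef n \<psi> k)\<^sup>2 / gap n)"
    using gap_le_eig gap_pos eig_pos by (intro sum_mono divide_left_mono) auto
  also have "\<dots> = msq n * (\<Sum>x\<in>Lam n. (\<psi> x)\<^sup>2) / gap n"
    by (simp add: parseval flip: sum_divide_distrib)
  finally show ?thesis using msq_pos by (simp add: green_def field_simps)
qed

text \<open>The ground mode is split off and all other modes are charged with the second eigenvalue
  bound; by Parseval their total is the excess of the squared norm over the ground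
  contribution.\<close>

lemma green_le_excess:
  "green n \<psi> \<le> (mass \<psi>)\<^sup>2 / (gap n * msq n)
     + ((\<Sum>x\<in>Lam n. (\<psi> x)\<^sup>2) - (mass \<psi>)\<^sup>2 / msq n) / (12 / 5 * gap n)"
proof -
  let ?R = "Lam n - {(1, 1)}"
  have "(\<Sum>k\<in>?R. (coef n \<psi> k)\<^sup>2 / eig n k) \<le> (\<Sum>k\<in>?R. (coef n \<psi> k)\<^sup>2 / (12 / 5 * gap n))"
    using gap_ratio gap_pos eig_pos by (intro sum_mono divide_left_mono) auto
  also have "\<dots> = (\<Sum>k\<in>?R. (coef n \<psi> k)\<^sup>2) / (12 / 5 * gap n)"
    by (rule sum_divide_distrib[symmetric])
  also have "(\<Sum>k\<in>?R. (coef n \<psi> k)\<^sup>2) = msq n * (\<Sum>x\<in>Lam n. (\<psi> x)\<^sup>2) - (mass \<psi>)\<^sup>2"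
    using parseval[of n \<psi>] sum.remove[OF finite_Lam one_in, of "\<lambda>k. (coef n \<psi> k)\<^sup>2"]
    by (simp add: mass_def)
  finally have "green n \<psi> \<le> ((mass \<psi>)\<^sup>2 / gap n + (msq n * (\<Sum>x\<in>Lam n. (\<psi> x)\<^sup>2) - (mass \<psi>)\<^sup>2) / (12 / 5 * gap n)) / msq n"
    unfolding green_def using msq_pos
      sum.remove[OF finite_Lam one_in, of "\<lambda>k. (coef n \<psi> k)\<^sup>2 / eig n k"]
    by (intro divide_right_mono) (auto simp: mass_def)
  also have "\<dots> = (mass \<psi>)\<^sup>2 / (gap n * msq n)
     + ((\<Sum>x\<in>Lam n. (\<psi> x)\<^sup>2) - (mass \<psi>)\<^sup>2 / msq n) / (12 / 5 * gap n)"
    using msq_pos gap_pos by (simp add: field_simps)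
  finally show ?thesis .
qed

lemma green_ratio_le:
  assumes "admissible \<psi>"
  shows "gap n * green_ratio \<psi> \<le> norm_ratio \<psi>" "gap n * green_ratio \<psi> \<le> 1 / msq n + norm_ratio \<psi> * (5 / 12)"
proof -
  have F: "mass \<psi> > 0" using assms by (simp add: admissible_def)
  have "green_ratio \<psi> \<le> (\<Sum>x\<in>Lam n. (\<psi> x)\<^sup>2) / gap n / (mass \<psi>)\<^sup>2"
    unfolding green_ratio_def by (intro divide_right_mono green_le) auto
  then show "gap n * green_ratio \<psi> \<le> norm_ratio \<psi>"
    using gap_pos F by (simp add: norm_ratio_def field_simps)
  have "green_ratio \<psi> \<le> ((mass \<psi>)\<^sup>2 / (gap n * msq n)
     + ((\<Sum>x\<in>Lam n. (\<psi> x)\<^sup>2) - (mass \<psi>)\<^sup>2 / msq n) / (12 / 5 * gap n)) / (mass \<psi>)\<^sup>2"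
    unfolding green_ratio_def by (intro divide_right_mono green_le_excess) auto
  also have "\<dots> = (1 / msq n + (norm_ratio \<psi> - 1 / msq n) * (5 / 12)) / gap n"
    using gap_pos F msq_pos by (simp add: norm_ratio_def field_simps)
  finally have "gap n * green_ratio \<psi> \<le> 1 / msq n + (norm_ratio \<psi> - 1 / msq n) * (5 / 12)"
    using gap_pos by (simp add: field_simps)
  also have "\<dots> \<le> 1 / msq n + norm_ratio \<psi> * (5 / 12)" using msq_pos by simp
  finally show "gap n * green_ratio \<psi> \<le> 1 / msq n + norm_ratio \<psi> * (5 / 12)" .
qed

lemma inverse_square_le:
  fixes y :: real
  assumes "0 \<le> y" "y \<le> 1 / 100"
  shows "1 / (1 - y)\<^sup>2 \<le> 1 + 2 * y + 4 * y\<^sup>2" "1 / (1 - y)\<^sup>2 \<ge> 1"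
proof -
  have p: "(1 - y)\<^sup>2 > 0" using assms by simp
  have "(1 + 2 * y + 4 * y\<^sup>2) * (1 - y)\<^sup>2 = 1 + y\<^sup>2 * (1 - 6 * y + 4 * y\<^sup>2)"
    by algebra
  moreover have "1 - 6 * y + 4 * y\<^sup>2 \<ge> 0" using assms zero_le_power2[of y] by linarith
  ultimately have "1 \<le> (1 + 2 * y + 4 * y\<^sup>2) * (1 - y)\<^sup>2" by simp
  then show "1 / (1 - y)\<^sup>2 \<le> 1 + 2 * y + 4 * y\<^sup>2" using p by (simp add: divide_le_eq)
  show "1 / (1 - y)\<^sup>2 \<ge> 1" using assms p by (simp add: power_le_one)
qed

text \<open>Summed over the sites, \<open>green\<close> loses exactly the squared norm, that is
  \<open>norm_ratio\<close> after normalisation, while dividing by the reduced \<open>mass\<close>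
  squared gains about \<open>2 * gap n * green_ratio \<psi>\<close>. By the spectral gap this gain
  is at most about 2/\<open>msq\<close> plus 2 * 5/12 of \<open>norm_ratio\<close>. As 2 * 5/12 < 1,
  a negative multiple of \<open>norm_ratio\<close> survives, and it pays for the second-order errors
  in the later estimates.\<close>

lemma sum_green_ratio_upd:
  assumes "admissible \<psi>"
  shows "(\<Sum>x\<in>Lam n. green_ratio (upd n x \<psi>)) \<le> card (Lam n) * green_ratio \<psi> + 3 / msq n - norm_ratio \<psi> / 10"
proof -
  define F where "F = mass \<psi>"
  have F: "F > 0" using assms by (simp add: admissible_def F_def)
  define y where "y x = gap n * share \<psi> x" for x
  have sy: "(\<Sum>x\<in>Lam n. y x) = gap n"
    using sum_share[OF assms] by (simp add: y_def flip: sum_distrib_left)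
  have 1: "green_ratio (upd n x \<psi>) \<le> green_ratio \<psi> + (2 + 4 * gap n) * green_ratio \<psi> * y x - (\<psi> x)\<^sup>2 / F\<^sup>2"
    if x: "x \<in> Lam n" for x
  proof -
    have y: "0 \<le> y x" "y x \<le> 1/100" "y x \<le> gap n" using gap_share[OF assms x] by (auto simp: y_def)
    define b where "b = green_ratio \<psi> - (\<psi> x)\<^sup>2 / F\<^sup>2"
    have be: "b = green n (upd n x \<psi>) / F\<^sup>2"
      by (simp add: b_def green_ratio_def green_upd[OF x] F_def diff_divide_distrib)
    then have b: "b \<ge> 0" by (simp add: green_nonneg)
    have "b \<le> green_ratio \<psi>" by (simp add: b_def)
    have "green_ratio (upd n x \<psi>) = b * (1 / (1 - y x)\<^sup>2)"
      by (simp add: be green_ratio_def mass_upd[OF assms x] y_def F_def power_mult_distrib)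
    also have "\<dots> \<le> b * (1 + 2 * y x + 4 * (y x)\<^sup>2)"
      by (intro mult_left_mono inverse_square_le y b)
    also have "\<dots> \<le> b * (1 + 2 * y x + 4 * (gap n * y x))"
      using y b unfolding power2_eq_square by (intro mult_left_mono add_left_mono mult_right_mono) auto
    also have "\<dots> = b + b * ((2 + 4 * gap n) * y x)" by (simp add: algebra_simps)
    also have "\<dots> \<le> b + green_ratio \<psi> * ((2 + 4 * gap n) * y x)"
      using y gap_pos \<open>b \<le> green_ratio \<psi>\<close> by (intro add_left_mono mult_right_mono) auto
    finally show ?thesis by (simp add: b_def algebra_simps)
  qed
  have "(\<Sum>x\<in>Lam n. green_ratio (upd n x \<psi>)) \<le> (\<Sum>x\<in>Lam n. green_ratio \<psi> + (2 + 4 * gap n) * green_ratio \<psi> * y x - (\<psi> x)\<^sup>2 / F\<^sup>2)"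
    by (intro sum_mono 1)
  also have "\<dots> = card (Lam n) * green_ratio \<psi> + (2 + 4 * gap n) * green_ratio \<psi> * gap n - norm_ratio \<psi>"
    by (simp add: sum.distrib sum_subtractf sy norm_ratio_def F_def flip: sum_distrib_left sum_divide_distrib)
  also have "(2 + 4 * gap n) * green_ratio \<psi> * gap n = (2 + 4 * gap n) * (gap n * green_ratio \<psi>)" by simp
  \<comment> \<open>With \<open>gap n\<close> at most 1/100 the prefactor is at most 2.04, and 2.04
    * 5/12 = 0.85 stays below 9/10.\<close>
  also have "\<dots> \<le> (204/100) * (1 / msq n + norm_ratio \<psi> * (5 / 12))"
    using green_ratio_le(2)[OF assms] gap_le gap_pos green_ratio_nonneg[of \<psi>] norm_ratio_nonneg[of \<psi>] msq_pos by (intro mult_mono) auto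
  also have "(204/100) * (1 / msq n + norm_ratio \<psi> * (5 / 12)) \<le> 3 * (1 / msq n) + norm_ratio \<psi> * 9 / 10"
    using norm_ratio_nonneg[of \<psi>] msq_pos by (simp add: field_simps)
  finally show ?thesis by simp
qed

text \<open>The first-order terms of the logarithm add up to \<open>gap n\<close> because the shares
  sum to 1. The second-order terms are sums of squared shares, hence bounded by
  \<open>norm_ratio\<close>; this is the one-step loss in Jensen's inequality.\<close>

lemma sum_ln_mass_upd:
  assumes "admissible \<psi>"
  shows "(\<Sum>x\<in>Lam n. ln (mass (upd n x \<psi>))) \<ge> card (Lam n) * ln (mass \<psi>) - gap n - 2 * (gap n)\<^sup>2 * norm_ratio \<psi>"
proof -
  have F: "mass \<psi> > 0" using assms by (simp add: admissible_def)
  have 1: "ln (mass (upd n x \<psi>)) \<ge> ln (mass \<psi>) - gap n * share \<psi> x - 2 * (gap n)\<^sup>2 * (share \<psi> x)\<^sup>2" if x: "x \<in> Lam n" for x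
    using gap_share[OF assms x] ln_one_minus_pos_lower_bound[of "gap n * share \<psi> x"] F
    by (simp add: mass_upd[OF assms x] ln_mult power_mult_distrib)
  have "(\<Sum>x\<in>Lam n. ln (mass (upd n x \<psi>))) \<ge> (\<Sum>x\<in>Lam n. ln (mass \<psi>) - gap n * share \<psi> x - 2 * (gap n)\<^sup>2 * (share \<psi> x)\<^sup>2)"
    by (intro sum_mono 1)
  also have "(\<Sum>x\<in>Lam n. ln (mass \<psi>) - gap n * share \<psi> x - 2 * (gap n)\<^sup>2 * (share \<psi> x)\<^sup>2) =
    card (Lam n) * ln (mass \<psi>) - gap n - 2 * (gap n)\<^sup>2 * (\<Sum>x\<in>Lam n. (share \<psi> x)\<^sup>2)"
    using sum_share[OF assms] by (simp add: sum_subtractf flip: sum_distrib_left)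
  finally show ?thesis
    using mult_left_mono[OF sum_share_sq[OF assms], of "2 * (gap n)\<^sup>2"] by simp
qed

lemma sum_mass_upd:
  assumes "admissible \<psi>"
  shows "(\<Sum>x\<in>Lam n. mass (upd n x \<psi>)) = (card (Lam n) - gap n) * mass \<psi>"
proof -
  have "(\<Sum>x\<in>Lam n. mass (upd n x \<psi>)) = (\<Sum>x\<in>Lam n. mass \<psi> - mass \<psi> * gap n * share \<psi> x)"
    by (intro sum.cong refl) (simp add: mass_upd[OF assms] algebra_simps)
  also have "\<dots> = (card (Lam n) - gap n) * mass \<psi>"
    unfolding sum_subtractf sum_distrib_left[symmetric] by (simp add: sum_share[OF assms] algebra_simps)
  finally show ?thesis .
qed

text \<open>The squared coefficient contracts at rate \<open>2 * eig n k\<close>, while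
  normalisation by \<open>mass\<close> squared expands at rate about \<open>2 * gap n\<close>. Since
  \<open>eig n k\<close> is at least 12/5 of \<open>gap n\<close>, a net contraction at rate
  \<open>gap n\<close> remains; the last term collects the squared jumps.\<close>

lemma sum_coef_ratio_upd:
  assumes "admissible \<psi>" and k: "k \<in> Lam n" "k \<noteq> (1, 1)"
  shows "(\<Sum>x\<in>Lam n. coef_ratio k (upd n x \<psi>)) \<le> card (Lam n) * coef_ratio k \<psi> - gap n * coef_ratio k \<psi> + 5 * (eig n k)\<^sup>2 * norm_ratio \<psi>"
proof -
  define F where "F = mass \<psi>"
  have F: "F > 0" using assms by (simp add: admissible_def F_def)
  define y where "y x = gap n * share \<psi> x" for x
  define b where "b x = \<psi> x * mode n k x / F" for x
  define G where "G = coef n \<psi> k / F"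
  define l where "l = eig n k"
  have l: "l > 0" "l \<ge> 12/5 * gap n" using eig_pos gap_ratio k by (auto simp: l_def)
  have sb: "(\<Sum>x\<in>Lam n. b x) = G" by (simp add: b_def G_def coef_def flip: sum_divide_distrib)
  have sy: "(\<Sum>x\<in>Lam n. share \<psi> x) = 1"
    using sum_share[OF assms(1)] .
  have sb2: "(\<Sum>x\<in>Lam n. (b x)\<^sup>2) \<le> norm_ratio \<psi>"
  proof -
    have "(b x)\<^sup>2 \<le> (\<psi> x)\<^sup>2 / F\<^sup>2" for x
    proof -
      have "(mode n k x)\<^sup>2 \<le> 1" using abs_mode_le_1[of n k x] by (simp add: abs_square_le_1)
      then have "(\<psi> x)\<^sup>2 * (mode n k x)\<^sup>2 \<le> (\<psi> x)\<^sup>2" by (simp add: mult_left_le)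
      then show ?thesis by (simp add: b_def power_divide power_mult_distrib divide_right_mono)
    qed
    then show ?thesis unfolding norm_ratio_def F_def[symmetric] sum_divide_distrib by (intro sum_mono)
  qed
  have 1: "coef_ratio k (upd n x \<psi>) \<le> G\<^sup>2 + G\<^sup>2 * (2 * gap n + 7 * (gap n)\<^sup>2) * share \<psi> x - 2 * l * G * b x + 5 * l\<^sup>2 * (b x)\<^sup>2"
    if x: "x \<in> Lam n" for x
  proof -
    have y: "0 \<le> y x" "y x \<le> 1/100" "y x \<le> gap n" using gap_share[OF assms(1) x] by (auto simp: y_def)
    have sh: "0 \<le> share \<psi> x" "share \<psi> x \<le> 1" using share_nonneg share_le_1 assms(1) x by auto
    define s where "s = 1 / (1 - y x)\<^sup>2"
    have s: "s \<le> 1 + 2 * y x + 4 * (y x)\<^sup>2" "1 \<le> s" unfolding s_def by (intro inverse_square_le y)+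
    have y2: "(y x)\<^sup>2 \<le> gap n * y x" "(y x)\<^sup>2 \<le> (1/100) * y x"
      using y unfolding power2_eq_square by (intro mult_right_mono; auto)+
    have s3: "s \<le> 1 + 3 * y x" "s \<le> 11/10" using s y2 y by auto
    have "coef n (upd n x \<psi>) k / mass (upd n x \<psi>) = (G - l * b x) / (1 - y x)"
      using F by (simp add: coef_upd[OF x] mass_upd[OF assms(1) x] G_def b_def l_def y_def F_def field_simps)
    then have "coef_ratio k (upd n x \<psi>) = (G - l * b x)\<^sup>2 * s"
      by (simp add: coef_ratio_def s_def power_divide)
    also have "\<dots> = G\<^sup>2 * s - 2 * l * G * b x - 2 * ((s - 1) * (G * (l * b x))) + l\<^sup>2 * (b x)\<^sup>2 * s"
      by (simp add: power2_eq_square algebra_simps)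
    also have "\<dots> \<le> G\<^sup>2 * (1 + 2 * y x + 4 * (gap n * y x)) - 2 * l * G * b x
        + (3 * (gap n)\<^sup>2 * G\<^sup>2 * share \<psi> x + 3 * (l\<^sup>2 * (b x)\<^sup>2)) + l\<^sup>2 * (b x)\<^sup>2 * (11/10)"
    proof -
      have "G\<^sup>2 * s \<le> G\<^sup>2 * (1 + 2 * y x + 4 * (gap n * y x))"
        using s y2 by (intro mult_left_mono) auto
      moreover have "l\<^sup>2 * (b x)\<^sup>2 * s \<le> l\<^sup>2 * (b x)\<^sup>2 * (11/10)"
        using s3 by (intro mult_left_mono) auto
      \<comment> \<open>The interaction of the two corrections: \<open>s - 1\<close> is at most
        three times \<open>gap n * share \<psi> x\<close>, and the arithmetic-geometric mean
        inequality separates \<open>gap n * G\<close> from \<open>l * b x\<close>, so that no sum of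
        mixed products has to be estimated.\<close>
      moreover have "- (2 * ((s - 1) * (G * (l * b x)))) \<le> 3 * (gap n)\<^sup>2 * G\<^sup>2 * share \<psi> x + 3 * (l\<^sup>2 * (b x)\<^sup>2)"
      proof -
        have "- (2 * ((s - 1) * (G * (l * b x)))) \<le> 2 * ((s - 1) * \<bar>G * (l * b x)\<bar>)"
        proof -
          have "(s - 1) * - (G * (l * b x)) \<le> (s - 1) * \<bar>G * (l * b x)\<bar>"
            using s by (intro mult_left_mono) auto
          then show ?thesis unfolding mult_minus_right by linarith
        qed
        also have "\<dots> \<le> 2 * (3 * y x * \<bar>G * (l * b x)\<bar>)"
          using s3 by (intro mult_left_mono mult_right_mono) auto
        also have "\<dots> = 3 * share \<psi> x * (2 * (\<bar>gap n * G\<bar> * \<bar>l * b x\<bar>))"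
          using gap_pos by (simp add: y_def abs_mult mult_ac)
        also have "\<dots> \<le> 3 * share \<psi> x * (\<bar>gap n * G\<bar>\<^sup>2 + \<bar>l * b x\<bar>\<^sup>2)"
          using sum_squares_bound[of "\<bar>gap n * G\<bar>" "\<bar>l * b x\<bar>"] sh by (intro mult_left_mono) auto
        also have "\<dots> = 3 * (gap n)\<^sup>2 * G\<^sup>2 * share \<psi> x + share \<psi> x * (3 * (l\<^sup>2 * (b x)\<^sup>2))"
          by (simp add: power_mult_distrib algebra_simps)
        also have "\<dots> \<le> 3 * (gap n)\<^sup>2 * G\<^sup>2 * share \<psi> x + 1 * (3 * (l\<^sup>2 * (b x)\<^sup>2))"
          using sh by (intro add_left_mono mult_right_mono) auto
        finally show ?thesis by simp
      qed
      ultimately show ?thesis by simp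
    qed
    also have "\<dots> = G\<^sup>2 + G\<^sup>2 * (2 * gap n + 7 * (gap n)\<^sup>2) * share \<psi> x - 2 * l * G * b x + 41/10 * (l\<^sup>2 * (b x)\<^sup>2)"
      by (simp add: y_def power2_eq_square algebra_simps)
    also have "\<dots> \<le> G\<^sup>2 + G\<^sup>2 * (2 * gap n + 7 * (gap n)\<^sup>2) * share \<psi> x - 2 * l * G * b x + 5 * (l\<^sup>2 * (b x)\<^sup>2)"
      by (intro add_left_mono mult_right_mono) auto
    finally show ?thesis by simp
  qed
  have "(\<Sum>x\<in>Lam n. coef_ratio k (upd n x \<psi>)) \<le>
     (\<Sum>x\<in>Lam n. G\<^sup>2 + G\<^sup>2 * (2 * gap n + 7 * (gap n)\<^sup>2) * share \<psi> x - 2 * l * G * b x + 5 * l\<^sup>2 * (b x)\<^sup>2)"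
    by (intro sum_mono 1)
  also have "\<dots> = card (Lam n) * G\<^sup>2 + G\<^sup>2 * (2 * gap n + 7 * (gap n)\<^sup>2) - 2 * l * G\<^sup>2 + 5 * l\<^sup>2 * (\<Sum>x\<in>Lam n. (b x)\<^sup>2)"
    using sy sb by (simp add: sum.distrib sum_subtractf power2_eq_square flip: sum_distrib_left)
  also have "\<dots> \<le> card (Lam n) * G\<^sup>2 - gap n * G\<^sup>2 + 5 * l\<^sup>2 * norm_ratio \<psi>"
  proof -
    have "(gap n)\<^sup>2 \<le> gap n * (1/100)" unfolding power2_eq_square using gap_le gap_pos by (intro mult_left_mono) auto
    then have "2 * gap n + 7 * (gap n)\<^sup>2 - 2 * l \<le> - gap n" using l gap_pos by linarith
    then have "G\<^sup>2 * (2 * gap n + 7 * (gap n)\<^sup>2 - 2 * l) \<le> G\<^sup>2 * (- gap n)" by (intro mult_left_mono) auto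
    moreover have "5 * l\<^sup>2 * (\<Sum>x\<in>Lam n. (b x)\<^sup>2) \<le> 5 * l\<^sup>2 * norm_ratio \<psi>"
      using sb2 by (intro mult_left_mono) auto
    ultimately show ?thesis by (simp add: algebra_simps)
  qed
  finally show ?thesis by (simp add: coef_ratio_def G_def F_def l_def)
qed

end

subsection \<open>Random words of updates\<close>

text \<open>
  Time is cut into intervals. The letter \<open>None\<close> stands for an interval without any ring, \<open>Some x\<close>
  for one with a single ring, at \<open>x\<close>; all other outcomes are discarded, so that the weights of the
  words sum to less than 1. The head of a word is the earliest interval, and the dual process
  starts from the latest one.
\<close>

definition evolve :: "nat \<Rightarrow> site option list \<Rightarrow> height" where
  "evolve n xs = foldr (\<lambda>c \<psi>. case c of None \<Rightarrow> \<psi> | Some x \<Rightarrow> upd n x \<psi>) xs (ground n)"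

definition words :: "nat \<Rightarrow> nat \<Rightarrow> site option list set" where
  "words n m = {xs. set xs \<subseteq> insert None (Some ` Lam n) \<and> length xs = m}"

definition weight :: "real \<Rightarrow> real \<Rightarrow> site option list \<Rightarrow> real" where
  "weight w p xs = (\<Prod>c\<leftarrow>xs. case c of None \<Rightarrow> w | Some _ \<Rightarrow> p)"

lemma evolve_Nil [simp]: "evolve n [] = ground n"
  and evolve_None [simp]: "evolve n (None # xs) = evolve n xs"
  and evolve_Some [simp]: "evolve n (Some x # xs) = upd n x (evolve n xs)"
  by (simp_all add: evolve_def)

lemma weight_Nil [simp]: "weight w p [] = 1"
  and weight_None [simp]: "weight w p (None # xs) = w * weight w p xs"
  and weight_Some [simp]: "weight w p (Some x # xs) = p * weight w p xs"
  by (simp_all add: weight_def)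

lemma weight_nonneg: "w \<ge> 0 \<Longrightarrow> p \<ge> 0 \<Longrightarrow> weight w p xs \<ge> 0"
  by (induction xs) (auto simp: weight_def split: option.split)

text \<open>Serves to replace the probability of an interval without rings by the larger number that
  makes all letters sum to 1. Bad words only become heavier.\<close>

lemma weight_mono: "0 \<le> w \<Longrightarrow> w \<le> w' \<Longrightarrow> 0 \<le> p \<Longrightarrow> weight w p xs \<le> weight w' p xs"
proof (induction xs)
  case (Cons c xs)
  then show ?case
    using weight_nonneg[of w p xs] by (cases c) (auto intro!: mult_mono mult_left_mono)
qed simp

lemma finite_words [simp]: "finite (words n m)"
  unfolding words_def by (intro finite_lists_length_eq) auto

lemma words_0 [simp]: "words n 0 = {[]}"
  by (auto simp: words_def)

text \<open>The head letter is the outermost update in the \<open>foldr\<close> of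
  \<open>evolve\<close>. Peeling it off is therefore one step of the dual chain, applied after the
  tail has been processed.\<close>

lemma sum_words_Suc:
  "(\<Sum>xs\<in>words n (Suc m). weight w p xs * g xs) =
   (\<Sum>xs\<in>words n m. weight w p xs * (w * g (None # xs) + p * (\<Sum>x\<in>Lam n. g (Some x # xs))))"
proof -
  let ?L = "insert None (Some ` Lam n)"
  have "words n (Suc m) = (\<lambda>(xs, c). c # xs) ` (words n m \<times> ?L)"
    unfolding words_def by (rule lists_length_Suc_eq)
  then have "(\<Sum>xs\<in>words n (Suc m). weight w p xs * g xs) =
      (\<Sum>(xs, c)\<in>words n m \<times> ?L. weight w p (c # xs) * g (c # xs))"
    by (simp add: sum.reindex inj_on_def case_prod_unfold prod_eq_iff)
  also have "\<dots> = (\<Sum>xs\<in>words n m. \<Sum>c\<in>?L. weight w p (c # xs) * g (c # xs))"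
    by (simp only: sum.cartesian_product)
  also have "\<dots> = (\<Sum>xs\<in>words n m. w * weight w p xs * g (None # xs) + (\<Sum>x\<in>Lam n. p * weight w p xs * g (Some x # xs)))"
    by (intro sum.cong refl) (simp add: sum.reindex image_iff mult_ac)
  finally show ?thesis
    by (simp add: sum_distrib_left algebra_simps)
qed

lemma sum_weight: "(\<Sum>xs\<in>words n m. weight w p xs) = (w + p * card (Lam n)) ^ m"
proof (induction m)
  case (Suc m)
  have "(\<Sum>xs\<in>words n (Suc m). weight w p xs) = (\<Sum>xs\<in>words n m. weight w p xs * (w + p * card (Lam n)))"
    using sum_words_Suc[of w p "\<lambda>_. 1" n m] by simp
  then show ?case using Suc by (simp flip: sum_distrib_right)
qed simp

text \<open>A Markov inequality in disguise: the convex function exp(\<xi>) - 1 - \<xi> is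
  nonnegative and decreasing for negative \<xi>. If exp(\<xi>) has mean at most 1, its mean is at
  most minus the mean of \<xi>, which is the Jensen defect.\<close>

lemma exp_convex_tail:
  fixes \<xi> v :: real
  assumes "v \<ge> 0"
  shows "(exp (- v) - 1 + v) * of_bool (\<xi> \<le> - v) \<le> exp \<xi> - 1 - \<xi>"
proof (cases "\<xi> \<le> - v")
  case True
  have "exp (- v) * (1 + (\<xi> + v)) \<le> exp (- v) * exp (\<xi> + v)"
    by (intro mult_left_mono exp_ge_add_one_self) auto
  also have "\<dots> = exp \<xi>" by (simp flip: exp_add)
  finally have "exp (- v) + exp (- v) * (\<xi> + v) \<le> exp \<xi>" by (simp add: algebra_simps)
  moreover have "exp (- v) * (\<xi> + v) \<ge> 1 * (\<xi> + v)"
    using True assms by (intro mult_right_mono_neg) auto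
  ultimately show ?thesis using True by simp
next
  case False
  then show ?thesis using exp_ge_add_one_self[of \<xi>] by (simp del: exp_ge_add_one_self)
qed

lemma exp_minus_gt:
  fixes v :: real
  assumes "v > 0"
  shows "exp (- v) - 1 + v > 0"
proof (cases "v < 2")
  case True
  have "(1 - v / 2)\<^sup>2 \<le> (exp (- (v / 2)))\<^sup>2"
    using True exp_ge_add_one_self[of "- (v / 2)"] by (intro power_mono) auto
  also have "(exp (- (v / 2)))\<^sup>2 = exp (- v)"
    by (simp add: power2_eq_square flip: exp_add)
  finally have "1 - v + v\<^sup>2 / 4 \<le> exp (- v)" by (simp add: power2_eq_square field_simps)
  moreover have "v\<^sup>2 > 0" using assms by simp
  ultimately show ?thesis by linarith
next
  case False
  then show ?thesis using exp_gt_zero[of "- v"] by linarith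
qed

section \<open>Lyapunov functions for the lazy dual chain\<close>

locale box_walk = box +
  fixes p :: real
  assumes p_nonneg: "p \<ge> 0" and p_le: "p * card (Lam n) \<le> 1"
begin

text \<open>Expectation after \<open>m\<close> steps of a genuine Markov chain: each site is updated
  with probability \<open>p\<close>, and all remaining probability is given to the empty
  letter.\<close>

definition expect :: "nat \<Rightarrow> (height \<Rightarrow> real) \<Rightarrow> real" where
  "expect m g = (\<Sum>xs\<in>words n m. weight (1 - p * card (Lam n)) p xs * g (evolve n xs))"

lemma w_nonneg: "1 - p * card (Lam n) \<ge> 0" using p_le by simp

lemma admissible_evolve: "xs \<in> words n m \<Longrightarrow> admissible (evolve n xs)"
proof (induction xs arbitrary: m)
  case Nil then show ?case by (simp add: admissible_ground)
next
  case (Cons c xs)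
  then have "admissible (evolve n xs)" by (cases m) (auto simp: words_def)
  moreover have "c = None \<or> (\<exists>x\<in>Lam n. c = Some x)" using Cons.prems by (auto simp: words_def)
  ultimately show ?case using admissible_upd by auto
qed

lemma expect_0 [simp]: "expect 0 g = g (ground n)" by (simp add: expect_def)

lemma expect_Suc: "expect (Suc m) g = expect m (\<lambda>\<psi>. (1 - p * card (Lam n)) * g \<psi> + p * (\<Sum>x\<in>Lam n. g (upd n x \<psi>)))"
  unfolding expect_def sum_words_Suc by simp

lemma expect_mono:
  fixes g g' :: "height \<Rightarrow> real"
  shows "(\<And>\<psi>. admissible \<psi> \<Longrightarrow> g \<psi> \<le> g' \<psi>) \<Longrightarrow> expect m g \<le> expect m g'"
  unfolding expect_def
  by (intro sum_mono mult_left_mono weight_nonneg w_nonneg p_nonneg) (auto intro: admissible_evolve)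

lemma expect_const [simp]: "expect m (\<lambda>_. c) = c"
  by (simp add: expect_def sum_weight flip: sum_distrib_right)

lemma expect_add: "expect m (\<lambda>\<psi>. f \<psi> + g \<psi>) = expect m f + expect m g"
  by (simp add: expect_def sum.distrib algebra_simps)

lemma expect_cmult: "expect m (\<lambda>\<psi>. c * g \<psi>) = c * expect m g"
  by (simp add: expect_def sum_distrib_left mult_ac)

lemma p_le_1: "p \<le> 1"
proof -
  have "card (Lam n) \<ge> 1" using one_in by (metis card_0_eq empty_iff finite_Lam less_one linorder_not_less)
  then have "p * 1 \<le> p * card (Lam n)" using p_nonneg by (intro mult_left_mono) auto
  then show ?thesis using p_le by simp
qed

text \<open>A discrete Gronwall argument: any supersolution \<open>u\<close> of the averaged
  recursion dominates. The bound on \<open>\<alpha>\<close>, with \<open>p\<close> at most 1, keeps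
  the factor \<open>1 - p * \<alpha>\<close> nonnegative, so the induction hypothesis may be
  multiplied by it.\<close>

lemma expect_drift:
  fixes \<alpha> \<beta> :: real and u :: "nat \<Rightarrow> real" and g :: "height \<Rightarrow> real"
  assumes step: "\<And>\<psi>. admissible \<psi> \<Longrightarrow> (\<Sum>x\<in>Lam n. g (upd n x \<psi>)) \<le> card (Lam n) * g \<psi> - \<alpha> * g \<psi> + \<beta>"
    and \<alpha>: "\<alpha> \<le> 1"
    and u0: "g (ground n) \<le> u 0"
    and u: "\<And>m. (1 - p * \<alpha>) * u m + p * \<beta> \<le> u (Suc m)"
  shows "expect m g \<le> u m"
proof (induction m)
  case (Suc m)
  have "expect (Suc m) g \<le> expect m (\<lambda>\<psi>. (1 - p * \<alpha>) * g \<psi> + p * \<beta>)"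
    unfolding expect_Suc
  proof (rule expect_mono)
    fix \<psi> assume "admissible \<psi>"
    from mult_left_mono[OF step[OF this] p_nonneg]
    show "(1 - p * card (Lam n)) * g \<psi> + p * (\<Sum>x\<in>Lam n. g (upd n x \<psi>)) \<le> (1 - p * \<alpha>) * g \<psi> + p * \<beta>"
      by (simp add: algebra_simps)
  qed
  also have "\<dots> = (1 - p * \<alpha>) * expect m g + p * \<beta>"
    by (simp add: expect_add expect_cmult)
  also have "\<dots> \<le> (1 - p * \<alpha>) * u m + p * \<beta>"
  proof -
    have "p * \<alpha> \<le> p * 1" using \<alpha> p_nonneg by (intro mult_left_mono)
    then show ?thesis using p_le_1 Suc.IH by (intro add_right_mono mult_left_mono) auto
  qed
  finally show ?case using u[of m] by linarith
qed (use u0 in simp)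

lemma expect_mass: "expect m mass \<le> msq n * exp (- (m * p * gap n))"
proof -
  have "expect m mass \<le> msq n * (1 - p * gap n) ^ m"
    by (rule expect_drift[where \<alpha> = "gap n" and \<beta> = 0 and u = "\<lambda>m. msq n * (1 - p * gap n) ^ m"])
       (use gap_le in \<open>auto simp: sum_mass_upd mass_ground algebra_simps\<close>)
  also have "(1 - p * gap n) ^ m \<le> exp (- (p * gap n)) ^ m"
  proof (rule power_mono)
    show "1 - p * gap n \<le> exp (- (p * gap n))" using exp_ge_add_one_self[of "- (p * gap n)"] by simp
    have "p * gap n \<le> 1 * 1" using p_le_1 gap_le gap_pos p_nonneg by (intro mult_mono) auto
    then show "0 \<le> 1 - p * gap n" by simp
  qed
  also have "exp (- (p * gap n)) ^ m = exp (- (m * p * gap n))"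
    by (simp add: mult_ac flip: exp_of_nat_mult)
  finally show ?thesis using msq_pos by simp
qed

lemma green_ratio_ground: "green_ratio (ground n) = 1 / (gap n * msq n)"
  by (simp add: green_ratio_def green_ground mass_ground power2_eq_square)

text \<open>The weight 20 of \<open>green_ratio\<close> is chosen so that its drift, -20/10 times
  \<open>(gap n)\<^sup>2 * norm_ratio\<close>, cancels the second-order loss of the logarithm. What
  remains is its initial value, of order n^-4, and the source 20 * 3
  \<open>(gap n)\<^sup>2 / msq n\<close> per unit of \<open>m * p\<close>, of order n^-6.\<close>

lemma expect_ln_mass:
  "expect m (\<lambda>\<psi>. ln (mass \<psi>)) \<ge> ln (msq n) - m * p * gap n - (20 * gap n / msq n + m * p * (60 * (gap n)\<^sup>2 / msq n))"
proof -
  define \<beta> where "\<beta> = gap n + 60 * (gap n)\<^sup>2 / msq n"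
  define f where "f \<psi> = - ln (mass \<psi>) + 20 * (gap n)\<^sup>2 * green_ratio \<psi>" for \<psi>
  have "expect m f \<le> - ln (msq n) + 20 * gap n / msq n + m * (p * \<beta>)"
  proof (rule expect_drift[where \<alpha> = 0 and \<beta> = \<beta> and u = "\<lambda>m. - ln (msq n) + 20 * gap n / msq n + m * (p * \<beta>)"])
    fix \<psi> assume a: "admissible \<psi>"
    have "(\<Sum>x\<in>Lam n. f (upd n x \<psi>)) = - (\<Sum>x\<in>Lam n. ln (mass (upd n x \<psi>))) + 20 * (gap n)\<^sup>2 * (\<Sum>x\<in>Lam n. green_ratio (upd n x \<psi>))"
      by (simp only: f_def sum.distrib sum_negf sum_distrib_left)
    also have "\<dots> \<le> - (card (Lam n) * ln (mass \<psi>) - gap n - 2 * (gap n)\<^sup>2 * norm_ratio \<psi>)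
        + 20 * (gap n)\<^sup>2 * (card (Lam n) * green_ratio \<psi> + 3 / msq n - norm_ratio \<psi> / 10)"
      by (intro add_mono mult_left_mono le_imp_neg_le sum_ln_mass_upd sum_green_ratio_upd a) auto
    also have "\<dots> = card (Lam n) * f \<psi> - 0 * f \<psi> + \<beta>"
      by (simp add: f_def \<beta>_def algebra_simps)
    finally show "(\<Sum>x\<in>Lam n. f (upd n x \<psi>)) \<le> card (Lam n) * f \<psi> - 0 * f \<psi> + \<beta>" .
  next
    show "f (ground n) \<le> - ln (msq n) + 20 * gap n / msq n + real 0 * (p * \<beta>)"
      using gap_pos msq_pos by (simp add: f_def mass_ground green_ratio_ground power2_eq_square)
  qed (auto simp: algebra_simps)
  moreover have "expect m f \<ge> expect m (\<lambda>\<psi>. (- 1) * ln (mass \<psi>))"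
    by (intro expect_mono) (simp add: f_def green_ratio_nonneg)
  ultimately show ?thesis
    unfolding expect_cmult by (simp add: \<beta>_def algebra_simps)
qed

text \<open>The added \<open>green_ratio\<close>, with weight \<open>100 * l2\<close>, has drift
  \<open>- 10 * l2 * norm_ratio\<close>. One half cancels the squared jumps of the coefficient; the
  other half dominates \<open>gap n / 20\<close> times the added term itself. The bound is the fixed
  point of the resulting recursion, 300 * 20 = 6000, and is uniform in \<open>m\<close>.\<close>

lemma expect_coef_ratio:
  assumes k: "k \<in> Lam n" "k \<noteq> (1, 1)"
  shows "expect m (coef_ratio k) \<le> 6000 * (eig n k)\<^sup>2 / (gap n * msq n)"
proof -
  define l2 where "l2 = (eig n k)\<^sup>2"
  have l2: "l2 \<ge> 0" by (simp add: l2_def)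
  define f where "f \<psi> = coef_ratio k \<psi> + 100 * l2 * green_ratio \<psi>" for \<psi>
  have "expect m f \<le> 6000 * l2 / (gap n * msq n)"
  proof (rule expect_drift[where \<alpha> = "gap n / 20" and \<beta> = "300 * l2 / msq n" and u = "\<lambda>_. 6000 * l2 / (gap n * msq n)"])
    fix \<psi> assume a: "admissible \<psi>"
    have "(\<Sum>x\<in>Lam n. f (upd n x \<psi>)) = (\<Sum>x\<in>Lam n. coef_ratio k (upd n x \<psi>)) + 100 * l2 * (\<Sum>x\<in>Lam n. green_ratio (upd n x \<psi>))"
      by (simp add: f_def sum.distrib sum_distrib_left)
    also have "\<dots> \<le> (card (Lam n) * coef_ratio k \<psi> - gap n * coef_ratio k \<psi> + 5 * l2 * norm_ratio \<psi>)
        + 100 * l2 * (card (Lam n) * green_ratio \<psi> + 3 / msq n - norm_ratio \<psi> / 10)"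
      unfolding l2_def by (intro add_mono mult_left_mono sum_coef_ratio_upd sum_green_ratio_upd a k) auto
    also have "\<dots> = card (Lam n) * f \<psi> - gap n * coef_ratio k \<psi> - 5 * l2 * norm_ratio \<psi> + 300 * l2 / msq n"
      by (simp add: f_def algebra_simps)
    also have "\<dots> \<le> card (Lam n) * f \<psi> - gap n / 20 * coef_ratio k \<psi> - 5 * l2 * (gap n * green_ratio \<psi>) + 300 * l2 / msq n"
    proof -
      have "gap n / 20 * coef_ratio k \<psi> \<le> gap n * coef_ratio k \<psi>" using gap_pos by (intro mult_right_mono) (auto simp: coef_ratio_def)
      moreover have "5 * l2 * (gap n * green_ratio \<psi>) \<le> 5 * l2 * norm_ratio \<psi>"
        using l2 green_ratio_le(1)[OF a] by (intro mult_left_mono) auto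
      ultimately show ?thesis by linarith
    qed
    also have "\<dots> = card (Lam n) * f \<psi> - gap n / 20 * f \<psi> + 300 * l2 / msq n"
      by (simp add: f_def algebra_simps)
    finally show "(\<Sum>x\<in>Lam n. f (upd n x \<psi>)) \<le> card (Lam n) * f \<psi> - gap n / 20 * f \<psi> + 300 * l2 / msq n" .
  next
    have "coef_ratio k (ground n) = 0" using coef_ground[OF k(1)] k by (simp add: coef_ratio_def)
    then show "f (ground n) \<le> 6000 * l2 / (gap n * msq n)"
      using gap_pos msq_pos l2 by (simp add: f_def green_ratio_ground divide_right_mono)
    show "(1 - p * (gap n / 20)) * (6000 * l2 / (gap n * msq n)) + p * (300 * l2 / msq n) \<le> 6000 * l2 / (gap n * msq n)"
      using gap_pos msq_pos by (simp add: field_simps)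
  qed (use gap_le in auto)
  moreover have "expect m (coef_ratio k) \<le> expect m f"
    by (intro expect_mono) (simp add: f_def green_ratio_nonneg l2)
  ultimately show ?thesis by (simp add: l2_def)
qed

text \<open>Here \<open>\<xi>\<close> is the logarithm of \<open>mass\<close> relative to its bound
  in expectation, so exp(\<xi>) has mean at most 1 and the convex tail bound applies.\<close>

lemma expect_mass_small:
  assumes v: "v > 0"
  shows "expect m (\<lambda>\<psi>. of_bool (mass \<psi> \<le> msq n * exp (- v - m * p * gap n))) * (exp (- v) - 1 + v)
    \<le> 20 * gap n / msq n + m * p * (60 * (gap n)\<^sup>2 / msq n)"
proof -
  define \<xi> where "\<xi> \<psi> = ln (mass \<psi>) - ln (msq n) + m * p * gap n" for \<psi>
  have "expect m (\<lambda>\<psi>. (exp (- v) - 1 + v) * of_bool (mass \<psi> \<le> msq n * exp (- v - m * p * gap n)))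
    \<le> expect m (\<lambda>\<psi>. exp (m * p * gap n) / msq n * mass \<psi> + ((- 1) * ln (mass \<psi>) + (- 1 + ln (msq n) - m * p * gap n)))"
  proof (rule expect_mono)
    fix \<psi> assume "admissible \<psi>"
    then have F: "mass \<psi> > 0" by (simp add: admissible_def)
    have "mass \<psi> \<le> msq n * exp (- v - m * p * gap n) \<longleftrightarrow> \<xi> \<psi> \<le> - v"
    proof -
      have "mass \<psi> \<le> msq n * exp (- v - m * p * gap n) \<longleftrightarrow> ln (mass \<psi>) \<le> ln (msq n * exp (- v - m * p * gap n))"
        using F msq_pos by (subst ln_le_cancel_iff) auto
      then show ?thesis using msq_pos by (auto simp: ln_mult \<xi>_def)
    qed
    moreover have "exp (\<xi> \<psi>) = exp (m * p * gap n) / msq n * mass \<psi>"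
      using F msq_pos by (simp add: \<xi>_def exp_add exp_diff)
    ultimately show "(exp (- v) - 1 + v) * of_bool (mass \<psi> \<le> msq n * exp (- v - m * p * gap n))
       \<le> exp (m * p * gap n) / msq n * mass \<psi> + ((- 1) * ln (mass \<psi>) + (- 1 + ln (msq n) - m * p * gap n))"
      using exp_convex_tail[of v "\<xi> \<psi>"] v by (simp add: \<xi>_def)
  qed
  also have "\<dots> = exp (m * p * gap n) / msq n * expect m mass + ((- 1) * expect m (\<lambda>\<psi>. ln (mass \<psi>)) + (- 1 + ln (msq n) - m * p * gap n))"
    unfolding expect_add expect_cmult expect_const ..
  also have "exp (m * p * gap n) / msq n * expect m mass \<le> exp (m * p * gap n) / msq n * (msq n * exp (- (m * p * gap n)))"
    using msq_pos by (intro mult_left_mono expect_mass) auto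
  also have "\<dots> = 1" using msq_pos by (simp flip: exp_add)
  finally show ?thesis
    using expect_ln_mass[of m] unfolding expect_cmult by (simp add: mult.commute)
qed

text \<open>A union bound: \<open>mass\<close> fails by the logarithmic tail estimate, and each mode
  in \<open>K\<close> fails by Markov's inequality for its squared ratio.\<close>

lemma weight_bad_words:
  assumes v: "v > 0" and K: "finite K" "K \<subseteq> Lam n - {(1, 1)}" and \<epsilon>: "\<epsilon> > 0"
  shows "(\<Sum>xs | xs \<in> words n m \<and> \<not> (msq n * exp (- v - m * p * gap n) \<le> mass (evolve n xs) \<and>
        (\<forall>k\<in>K. \<bar>coef n (evolve n xs) k\<bar> \<le> \<epsilon> * mass (evolve n xs))). weight (1 - p * card (Lam n)) p xs)
    \<le> (20 * gap n / msq n + m * p * (60 * (gap n)\<^sup>2 / msq n)) / (exp (- v) - 1 + v)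
      + (\<Sum>k\<in>K. 6000 * (eig n k)\<^sup>2 / (gap n * msq n)) / \<epsilon>\<^sup>2"
proof -
  define bad where "bad \<psi> \<longleftrightarrow> \<not> (msq n * exp (- v - m * p * gap n) \<le> mass \<psi> \<and> (\<forall>k\<in>K. \<bar>coef n \<psi> k\<bar> \<le> \<epsilon> * mass \<psi>))" for \<psi>
  have h: "exp (- v) - 1 + v > 0" by (rule exp_minus_gt[OF v])
  have "(\<Sum>xs | xs \<in> words n m \<and> bad (evolve n xs). weight (1 - p * card (Lam n)) p xs) = expect m (\<lambda>\<psi>. of_bool (bad \<psi>))"
    unfolding expect_def by (intro sum.mono_neutral_cong_left) (auto split: if_splits)
  also have "\<dots> \<le> expect m (\<lambda>\<psi>. of_bool (mass \<psi> \<le> msq n * exp (- v - m * p * gap n)) + (1 / \<epsilon>\<^sup>2) * (\<Sum>k\<in>K. coef_ratio k \<psi>))"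
  proof (rule expect_mono)
    fix \<psi> assume "admissible \<psi>"
    then have F: "mass \<psi> > 0" by (simp add: admissible_def)
    have g: "(\<Sum>k\<in>K. coef_ratio k \<psi>) \<ge> 0" by (intro sum_nonneg) (auto simp: coef_ratio_def)
    show "of_bool (bad \<psi>) \<le> of_bool (mass \<psi> \<le> msq n * exp (- v - m * p * gap n)) + (1 / \<epsilon>\<^sup>2) * (\<Sum>k\<in>K. coef_ratio k \<psi>)"
    proof (cases "\<exists>k\<in>K. \<bar>coef n \<psi> k\<bar> > \<epsilon> * mass \<psi>")
      case True
      then obtain k where k: "k \<in> K" "\<bar>coef n \<psi> k\<bar> > \<epsilon> * mass \<psi>" by blast
      have "\<epsilon> \<le> \<bar>coef n \<psi> k / mass \<psi>\<bar>" using k F by (simp add: field_simps)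
      then have "\<epsilon>\<^sup>2 \<le> \<bar>coef n \<psi> k / mass \<psi>\<bar>\<^sup>2" using \<epsilon> by (intro power_mono) auto
      then have "\<epsilon>\<^sup>2 \<le> coef_ratio k \<psi>" by (simp only: coef_ratio_def power2_abs)
      also have "coef_ratio k \<psi> \<le> (\<Sum>k\<in>K. coef_ratio k \<psi>)" using k K by (intro member_le_sum) (auto simp: coef_ratio_def)
      finally have "1 \<le> (1 / \<epsilon>\<^sup>2) * (\<Sum>k\<in>K. coef_ratio k \<psi>)" using \<epsilon> by (simp add: field_simps)
      then show ?thesis by (simp add: of_bool_def)
    next
      case False
      then show ?thesis using g by (auto simp: bad_def of_bool_def not_less)
    qed
  qed
  also have "\<dots> = expect m (\<lambda>\<psi>. of_bool (mass \<psi> \<le> msq n * exp (- v - m * p * gap n))) + (1 / \<epsilon>\<^sup>2) * (\<Sum>k\<in>K. expect m (coef_ratio k))"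
  proof -
    have "expect m (\<lambda>\<psi>. \<Sum>k\<in>K. coef_ratio k \<psi>) = (\<Sum>k\<in>K. expect m (coef_ratio k))"
      unfolding expect_def by (subst sum.swap) (simp add: sum_distrib_left)
    then show ?thesis unfolding expect_add expect_cmult by simp
  qed
  also have "\<dots> \<le> (20 * gap n / msq n + m * p * (60 * (gap n)\<^sup>2 / msq n)) / (exp (- v) - 1 + v)
      + (1 / \<epsilon>\<^sup>2) * (\<Sum>k\<in>K. 6000 * (eig n k)\<^sup>2 / (gap n * msq n))"
    using expect_mass_small[OF v, of m] h K
    by (intro add_mono mult_left_mono sum_mono expect_coef_ratio) (auto simp: pos_le_divide_eq)
  finally show ?thesis by (simp add: bad_def)
qed

end

subsection \<open>Approximating the square wave\<close>

text \<open>The map z to (1 + z)/(1 - z) sends the unit disc into the right half-plane. Both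
  principal arguments are below pi/2 in modulus, so their difference stays in the principal range
  and is the argument of the quotient.\<close>

lemma Im_Ln_quotient_bound:
  assumes "cmod z < 1"
  shows "\<bar>Im (ln (1 + z) - ln (1 - z))\<bar> \<le> pi / 2"
proof -
  have re: "\<bar>Re z\<bar> < 1" using assms abs_Re_le_cmod[of z] by linarith
  have nz: "1 + z \<noteq> 0" "1 - z \<noteq> 0" using assms by (auto simp: add_eq_0_iff)
  have im: "\<bar>Im (ln (1 + z))\<bar> < pi / 2" "\<bar>Im (ln (1 - z))\<bar> < pi / 2"
    using re nz by (subst Re_Ln_pos_lt; auto)+
  have "exp (ln (1 + z) - ln (1 - z)) = (1 + z) / (1 - z)"
    using nz by (simp add: exp_diff)
  then have e: "ln ((1 + z) / (1 - z)) = ln (1 + z) - ln (1 - z)"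
    by (rule Ln_unique) (use im in auto)
  have "Re ((1 + z) / (1 - z)) > 0"
  proof -
    have "(Re z)\<^sup>2 + (Im z)\<^sup>2 < 1"
      using assms unfolding cmod_def by (simp add: real_sqrt_lt_1_iff)
    moreover have "Re ((1 + z) / (1 - z)) = (1 - ((Re z)\<^sup>2 + (Im z)\<^sup>2)) / ((1 - Re z)\<^sup>2 + (Im z)\<^sup>2)"
      by (simp add: Re_divide power2_eq_square algebra_simps)
    moreover have "(1 - Re z)\<^sup>2 + (Im z)\<^sup>2 > 0"
      using re by (intro add_pos_nonneg) auto
    ultimately show ?thesis by (simp add: divide_pos_pos)
  qed
  then have "\<bar>Im (ln ((1 + z) / (1 - z)))\<bar> < pi / 2" using nz by (subst Re_Ln_pos_lt) auto
  then show ?thesis by (simp add: e)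
qed

text \<open>
  The trigonometric polynomials are truncated Abel means of the square wave, whose first Fourier
  coefficient is \<open>4 / \<pi>\<close>; the Abel mean at radius \<open>r\<close> is \<open>2 / \<pi>\<close> times the argument of
  \<open>(1 + z) / (1 - z)\<close> with \<open>z = r e\<^sup>i\<^sup>\<theta>\<close>, hence bounded by 1.
\<close>

lemma square_wave_approximation:
  fixes \<delta> :: real
  assumes "0 < \<delta>" "\<delta> < 1"
  obtains J c where "\<And>\<theta>::real. \<bar>\<Sum>j\<in>{1..J}. c j * sin (real j * \<theta>)\<bar> \<le> 1" "c 1 \<ge> 4 / pi - \<delta>" "J \<ge> 1"
proof -
  define \<eta> where "\<eta> = \<delta> / 4"
  have \<eta>: "0 < \<eta>" "\<eta> < 1 / 4" using assms by (auto simp: \<eta>_def)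
  define r where "r = 1 - \<eta>"
  have r: "0 < r" "r < 1" using \<eta> by (auto simp: r_def)
  define a where "a j = (1 - (- 1) ^ j) / real j * r ^ j" for j :: nat
  have a_bound: "\<bar>a j\<bar> \<le> 2 * r ^ j" for j
  proof -
    have "\<bar>(1 - (- 1) ^ j) / real j\<bar> \<le> 2"
      by (cases "j = 0"; cases "even j") (auto simp: field_simps)
    from mult_right_mono[OF this, of "r ^ j"] show ?thesis using r by (simp add: a_def abs_mult)
  qed
  have sm: "summable (\<lambda>j. 2 * r ^ j)" using r by (intro summable_mult summable_geometric) auto
  have abel: "(\<lambda>j. a j * sin (real j * \<theta>)) sums Im (ln (1 + r * cis \<theta>) - ln (1 - r * cis \<theta>))" for \<theta>
  proof -
    define z where "z = r * cis \<theta>"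
    have z: "cmod z < 1" using r by (simp add: z_def norm_mult)
    have "(\<lambda>n. - ((-z)^n) / of_nat n - (- ((- (-z))^n) / of_nat n)) sums (ln (1 + z) - ln (1 + (- z)))"
      by (intro sums_diff Ln_series') (use z in auto)
    then have "(\<lambda>n. Im (- ((-z)^n) / of_nat n - (- ((- (-z))^n) / of_nat n))) sums Im (ln (1 + z) - ln (1 + (- z)))"
      by (rule sums_Im)
    moreover have "Im (- ((-z)^n) / of_nat n - (- ((- (-z))^n) / of_nat n)) = a n * sin (real n * \<theta>)" for n
    proof -
      have "(- z) ^ n = (- 1) ^ n * z ^ n" by (rule power_minus)
      moreover have "z ^ n = of_real (r ^ n) * cis (real n * \<theta>)"
        by (simp add: z_def power_mult_distrib Complex.DeMoivre)
      ultimately have "- ((-z)^n) / of_nat n - (- ((- (-z))^n) / of_nat n) =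
          of_real ((1 - (- 1) ^ n) / real n * r ^ n) * cis (real n * \<theta>)"
        by (simp add: algebra_simps diff_divide_distrib)
      also have "Im \<dots> = a n * sin (real n * \<theta>)" unfolding times_complex.sel Re_complex_of_real Im_complex_of_real cis.sel a_def by simp
      finally show ?thesis .
    qed
    ultimately show ?thesis by (simp add: z_def)
  qed
  obtain J0 where J0: "\<And>m. m \<ge> J0 \<Longrightarrow> \<bar>\<Sum>j. 2 * r ^ (j + m)\<bar> < \<eta>"
    using suminf_exist_split[OF \<eta>(1) sm] by auto
  define J where "J = J0 + 1"
  have part: "\<bar>\<Sum>j\<in>{1..J}. a j * sin (real j * \<theta>)\<bar> \<le> pi / 2 + \<eta>" for \<theta>
  proof -
    define g where "g j = a j * sin (real j * \<theta>)" for j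
    have gb: "norm (g j) \<le> 2 * r ^ j" for j
    proof -
      have "\<bar>a j\<bar> * \<bar>sin (real j * \<theta>)\<bar> \<le> (2 * r ^ j) * 1"
        using a_bound r by (intro mult_mono) auto
      then show ?thesis by (simp add: g_def abs_mult)
    qed
    have gs: "summable g" by (rule summable_comparison_test'[OF sm, of 0]) (use gb in auto)
    have "\<bar>suminf g\<bar> \<le> pi / 2"
    proof -
      have "suminf g = Im (ln (1 + r * cis \<theta>) - ln (1 - r * cis \<theta>))"
        using abel[of \<theta>] unfolding g_def by (rule sums_unique[symmetric])
      then show ?thesis using Im_Ln_quotient_bound[of "r * cis \<theta>"] r by (simp add: norm_mult)
    qed
    moreover have "suminf g = (\<Sum>j. g (j + Suc J)) + (\<Sum>j<Suc J. g j)"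
      by (rule suminf_split_initial_segment[OF gs])
    moreover have "\<bar>\<Sum>j. g (j + Suc J)\<bar> \<le> (\<Sum>j. 2 * r ^ (j + Suc J))"
      using gb norm_suminf_le[of "\<lambda>j. g (j + Suc J)" "\<lambda>j. 2 * r ^ (j + Suc J)"]
        summable_iff_shift[of "\<lambda>j. 2 * r ^ j" "Suc J"] sm by (simp del: power_Suc add_Suc_right)
    moreover have "\<dots> < \<eta>" using J0[of "Suc J"] by (simp add: J_def)
    moreover have "(\<Sum>j<Suc J. g j) = (\<Sum>j\<in>{1..J}. g j)"
    proof -
      have "{..<Suc J} = insert 0 {1..J}" by auto
      then show ?thesis by (simp add: g_def)
    qed
    ultimately show ?thesis unfolding g_def by linarith
  qed
  \<comment> \<open>Dividing by \<open>1 + \<eta>\<close> restores the bound 1 after truncation. The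
    cost for the first coefficient is the factor (1 - \<eta>)/(1 + \<eta>), which explains \<eta> =
    \<delta>/4.\<close>
  define c where "c j = 2 / pi * a j / (1 + \<eta>)" for j
  show ?thesis
  proof (rule that[of c J])
    fix \<theta> :: real
    have "(\<Sum>j\<in>{1..J}. c j * sin (real j * \<theta>)) = (\<Sum>j\<in>{1..J}. a j * sin (real j * \<theta>)) * (2 / pi / (1 + \<eta>))"
      unfolding sum_distrib_right by (intro sum.cong refl) (simp add: c_def)
    then have "\<bar>\<Sum>j\<in>{1..J}. c j * sin (real j * \<theta>)\<bar> = \<bar>\<Sum>j\<in>{1..J}. a j * sin (real j * \<theta>)\<bar> * (2 / pi / (1 + \<eta>))"
      using \<eta> by (simp add: abs_mult)
    also have "\<dots> \<le> (pi / 2 + \<eta>) * (2 / pi / (1 + \<eta>))"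
      using part \<eta> by (intro mult_right_mono) auto
    also have "\<dots> = (1 + \<eta> * (2 / pi)) / (1 + \<eta>)" by (simp add: add_divide_distrib distrib_right)
    also have "\<dots> \<le> 1"
    proof -
      have "\<eta> * (2 / pi) \<le> \<eta> * 1" using \<eta> pi_gt3 by (intro mult_left_mono) auto
      then show ?thesis using \<eta> by simp
    qed
    finally show "\<bar>\<Sum>j\<in>{1..J}. c j * sin (real j * \<theta>)\<bar> \<le> 1" .
    have "(1 - 2 * \<eta>) * (1 + \<eta>) \<le> 1 - \<eta>" using \<eta> by (simp add: algebra_simps)
    then have "(1 - 2 * \<eta>) \<le> (1 - \<eta>) / (1 + \<eta>)" using \<eta> by (simp add: pos_le_divide_eq)
    then have "4 / pi * (1 - 2 * \<eta>) \<le> 4 / pi * ((1 - \<eta>) / (1 + \<eta>))"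
      by (intro mult_left_mono) auto
    moreover have "c 1 = 4 / pi * ((1 - \<eta>) / (1 + \<eta>))"
      by (simp add: c_def a_def r_def)
    moreover have "4 / pi * (2 * \<eta>) \<le> \<delta>"
      using pi_gt3 assms by (simp add: \<eta>_def field_simps)
    ultimately show "4 / pi - \<delta> \<le> c 1" by (simp add: algebra_simps)
  qed (simp add: J_def)
qed

subsection \<open>The law of the ground-state coefficient under the DGFF\<close>

lemma finite_bdry [simp]: "finite (bdry n)"
proof (rule finite_subset)
  show "bdry n \<subseteq> (\<Union>x\<in>Lam n. {y. adj x y})"
    by (auto simp: bdry_def adj_def site_dist_def abs_minus_commute)
qed auto

lemma adj_Lam_subset: "x \<in> Lam n \<Longrightarrow> adj x y \<Longrightarrow> y \<in> Lam n \<union> bdry n"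
  by (auto simp: bdry_def adj_def site_dist_def abs_minus_commute)

text \<open>Summation by parts over ordered pairs: swapping the two ends symmetrises the square.
  Boundary sites drop out because the extended height vanishes there, and each interior site sees
  all four of its neighbours.\<close>

lemma gradient_energy_eq_sum:
  "gradient_energy n h = (\<Sum>x\<in>Lam n. h x * (4 * h x - (\<Sum>y | adj x y. zero_ext n h y)))"
proof -
  define u where "u = zero_ext n h"
  define V where "V = Lam n \<union> bdry n"
  define S where "S = {(x, y). x \<in> V \<and> y \<in> V \<and> adj x y}"
  have S: "S = Sigma V (\<lambda>x. {y\<in>V. adj x y})" by (auto simp: S_def)
  have fV: "finite V" by (simp add: V_def)
  have "(\<Sum>(x, y)\<in>S. (u x - u y)\<^sup>2) = (\<Sum>(x, y)\<in>S. u x * (u x - u y)) + (\<Sum>(x, y)\<in>S. u y * (u y - u x))"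
    by (simp add: power2_eq_square algebra_simps case_prod_unfold flip: sum.distrib)
  also have "(\<Sum>(x, y)\<in>S. u y * (u y - u x)) = (\<Sum>(x, y)\<in>S. u x * (u x - u y))"
    by (rule sum.reindex_bij_witness[of _ prod.swap prod.swap]) (auto simp: S_def adj_commute)
  also have "(\<Sum>(x, y)\<in>S. u x * (u x - u y)) = (\<Sum>x\<in>V. \<Sum>y | y \<in> V \<and> adj x y. u x * (u x - u y))"
    unfolding S using fV by (subst sum.Sigma) auto
  also have "\<dots> = (\<Sum>x\<in>Lam n. \<Sum>y | y \<in> V \<and> adj x y. u x * (u x - u y))"
    by (rule sum.mono_neutral_right) (use fV in \<open>auto simp: V_def u_def zero_ext_def\<close>)
  also have "\<dots> = (\<Sum>x\<in>Lam n. h x * (4 * h x - (\<Sum>y | adj x y. u y)))"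
  proof (rule sum.cong[OF refl])
    fix x assume x: "x \<in> Lam n"
    have "{y. y \<in> V \<and> adj x y} = {y. adj x y}" using adj_Lam_subset[OF x] by (auto simp: V_def)
    moreover have "u x = h x" using x by (simp add: u_def zero_ext_def)
    moreover have "real (card {y. adj x y}) = 4" by (simp add: adj_set)
    ultimately show "(\<Sum>y | y \<in> V \<and> adj x y. u x * (u x - u y)) = h x * (4 * h x - (\<Sum>y | adj x y. u y))"
      by (simp add: sum_subtractf flip: sum_distrib_left)
  qed
  finally show ?thesis
    by (simp add: gradient_energy_def S_def V_def u_def)
qed

lemma gradient_energy_eq_coef:
  "gradient_energy n h = 4 * (\<Sum>k\<in>Lam n. eig n k * (coef n h k)\<^sup>2) / msq n"
proof (cases "Lam n = {}")
  case True then show ?thesis by (simp add: gradient_energy_eq_sum)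
next
  case False
  then have N: "msq n > 0" using Lam_msq_pos by blast
  have h: "h x = (\<Sum>k\<in>Lam n. coef n h k * mode n k x) / msq n" if "x \<in> Lam n" for x
    using coef_inversion[OF that, of h] N by (simp add: field_simps)
  have lap: "4 * h x - (\<Sum>y | adj x y. zero_ext n h y) = 4 * (\<Sum>k\<in>Lam n. eig n k * coef n h k * mode n k x) / msq n"
    if x: "x \<in> Lam n" for x
  proof -
    have "(\<Sum>y | adj x y. zero_ext n h y) = (\<Sum>y | adj x y. (\<Sum>k\<in>Lam n. coef n h k * mode n k y) / msq n)"
    proof (rule sum.cong[OF refl])
      fix y assume "y \<in> {y. adj x y}"
      then have "y \<notin> Lam n \<Longrightarrow> mode n k y = 0" for k using mode_zero[OF x] by auto
      then show "zero_ext n h y = (\<Sum>k\<in>Lam n. coef n h k * mode n k y) / msq n"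
        by (auto simp: zero_ext_def h)
    qed
    also have "\<dots> = (\<Sum>k\<in>Lam n. coef n h k * (\<Sum>y | adj x y. mode n k y)) / msq n"
      unfolding sum_divide_distrib[symmetric] by (subst sum.swap) (simp add: sum_distrib_left)
    also have "\<dots> = (\<Sum>k\<in>Lam n. coef n h k * (4 * ((1 - eig n k) * mode n k x))) / msq n"
      by (simp flip: mode_eigen)
    finally show ?thesis
      using N by (simp add: h[OF x] field_simps sum_distrib_left flip: sum_subtractf)
  qed
  have "gradient_energy n h = (\<Sum>x\<in>Lam n. \<Sum>k\<in>Lam n. 4 * (eig n k * coef n h k * (h x * mode n k x)) / msq n)"
    unfolding gradient_energy_eq_sum
  proof (rule sum.cong[OF refl])
    fix x assume x: "x \<in> Lam n"
    show "h x * (4 * h x - (\<Sum>y | adj x y. zero_ext n h y)) = (\<Sum>k\<in>Lam n. 4 * (eig n k * coef n h k * (h x * mode n k x)) / msq n)"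
      unfolding lap[OF x] by (simp add: sum_distrib_left sum_divide_distrib mult_ac)
  qed
  also have "\<dots> = (\<Sum>k\<in>Lam n. 4 * (eig n k * coef n h k * (\<Sum>x\<in>Lam n. h x * mode n k x)) / msq n)"
    by (subst sum.swap) (simp add: sum_distrib_left sum_divide_distrib)
  also have "\<dots> = 4 * (\<Sum>k\<in>Lam n. eig n k * (coef n h k)\<^sup>2) / msq n"
    by (simp add: sum_distrib_left sum_divide_distrib power2_eq_square mult_ac flip: coef_def)
  finally show ?thesis .
qed

lemma coef_shift:
  "coef n (\<lambda>x\<in>Lam n. h x + c * g x) k = coef n h k + c * coef n g k"
  by (simp add: coef_def sum_distrib_left sum.distrib algebra_simps)

interpretation lborel_product: product_sigma_finite "\<lambda>_::site. lborel :: real measure"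
  by standard

abbreviation vol :: "nat \<Rightarrow> height measure" where
  "vol n \<equiv> \<Pi>\<^sub>M x\<in>Lam n. lborel"

lemma vol_shift:
  "distr (vol n) (vol n) (\<lambda>h. \<lambda>x\<in>Lam n. h x + v x) = vol n"
proof (rule lborel_product.PiM_eqI)
  have m: "(\<lambda>h. \<lambda>x\<in>Lam n. h x + v x) \<in> vol n \<rightarrow>\<^sub>M vol n"
    by (intro measurable_restrict borel_measurable_add) (auto intro: measurable_component_singleton)
  fix A :: "site \<Rightarrow> real set" assume A: "\<And>i. i \<in> Lam n \<Longrightarrow> A i \<in> sets lborel"
  have "emeasure (distr (vol n) (vol n) (\<lambda>h. \<lambda>x\<in>Lam n. h x + v x)) (Pi\<^sub>E (Lam n) A) =
    emeasure (vol n) (Pi\<^sub>E (Lam n) (\<lambda>x. (\<lambda>y. y + v x) -` A x \<inter> space lborel))"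
    using A by (subst emeasure_distr[OF m])
      (auto simp: space_PiM intro!: arg_cong[where f = "emeasure (vol n)"] sets_PiM_I_finite, auto simp: PiE_def Pi_def extensional_def)
  also have "\<dots> = (\<Prod>x\<in>Lam n. emeasure lborel ((\<lambda>y. y + v x) -` A x \<inter> space lborel))"
  proof (intro lborel_product.emeasure_PiM)
    fix x assume "x \<in> Lam n"
    from A[OF this] show "(\<lambda>y. y + v x) -` A x \<inter> space lborel \<in> sets lborel"
      by (intro measurable_sets[where A = lborel and M = lborel]) auto
  qed simp
  also have "\<dots> = (\<Prod>x\<in>Lam n. emeasure lborel (A x))"
  proof (rule prod.cong[OF refl])
    fix x assume "x \<in> Lam n"
    then have "A x \<in> sets borel" using A by auto
    moreover have plus_swap: "(+) (v x) = (\<lambda>y. y + v x)" by (auto simp: add.commute)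
    ultimately have "emeasure (distr lborel borel ((+) (v x))) (A x) = emeasure lborel ((\<lambda>y. y + v x) -` A x \<inter> space lborel)"
      by (subst emeasure_distr) (auto simp: plus_swap)
    then show "emeasure lborel ((\<lambda>y. y + v x) -` A x \<inter> space lborel) = emeasure lborel (A x)"
      by (simp add: lborel_distr_plus)
  qed
  finally show "emeasure (distr (vol n) (vol n) (\<lambda>h. \<lambda>x\<in>Lam n. h x + v x)) (Pi\<^sub>E (Lam n) A) = (\<Prod>x\<in>Lam n. emeasure lborel (A x))" .
qed auto

lemma coef_measurable [measurable]: "(\<lambda>h. coef n h k) \<in> borel_measurable (vol n)"
  unfolding coef_def by measurable

lemma coef_measurable_borel [measurable]: "(\<lambda>h. coef n h k) \<in> borel_measurable (height_space n)"
  unfolding coef_def by measurable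

lemma dgff_weight_eq: "dgff_weight n h = exp (- (\<Sum>k\<in>Lam n. eig n k * (coef n h k)\<^sup>2) / (2 * msq n))"
  by (simp add: dgff_weight_def gradient_energy_eq_coef)

lemma dgff_weight_measurable [measurable]: "dgff_weight n \<in> borel_measurable (vol n)"
  unfolding dgff_weight_eq by measurable

text \<open>
  Integrate \<open>indicator {0..1} (f x) * indicator A (f x + c)\<close> over \<open>x\<close> and \<open>c\<close> in both orders.
\<close>

lemma translation_invariant_law:
  fixes f :: "'a \<Rightarrow> real"
  assumes \<mu>: "sigma_finite_measure \<mu>" and f [measurable]: "f \<in> borel_measurable \<mu>"
    and inv: "\<And>G s. G \<in> borel_measurable borel \<Longrightarrow> (\<integral>\<^sup>+x. G (f x) \<partial>\<mu>) = (\<integral>\<^sup>+x. G (f x + s) \<partial>\<mu>)"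
  obtains C where "distr \<mu> borel f = density lborel (\<lambda>_. C)"
proof
  interpret pair_sigma_finite \<mu> "lborel :: real measure"
    using \<mu> by (intro pair_sigma_finite.intro) (auto intro: lborel.sigma_finite_measure_axioms)
  let ?C = "\<integral>\<^sup>+x. indicator {0..1} (f x) \<partial>\<mu>"
  have shift: "(\<integral>\<^sup>+c. indicator A (u + c) \<partial>lborel) = emeasure lborel A" if "A \<in> sets borel" for A and u :: real
  proof -
    have "(\<integral>\<^sup>+c. indicator A c \<partial>distr lborel borel ((+) u)) = (\<integral>\<^sup>+c. indicator A (u + c) \<partial>lborel)"
      using that by (intro nn_integral_distr) auto
    then show ?thesis using that by (simp add: lborel_distr_plus)
  qed
  have refl: "(\<integral>\<^sup>+c. indicator {0..1::real} (u - c) \<partial>lborel) = 1" for u :: real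
  proof -
    have "(\<integral>\<^sup>+c. indicator {0..1::real} (u - c) \<partial>lborel) = (\<integral>\<^sup>+c. indicator {u - 1..u} c \<partial>lborel)"
      by (intro nn_integral_cong) (auto simp: indicator_def)
    then show ?thesis by simp
  qed
  show "distr \<mu> borel f = density lborel (\<lambda>_. ?C)"
  proof (rule measure_eqI)
    fix A assume "A \<in> sets (distr \<mu> borel f)"
    then have A [measurable]: "A \<in> sets borel" by simp
    have "?C * emeasure lborel A = (\<integral>\<^sup>+x. indicator {0..1} (f x) * (\<integral>\<^sup>+c. indicator A (f x + c) \<partial>lborel) \<partial>\<mu>)"
      by (simp add: shift nn_integral_multc)
    also have "\<dots> = (\<integral>\<^sup>+x. (\<integral>\<^sup>+c. indicator {0..1} (f x) * indicator A (f x + c) \<partial>lborel) \<partial>\<mu>)"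
      by (simp add: nn_integral_cmult)
    also have "\<dots> = (\<integral>\<^sup>+c. (\<integral>\<^sup>+x. indicator {0..1} (f x) * indicator A (f x + c) \<partial>\<mu>) \<partial>lborel)"
      by (rule Fubini'[symmetric]) measurable
    also have "\<dots> = (\<integral>\<^sup>+c. (\<integral>\<^sup>+x. indicator {0..1} (f x - c) * indicator A (f x) \<partial>\<mu>) \<partial>lborel)"
    proof (rule nn_integral_cong)
      fix c :: real
      have "(\<lambda>u. indicator {0..1} (u - c) * indicator A u :: ennreal) \<in> borel_measurable borel" by measurable
      from inv[OF this, of c]
      show "(\<integral>\<^sup>+x. indicator {0..1} (f x) * indicator A (f x + c) \<partial>\<mu>) = (\<integral>\<^sup>+x. indicator {0..1} (f x - c) * indicator A (f x) \<partial>\<mu>)"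
        by simp
    qed
    also have "\<dots> = (\<integral>\<^sup>+x. (\<integral>\<^sup>+c. indicator {0..1} (f x - c) * indicator A (f x) \<partial>lborel) \<partial>\<mu>)"
      by (rule Fubini') measurable
    also have "\<dots> = (\<integral>\<^sup>+x. indicator A (f x) \<partial>\<mu>)"
      by (simp add: nn_integral_multc refl)
    also have "\<dots> = emeasure (distr \<mu> borel f) A"
      by (simp add: nn_integral_distr[of f \<mu> borel "indicator A", symmetric])
    finally show "emeasure (distr \<mu> borel f) A = emeasure (density lborel (\<lambda>_. ?C)) A"
      by (simp add: emeasure_density nn_integral_cmult)
  qed simp
qed

context box begin

lemma mass_measurable [measurable]: "mass \<in> borel_measurable (vol n)" "mass \<in> borel_measurable (height_space n)"
  unfolding mass_def by measurable

text \<open>Replacing every eigenvalue by the smallest one gives a product Gaussian, by Parseval.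
  This provides integrability of the weight.\<close>

lemma dgff_weight_le: "dgff_weight n h \<le> (\<Prod>x\<in>Lam n. exp (- (gap n) * (h x)\<^sup>2 / 2))"
proof -
  have "gap n * (\<Sum>k\<in>Lam n. (coef n h k)\<^sup>2) \<le> (\<Sum>k\<in>Lam n. eig n k * (coef n h k)\<^sup>2)"
    unfolding sum_distrib_left by (intro sum_mono mult_right_mono gap_le_eig) auto
  then have "gap n * (msq n * (\<Sum>x\<in>Lam n. (h x)\<^sup>2)) \<le> (\<Sum>k\<in>Lam n. eig n k * (coef n h k)\<^sup>2)"
    by (simp only: parseval)
  then have "dgff_weight n h \<le> exp (- (gap n * (msq n * (\<Sum>x\<in>Lam n. (h x)\<^sup>2))) / (2 * msq n))"
    unfolding dgff_weight_eq using msq_pos by (simp add: field_simps)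
  also have "\<dots> = (\<Prod>x\<in>Lam n. exp (- (gap n) * (h x)\<^sup>2 / 2))"
    using msq_pos by (simp add: sum_distrib_left sum_divide_distrib sum_negf flip: exp_sum)
  finally show ?thesis .
qed

lemma integrable_dgff_weight: "integrable (vol n) (dgff_weight n)"
proof (rule Bochner_Integration.integrable_bound)
  have "integrable lborel (\<lambda>y. sqrt (2 * pi * (1 / gap n)) * normal_density 0 (sqrt (1 / gap n)) y)"
    using gap_pos by (intro integrable_mult_right) auto
  then have "integrable lborel (\<lambda>y::real. exp (- gap n * y\<^sup>2 / 2))"
    using gap_pos by (simp add: normal_density_def field_simps real_sqrt_mult real_sqrt_divide)
  then show "integrable (vol n) (\<lambda>h. \<Prod>x\<in>Lam n. exp (- (gap n) * (h x)\<^sup>2 / 2))"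
    by (intro lborel_product.product_integrable_prod) auto
  show "AE h in vol n. norm (dgff_weight n h) \<le> norm (\<Prod>x\<in>Lam n. exp (- (gap n) * (h x)\<^sup>2 / 2))"
    using dgff_weight_le by (intro AE_I2) (auto simp: dgff_weight_eq abs_prod)
qed simp

definition partition_const :: real where
  "partition_const = (\<integral>g. dgff_weight n g \<partial>vol n)"

lemma partition_const: "partition_const > 0" "(\<integral>\<^sup>+h. dgff_weight n h \<partial>vol n) = partition_const"
proof -
  have w: "dgff_weight n h > 0" for h by (simp add: dgff_weight_eq)
  show e: "(\<integral>\<^sup>+h. dgff_weight n h \<partial>vol n) = partition_const"
    unfolding partition_const_def using w
    by (intro nn_integral_eq_integral integrable_dgff_weight) (auto simp: less_imp_le)
  have "emeasure (vol n) (space (vol n)) \<noteq> 0"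
  proof -
    have "emeasure (vol n) (Pi\<^sub>E (Lam n) (\<lambda>_. UNIV)) = (\<Prod>x\<in>Lam n. emeasure lborel (UNIV :: real set))"
      by (intro lborel_product.emeasure_PiM) auto
    then show ?thesis by (simp add: space_PiM)
  qed
  moreover have "{h \<in> space (vol n). ennreal (dgff_weight n h) \<noteq> 0} = space (vol n)"
    using w by (auto simp: ennreal_eq_0_iff not_le)
  ultimately have "(\<integral>\<^sup>+h. dgff_weight n h \<partial>vol n) \<noteq> 0"
    by (subst nn_integral_0_iff) auto
  moreover have "partition_const \<ge> 0"
    unfolding partition_const_def using w by (intro integral_nonneg_AE AE_I2) (auto simp: less_imp_le)
  ultimately show "partition_const > 0" using e by (cases "partition_const = 0") auto
qed

lemma dgff_eq: "dgff n = density (vol n) (\<lambda>h. ennreal (dgff_weight n h / partition_const))"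
  by (simp add: dgff_def partition_const_def)

lemma prob_space_dgff: "prob_space (dgff n)"
proof
  have "emeasure (dgff n) (space (dgff n)) = (\<integral>\<^sup>+h. ennreal (dgff_weight n h) / ennreal partition_const \<partial>vol n)"
    unfolding dgff_eq using partition_const(1)
    by (subst emeasure_density) (auto intro!: nn_integral_cong simp: divide_ennreal dgff_weight_eq)
  also have "\<dots> = 1"
    using partition_const by (simp add: nn_integral_divide divide_ennreal)
  finally show "emeasure (dgff n) (space (dgff n)) = 1" .
qed

lemma sets_dgff [measurable_cong]: "sets (dgff n) = sets (height_space n)"
  by (simp add: dgff_def cong: sets_PiM_cong)

text \<open>
  By completing the square, the tilt by \<open>exp (gap * mass\<^sup>2 / (2 * msq))\<close> turns the DGFF weight into
  one that is invariant under shifts along the ground state, so that \<open>mass\<close> becomes uniform.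
\<close>

lemma tilted_weight_shift:
  "exp (gap n * (mass h + c * msq n)\<^sup>2 / (2 * msq n)) * dgff_weight n (\<lambda>x\<in>Lam n. h x + c * ground n x)
    = exp (gap n * (mass h)\<^sup>2 / (2 * msq n)) * dgff_weight n h"
proof -
  let ?h = "\<lambda>x\<in>Lam n. h x + c * ground n x"
  have "(\<Sum>k\<in>Lam n. eig n k * (coef n ?h k)\<^sup>2) =
    (\<Sum>k\<in>Lam n. eig n k * (coef n h k)\<^sup>2 + (if k = (1, 1) then gap n * (2 * c * msq n * mass h + (c * msq n)\<^sup>2) else 0))"
    by (intro sum.cong refl) (auto simp: coef_shift coef_ground mass_def power2_eq_square algebra_simps)
  also have "\<dots> = (\<Sum>k\<in>Lam n. eig n k * (coef n h k)\<^sup>2) + gap n * (2 * c * msq n * mass h + (c * msq n)\<^sup>2)"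
    using one_in by (simp add: sum.distrib)
  finally show ?thesis
    using msq_pos unfolding dgff_weight_eq
    by (simp add: power2_eq_square field_simps flip: exp_add)
qed

text \<open>Under the tilted measure \<open>mass\<close> has a multiple of Lebesgue measure as its
  law. Undoing the tilt, which depends on \<open>mass\<close> only, multiplies by a Gaussian
  density, and the unknown factor is fixed by total probability.\<close>

lemma dgff_mass_law: "distr (dgff n) borel mass = density lborel (normal_density 0 (sqrt (msq n / gap n)))"
proof -
  define E where "E u = exp (gap n * u\<^sup>2 / (2 * msq n))" for u :: real
  have [measurable]: "E \<in> borel_measurable borel" unfolding E_def by measurable
  define \<mu> where "\<mu> = density (vol n) (\<lambda>h. ennreal (E (mass h) * dgff_weight n h))"
  \<comment> \<open>The tilt removes all decay along the ground state, so \<mu> has infinite total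
    mass; the exchange of integrals behind the translation argument needs this weaker
    finiteness.\<close>
  have sf: "sigma_finite_measure \<mu>"
  proof -
    interpret finite_product_sigma_finite "\<lambda>_::site. lborel :: real measure" "Lam n" by standard simp
    show ?thesis unfolding \<mu>_def by (subst sigma_finite_iff_density_finite') auto
  qed
  have [measurable]: "mass \<in> borel_measurable \<mu>" by (simp add: \<mu>_def)
  obtain C where C: "distr \<mu> borel mass = density lborel (\<lambda>_. C)"
  proof (rule translation_invariant_law[OF sf])
    fix G :: "real \<Rightarrow> ennreal" and s :: real assume G [measurable]: "G \<in> borel_measurable borel"
    define c where "c = s / msq n"
    have s: "s = c * msq n" using msq_pos by (simp add: c_def)
    let ?T = "\<lambda>h. \<lambda>x\<in>Lam n. h x + c * ground n x"
    have [measurable]: "?T \<in> vol n \<rightarrow>\<^sub>M vol n"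
      by (intro measurable_restrict borel_measurable_add) (auto intro: measurable_component_singleton)
    have mT: "mass (?T h) = mass h + s" for h
      using coef_ground[OF one_in] by (simp add: mass_def coef_shift s)
    have "(\<integral>\<^sup>+h. G (mass h) \<partial>\<mu>) = (\<integral>\<^sup>+h. ennreal (E (mass h) * dgff_weight n h) * G (mass h) \<partial>vol n)"
      unfolding \<mu>_def by (rule nn_integral_density) measurable
    also have "\<dots> = (\<integral>\<^sup>+h. ennreal (E (mass h) * dgff_weight n h) * G (mass h) \<partial>distr (vol n) (vol n) ?T)"
      by (subst vol_shift) simp
    also have "\<dots> = (\<integral>\<^sup>+h. ennreal (E (mass (?T h)) * dgff_weight n (?T h)) * G (mass (?T h)) \<partial>vol n)"
      by (rule nn_integral_distr) measurable
    also have "\<dots> = (\<integral>\<^sup>+h. ennreal (E (mass h) * dgff_weight n h) * G (mass h + s) \<partial>vol n)"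
      unfolding mT using tilted_weight_shift[of _ c] by (simp add: E_def s)
    also have "\<dots> = (\<integral>\<^sup>+h. G (mass h + s) \<partial>\<mu>)"
      unfolding \<mu>_def by (rule nn_integral_density[symmetric]) measurable
    finally show "(\<integral>\<^sup>+h. G (mass h) \<partial>\<mu>) = (\<integral>\<^sup>+h. G (mass h + s) \<partial>\<mu>)" .
  qed auto
  define \<sigma> where "\<sigma> = sqrt (msq n / gap n)"
  have \<sigma>: "\<sigma> > 0" using msq_pos gap_pos by (simp add: \<sigma>_def)
  have nd: "normal_density 0 \<sigma> u = 1 / sqrt (2 * pi * \<sigma>\<^sup>2) * inverse (E u)" for u
    using msq_pos gap_pos by (simp add: normal_density_def E_def \<sigma>_def exp_minus[symmetric])
  define D where "D = C / ennreal partition_const * ennreal (sqrt (2 * pi * \<sigma>\<^sup>2))"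
  have law: "emeasure (distr (dgff n) borel mass) A = D * emeasure (density lborel (normal_density 0 \<sigma>)) A"
    if A [measurable]: "A \<in> sets borel" for A
  proof -
    have "emeasure (distr (dgff n) borel mass) A = (\<integral>\<^sup>+h. indicator A (mass h) \<partial>dgff n)"
      by (simp add: nn_integral_distr[of mass "dgff n" borel "indicator A", symmetric])
    also have "\<dots> = (\<integral>\<^sup>+h. ennreal (dgff_weight n h / partition_const) * indicator A (mass h) \<partial>vol n)"
      unfolding dgff_eq by (rule nn_integral_density) measurable
    also have "\<dots> = (\<integral>\<^sup>+h. ennreal (E (mass h) * dgff_weight n h) * (ennreal (inverse (E (mass h)) / partition_const) * indicator A (mass h)) \<partial>vol n)"
    proof (rule nn_integral_cong)
      fix h
      have "ennreal (dgff_weight n h / partition_const) = ennreal (E (mass h) * dgff_weight n h) * ennreal (inverse (E (mass h)) / partition_const)"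
        using partition_const by (subst ennreal_mult[symmetric]) (auto simp: E_def dgff_weight_eq)
      then show "ennreal (dgff_weight n h / partition_const) * indicator A (mass h)
        = ennreal (E (mass h) * dgff_weight n h) * (ennreal (inverse (E (mass h)) / partition_const) * indicator A (mass h))"
        by (simp add: mult.assoc)
    qed
    also have "\<dots> = (\<integral>\<^sup>+h. ennreal (inverse (E (mass h)) / partition_const) * indicator A (mass h) \<partial>\<mu>)"
      unfolding \<mu>_def by (rule nn_integral_density[symmetric]) measurable
    also have "\<dots> = (\<integral>\<^sup>+u. ennreal (inverse (E u) / partition_const) * indicator A u \<partial>distr \<mu> borel mass)"
      by (rule nn_integral_distr[symmetric]) measurable
    also have "\<dots> = (\<integral>\<^sup>+u. C * (ennreal (inverse (E u) / partition_const) * indicator A u) \<partial>lborel)"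
      unfolding C by (rule nn_integral_density) measurable
    also have "\<dots> = (\<integral>\<^sup>+u. D * (ennreal (normal_density 0 \<sigma> u) * indicator A u) \<partial>lborel)"
    proof (rule nn_integral_cong)
      fix u
      have "inverse (E u) / partition_const = (1 / partition_const) * (sqrt (2 * pi * \<sigma>\<^sup>2) * normal_density 0 \<sigma> u)"
        using \<sigma> by (simp add: nd)
      then have "ennreal (inverse (E u) / partition_const) = ennreal (1 / partition_const) * (ennreal (sqrt (2 * pi * \<sigma>\<^sup>2)) * ennreal (normal_density 0 \<sigma> u))"
        using partition_const \<sigma> by (simp add: ennreal_mult[symmetric])
      also have "ennreal (1 / partition_const) = 1 / ennreal partition_const"
        using partition_const by (metis divide_ennreal ennreal_1 zero_le_one)
      finally show "C * (ennreal (inverse (E u) / partition_const) * indicator A u) = D * (ennreal (normal_density 0 \<sigma> u) * indicator A u)"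
        by (simp add: D_def divide_ennreal_def mult_ac)
    qed
    also have "\<dots> = D * (\<integral>\<^sup>+u. ennreal (normal_density 0 \<sigma> u) * indicator A u \<partial>lborel)"
      by (rule nn_integral_cmult) measurable
    finally show ?thesis by (simp add: emeasure_density)
  qed
  interpret P: prob_space "dgff n" by (rule prob_space_dgff)
  interpret Q: prob_space "density lborel (normal_density 0 \<sigma>)" by (rule prob_space_normal_density[OF \<sigma>])
  interpret R: prob_space "distr (dgff n) borel mass" by (rule P.prob_space_distr) measurable
  have "D = 1"
    using law[of UNIV] Q.emeasure_space_1 R.emeasure_space_1 by simp
  then show ?thesis
    by (intro measure_eqI) (auto simp: law \<sigma>_def)
qed

end

subsection \<open>Conditioning the dynamics on the clocks\<close>

text \<open>The ring time \<open>T\<close> is the infimum of the times at which the clock at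
  \<open>x\<close> has advanced; right-continuity of an integer-valued path puts \<open>T\<close>
  into that set. The other clocks stand still, so all left limits at \<open>T\<close> are the
  heights at time \<open>s\<close>, and after \<open>T\<close> the height at \<open>x\<close> is
  frozen again.\<close>

lemma single_ring_update:
  fixes N :: "site \<Rightarrow> real \<Rightarrow> nat" and H :: "real \<Rightarrow> height" and z :: "site \<Rightarrow> nat \<Rightarrow> real"
  assumes mono: "\<And>y. y \<in> Lam n \<Longrightarrow> mono_on {0..} (N y)"
    and rcont: "\<And>y u. y \<in> Lam n \<Longrightarrow> 0 \<le> u \<Longrightarrow> continuous (at_right u) (N y)"
    and const: "\<And>y u v. y \<in> Lam n \<Longrightarrow> 0 \<le> u \<Longrightarrow> u \<le> v \<Longrightarrow> N y u = N y v \<Longrightarrow> H u y = H v y"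
    and ring: "\<And>u. 0 < u \<Longrightarrow> rings (N x) u \<Longrightarrow>
      H u x = (\<Sum>y | adj x y. Lim (at_left u) (\<lambda>v. zero_ext n (H v) y)) / 4 + z x (N x u)"
    and s: "0 \<le> s" "s \<le> t" and x: "x \<in> Lam n"
    and jump: "N x t = Suc (N x s)" and still: "\<And>y. y \<in> Lam n \<Longrightarrow> y \<noteq> x \<Longrightarrow> N y t = N y s"
  shows "H t x = (\<Sum>y | adj x y. zero_ext n (H s) y) / 4 + z x (N x t)"
proof -
  define A where "A = {u \<in> {s..t}. N x u = Suc (N x s)}"
  define T where "T = Inf A"
  have tA: "t \<in> A" using s jump by (simp add: A_def)
  have bdd: "bdd_below A" by (rule bdd_belowI[of _ s]) (auto simp: A_def)
  have T: "s \<le> T" "T \<le> t"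
    using tA bdd unfolding T_def by (auto intro!: cInf_greatest cInf_lower simp: A_def)
  have "T \<in> A"
  proof (rule ccontr)
    assume "T \<notin> A"
    have "(N x \<longlongrightarrow> N x T) (at_right T)"
      using rcont[OF x, of T] T s by (simp add: continuous_within)
    then have "eventually (\<lambda>u. N x u = N x T) (at_right T)" by (simp add: tendsto_discrete)
    then obtain b where b: "b > T" "\<And>u. u > T \<Longrightarrow> u < b \<Longrightarrow> N x u = N x T"
      unfolding eventually_at_right_field by blast
    obtain u where u: "u \<in> A" "u < b" using b(1) tA cInf_lessD[of A b] by (auto simp: T_def)
    have "u \<ge> T" using cInf_lower[OF u(1) bdd] by (simp add: T_def)
    moreover have "u \<noteq> T" using u \<open>T \<notin> A\<close> by auto
    ultimately have "N x u = N x T" using b(2)[of u] u by auto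
    then show False using u(1) \<open>T \<notin> A\<close> T by (auto simp: A_def)
  qed
  then have NT: "N x T = Suc (N x s)" by (simp add: A_def)
  then have "T \<noteq> s" by auto
  then have sT: "s < T" using T by simp
  have before: "N x u = N x s" if "s \<le> u" "u < T" for u
  proof -
    have "u \<notin> A" using that cInf_lower[OF _ bdd, of u] by (auto simp: T_def)
    moreover have "N x s \<le> N x u" "N x u \<le> N x t"
      using that s T mono_onD[OF mono[OF x]] by auto
    ultimately show ?thesis using that T jump by (auto simp: A_def)
  qed
  have ev: "eventually (\<lambda>u. u \<in> {s<..<T}) (at_left T)" using sT by (rule eventually_at_left_real)
  have "rings (N x) T"
    unfolding rings_def
  proof
    assume "eventually (\<lambda>u. N x u = N x T) (at_left T)"
    with ev have "eventually (\<lambda>u. False) (at_left T)"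
    proof eventually_elim
      case (elim u)
      have "N x u = N x s" by (rule before) (use elim in auto)
      then show False using elim NT by linarith
    qed
    then show False using trivial_limit_at_left_real[of T] by (simp only: eventually_False)
  qed
  moreover have "Lim (at_left T) (\<lambda>v. zero_ext n (H v) y) = zero_ext n (H s) y" if y: "adj x y" for y
  proof (rule tendsto_Lim)
    have "zero_ext n (H v) y = zero_ext n (H s) y" if v: "v \<in> {s<..<T}" for v
    proof (cases "y \<in> Lam n")
      case True
      have "y \<noteq> x" using y by auto
      then have "N y t = N y s" using still True by blast
      moreover have "N y s \<le> N y v" "N y v \<le> N y t"
        using v s T mono_onD[OF mono[OF True]] by auto
      ultimately have "H s y = H v y" using const[OF True, of s v] v s by auto
      then show ?thesis by (simp add: zero_ext_def)
    qed (simp add: zero_ext_def)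
    then show "((\<lambda>v. zero_ext n (H v) y) \<longlongrightarrow> zero_ext n (H s) y) (at_left T)"
      by (intro tendsto_eventually eventually_mono[OF ev])
  qed (simp add: trivial_limit_at_left_real)
  ultimately have "H T x = (\<Sum>y | adj x y. zero_ext n (H s) y) / 4 + z x (N x T)"
    using ring[of T] sT s by simp
  moreover have "H T x = H t x" using const[OF x, of T t] T s NT jump by auto
  ultimately show ?thesis using NT jump by simp
qed

abbreviation gauss :: "real \<Rightarrow> real measure" where
  "gauss \<sigma> \<equiv> density lborel (normal_density 0 \<sigma>)"

lemma measure_gauss_scale:
  assumes "\<sigma> > 0" "A \<in> sets borel"
  shows "measure (gauss \<sigma>) A = measure (gauss 1) ((\<lambda>x. \<sigma> * x) -` A)"
proof -
  interpret prob_space "gauss 1" by (rule prob_space_normal_density) simp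
  have "distributed (gauss 1) lborel (\<lambda>x. x) (normal_density 0 1)"
    by (simp add: distributed_def distr_id2)
  from normal_density_affine[OF this, of \<sigma> 0] assms
  have "distributed (gauss 1) lborel (\<lambda>x. \<sigma> * x) (normal_density 0 \<sigma>)" by simp
  then have "distr (gauss 1) lborel (\<lambda>x. \<sigma> * x) = gauss \<sigma>" by (simp add: distributed_def)
  then have "measure (gauss \<sigma>) A = measure (distr (gauss 1) lborel (\<lambda>x. \<sigma> * x)) A" by simp
  also have "\<dots> = measure (gauss 1) ((\<lambda>x. \<sigma> * x) -` A)"
    using assms by (subst measure_distr) auto
  finally show ?thesis .
qed

lemma measure_gauss_atLeast:
  assumes "\<sigma> > 0" shows "measure (gauss \<sigma>) {a..} = measure (gauss 1) {a / \<sigma>..}"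
proof -
  have "(\<lambda>x. \<sigma> * x) -` {a..} = {a / \<sigma>..}" using assms by (auto simp: field_simps)
  then show ?thesis using measure_gauss_scale[OF assms, of "{a..}"] by simp
qed

text \<open>The half-line starts at or left of the centre, so shrinking the variance can only
  increase its probability. Zero coefficients are discarded first, because the normal density needs
  positive deviation; if none remain, the sum is 0 and the event is certain.\<close>

lemma (in prob_space) gaussian_sum_tail:
  fixes b :: "'i \<Rightarrow> real"
  assumes I: "finite I" and indep: "indep_vars (\<lambda>_. borel) X I"
    and std: "\<And>i. i \<in> I \<Longrightarrow> distributed M lborel (X i) std_normal_density"
    and var: "(\<Sum>i\<in>I. (b i)\<^sup>2) \<le> \<sigma>\<^sup>2" and \<sigma>: "\<sigma> > 0" and d: "d \<ge> 0"
  shows "prob {\<omega> \<in> space M. - d \<le> (\<Sum>i\<in>I. b i * X i \<omega>)} \<ge> measure (gauss \<sigma>) {- d..}"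
proof -
  define J where "J = {i \<in> I. b i \<noteq> 0}"
  have J: "finite J" "J \<subseteq> I" using I by (auto simp: J_def)
  have eq: "(\<Sum>i\<in>I. b i * X i \<omega>) = (\<Sum>i\<in>J. b i * X i \<omega>)" for \<omega>
    by (rule sum.mono_neutral_right) (use I in \<open>auto simp: J_def\<close>)
  interpret G: prob_space "gauss \<sigma>" by (rule prob_space_normal_density[OF \<sigma>])
  show ?thesis
  proof (cases "J = {}")
    case True
    then show ?thesis using d by (simp add: eq prob_space)
  next
    case False
    define v where "v = sqrt (\<Sum>i\<in>J. \<bar>b i\<bar>\<^sup>2)"
    have vpos: "(\<Sum>i\<in>J. \<bar>b i\<bar>\<^sup>2) > 0"
      using J False by (intro sum_pos) (auto simp: J_def)
    have v: "v > 0" using vpos by (simp add: v_def)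
    have "(\<Sum>i\<in>J. \<bar>b i\<bar>\<^sup>2) \<le> \<sigma>\<^sup>2"
      using sum_mono2[OF I J(2), of "\<lambda>i. (b i)\<^sup>2"] var by simp
    then have v\<sigma>: "v \<le> \<sigma>" unfolding v_def using \<sigma> by (intro real_le_lsqrt) (auto intro: sum_nonneg)
    have "distributed M lborel (\<lambda>\<omega>. \<Sum>i\<in>J. b i * X i \<omega>) (normal_density (\<Sum>i\<in>J. 0) v)"
      unfolding v_def
    proof (rule sum_indep_normal[OF J(1) False])
      have "indep_vars (\<lambda>_. borel) X J" using indep J(2) by (rule indep_vars_subset)
      then show "indep_vars (\<lambda>i. borel) (\<lambda>i \<omega>. b i * X i \<omega>) J"
        by (rule indep_vars_compose2) auto
      show "distributed M lborel (\<lambda>\<omega>. b i * X i \<omega>) (\<lambda>x. ennreal (normal_density 0 \<bar>b i\<bar> x))" if "i \<in> J" for i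
        using normal_density_affine[OF std, of i "b i" 0] that by (simp add: J_def)
    qed (auto simp: J_def)
    then have D: "distr M lborel (\<lambda>\<omega>. \<Sum>i\<in>J. b i * X i \<omega>) = gauss v"
      and meas: "(\<lambda>\<omega>. \<Sum>i\<in>J. b i * X i \<omega>) \<in> M \<rightarrow>\<^sub>M lborel"
      by (auto simp: distributed_def)
    have "prob {\<omega> \<in> space M. - d \<le> (\<Sum>i\<in>J. b i * X i \<omega>)} = measure (distr M lborel (\<lambda>\<omega>. \<Sum>i\<in>J. b i * X i \<omega>)) {- d..}"
      by (subst measure_distr[OF meas]) (auto intro!: arg_cong[where f = prob])
    also have "\<dots> = measure (gauss 1) {- d / v..}" by (simp add: D measure_gauss_atLeast[OF v])
    also have "\<dots> \<ge> measure (gauss 1) {- d / \<sigma>..}"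
    proof -
      interpret S: prob_space "gauss 1" by (rule prob_space_normal_density) simp
      have "d / \<sigma> \<le> d / v" using d v v\<sigma> \<sigma> by (intro divide_left_mono) auto
      then show ?thesis by (intro S.finite_measure_mono) auto
    qed
    finally show ?thesis by (simp add: eq measure_gauss_atLeast[OF \<sigma>])
  qed
qed

lemma words_nth: "xs \<in> words n m \<Longrightarrow> i < m \<Longrightarrow> xs ! i \<in> insert None (Some ` Lam n)"
  unfolding words_def by (metis (mono_tags, lifting) mem_Collect_eq nth_mem subsetD)

section \<open>The dynamics on the event of a fixed word\<close>

locale glauber_run = box n for n +
  fixes M :: "'w measure" and h0 :: height and N Z H and t :: real and m :: nat
  assumes glauber: "glauber_dynamics M n h0 N Z H" and t: "t > 0" and m: "m > 0"
begin

sublocale prob_space M using glauber by (simp add: glauber_dynamics_def)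

definition tick :: "nat \<Rightarrow> real" where
  "tick i = real i * (t / real m)"

lemma tick: "0 \<le> tick i" "tick i \<le> tick (Suc i)" "tick (Suc i) - tick i = t / m" "tick m = t" "tick 0 = 0"
  using t m by (auto simp: tick_def field_simps)

definition jump :: "site option list \<Rightarrow> site \<Rightarrow> nat \<Rightarrow> nat" where
  "jump xs x i = (if xs ! i = Some x then 1 else 0)"

definition clock_event :: "site option list \<Rightarrow> site \<Rightarrow> 'w set" where
  "clock_event xs x = {\<omega> \<in> space M. \<forall>i<m. N x (tick (Suc i)) \<omega> - N x (tick i) \<omega> = jump xs x i}"

definition word_event :: "site option list \<Rightarrow> 'w set" where
  "word_event xs = (\<Inter>x\<in>Lam n. clock_event xs x)"

lemma clock: "x \<in> Lam n \<Longrightarrow> poisson_clock M (N x)"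
  using glauber by (simp add: glauber_dynamics_def)

lemma clock_measurable [measurable]: "x \<in> Lam n \<Longrightarrow> 0 \<le> u \<Longrightarrow> N x u \<in> M \<rightarrow>\<^sub>M count_space UNIV"
  using clock[of x] by (simp add: poisson_clock_def)

lemma prob_clock_event:
  assumes x: "x \<in> Lam n"
  shows "prob (clock_event xs x) = (\<Prod>i<m. (if xs ! i = Some x then t / m * exp (- (t / m)) else exp (- (t / m))))"
proof -
  let ?D = "\<lambda>i \<omega>. N x (tick (Suc i)) \<omega> - N x (tick i) \<omega>"
  have mono: "mono tick" by (rule mono_iff_le_Suc[THEN iffD2]) (use tick in auto)
  have indep: "indep_vars (\<lambda>_. count_space UNIV) ?D UNIV"
    using clock[OF x] mono tick unfolding poisson_clock_def by blast
  have "clock_event xs x = (\<Inter>i\<in>{..<m}. ?D i -` {jump xs x i} \<inter> space M)"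
    using m by (auto simp: clock_event_def)
  then have "prob (clock_event xs x) = (\<Prod>i<m. prob (?D i -` {jump xs x i} \<inter> space M))"
    using m by (simp only:) (rule indep_varsD[OF indep], auto)
  also have "\<dots> = (\<Prod>i<m. (if xs ! i = Some x then t / m * exp (- (t / m)) else exp (- (t / m))))"
  proof (rule prod.cong[OF refl])
    fix i
    have less: "tick i < tick (Suc i)" using tick(3)[of i] t m by (smt (verit) divide_pos_pos of_nat_0_less_iff)
    have "distr M (count_space UNIV) (?D i) = measure_pmf (poisson_pmf (t / m))"
      using clock[OF x] less tick(1)[of i] unfolding poisson_clock_def by (simp add: tick(3))
    moreover have "?D i \<in> M \<rightarrow>\<^sub>M count_space UNIV"
      using indep unfolding indep_vars_def by auto
    ultimately have "prob (?D i -` {jump xs x i} \<inter> space M) = measure (measure_pmf (poisson_pmf (t / m))) {jump xs x i}"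
      by (metis measure_distr UNIV_I sets_count_space Pow_UNIV)
    also have "\<dots> = pmf (poisson_pmf (t / m)) (jump xs x i)" by (simp add: measure_pmf_single)
    finally show "prob (?D i -` {jump xs x i} \<inter> space M) = (if xs ! i = Some x then t / m * exp (- (t / m)) else exp (- (t / m)))"
      using t m by (simp add: jump_def)
  qed
  finally show ?thesis .
qed

lemma clock_event_process_sets:
  assumes x: "x \<in> Lam n"
  shows "clock_event xs x \<in> process_sets M (N x)"
proof -
  let ?A = "{f \<in> space (\<Pi>\<^sub>M t\<in>{0::real..}. count_space UNIV :: nat measure). \<forall>i<m. f (tick (Suc i)) - f (tick i) = jump xs x i}"
  have m1: "(\<lambda>f. f (tick j)) \<in> (\<Pi>\<^sub>M t\<in>{0::real..}. count_space UNIV :: nat measure) \<rightarrow>\<^sub>M count_space UNIV" for j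
    by (rule measurable_component_singleton) (use tick in auto)
  note [measurable] = m1
  have "?A \<in> sets (\<Pi>\<^sub>M t\<in>{0::real..}. count_space UNIV)" by measurable
  moreover have "clock_event xs x = (\<lambda>\<omega>. \<lambda>t\<in>{0..}. N x t \<omega>) -` ?A \<inter> space M"
    using tick by (auto simp: clock_event_def space_PiM)
  ultimately show ?thesis unfolding process_sets_def by blast
qed

abbreviation sources :: "site + site \<times> nat \<Rightarrow> 'w set set" where
  "sources \<equiv> case_sum (\<lambda>x. process_sets M (N x)) (\<lambda>(x, k). variable_sets M (Z x k))"

lemma indep_sources: "indep_sets sources (Lam n <+> (Lam n \<times> UNIV))"
  using glauber by (simp add: glauber_dynamics_def)

text \<open>The probabilities that an interval contains no ring at all, and that it contains exactly
  one ring, at a prescribed site. The missing mass belongs to intervals with several rings.\<close>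

definition rate_none :: real where "rate_none = exp (- (t / m) * card (Lam n))"
definition rate_one :: real where "rate_one = t / m * exp (- (t / m) * card (Lam n))"

lemma prob_word_event:
  assumes xs: "xs \<in> words n m"
  shows "prob (word_event xs) = weight rate_none rate_one xs"
proof -
  let ?E = "case_sum (clock_event xs) (\<lambda>_. {}) :: site + site \<times> nat \<Rightarrow> 'w set"
  have "prob (\<Inter>j\<in>Inl ` Lam n. ?E j) = (\<Prod>j\<in>Inl ` Lam n. prob (?E j))"
    by (rule indep_setsD[OF indep_sources]) (use one_in clock_event_process_sets in auto)
  then have "prob (word_event xs) = (\<Prod>x\<in>Lam n. prob (clock_event xs x))"
    by (simp add: word_event_def prod.reindex)
  also have "\<dots> = (\<Prod>i<m. \<Prod>x\<in>Lam n. (if xs ! i = Some x then t / m * exp (- (t / m)) else exp (- (t / m))))"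
    by (subst prod.swap) (simp add: prob_clock_event)
  also have "\<dots> = (\<Prod>i<m. case xs ! i of None \<Rightarrow> rate_none | Some _ \<Rightarrow> rate_one)"
  proof (rule prod.cong[OF refl])
    fix i assume i: "i \<in> {..<m}"
    have "xs ! i \<in> insert None (Some ` Lam n)" using words_nth[OF xs] i by simp
    then consider "xs ! i = None" | x where "x \<in> Lam n" "xs ! i = Some x" by auto
    then show "(\<Prod>x\<in>Lam n. (if xs ! i = Some x then t / m * exp (- (t / m)) else exp (- (t / m)))) =
       (case xs ! i of None \<Rightarrow> rate_none | Some _ \<Rightarrow> rate_one)"
    proof cases
      case 1
      then show ?thesis by (simp add: rate_none_def mult.commute flip: exp_of_nat_mult)
    next
      case 2
      have "(\<Prod>y\<in>Lam n. (if xs ! i = Some y then t / m * exp (- (t / m)) else exp (- (t / m)))) =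
        (\<Prod>y\<in>Lam n. (if y = x then t / m else 1) * exp (- (t / m)))"
        using 2 by (intro prod.cong refl) auto
      also have "\<dots> = t / m * exp (- (t / m)) ^ card (Lam n)"
        using 2 by (simp add: prod.distrib)
      finally show ?thesis using 2 by (simp add: rate_one_def mult.commute flip: exp_of_nat_mult)
    qed
  qed
  also have "\<dots> = weight rate_none rate_one xs"
    using xs by (simp add: weight_def words_def prod.list_conv_set_nth atLeast0LessThan)
  finally show ?thesis .
qed

definition cnt :: "site option list \<Rightarrow> nat \<Rightarrow> site \<Rightarrow> nat" where
  "cnt xs i x = card {j. j < i \<and> xs ! j = Some x}"

lemma cnt_Suc: "cnt xs (Suc i) x = cnt xs i x + jump xs x i"
proof -
  have "{j. j < Suc i \<and> xs ! j = Some x} = (if xs ! i = Some x then insert i {j. j < i \<and> xs ! j = Some x} else {j. j < i \<and> xs ! j = Some x})"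
    by (auto simp: less_Suc_eq)
  then show ?thesis by (simp add: cnt_def jump_def)
qed

text \<open>What interval \<open>i\<close> adds to the final coefficient: later intervals act on a
  fresh Gaussian through their dual state, hence \<open>drop (Suc i)\<close>. Noise variables are
  numbered from the first ring on, so the count includes interval \<open>i\<close> itself.\<close>

definition noise :: "site option list \<Rightarrow> nat \<Rightarrow> 'w \<Rightarrow> real" where
  "noise xs i \<omega> = (case xs ! i of None \<Rightarrow> 0 | Some x \<Rightarrow> evolve n (drop (Suc i) xs) x * Z x (cnt xs (Suc i) x) \<omega>)"

definition mean :: "site option list \<Rightarrow> real" where
  "mean xs = (\<Sum>y\<in>Lam n. evolve n xs y * h0 y)"

definition regular :: "'w \<Rightarrow> bool" where
  "regular \<omega> \<longleftrightarrow> (\<forall>x\<in>Lam n. N x 0 \<omega> = 0 \<and> mono_on {0..} (\<lambda>t. N x t \<omega>) \<and> (\<forall>t\<ge>0. continuous (at_right t) (\<lambda>u. N x u \<omega>))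
    \<and> H 0 \<omega> x = h0 x \<and>
        (\<forall>s t. 0 \<le> s \<and> s \<le> t \<and> N x s \<omega> = N x t \<omega> \<longrightarrow> H s \<omega> x = H t \<omega> x) \<and>
        (\<forall>t>0. rings (\<lambda>u. N x u \<omega>) t \<longrightarrow>
           H t \<omega> x = (\<Sum>y | adj x y. Lim (at_left t) (\<lambda>u. zero_ext n (H u \<omega>) y)) / 4
                       + Z x (N x t \<omega>) \<omega>))"

lemma AE_regular: "AE \<omega> in M. regular \<omega>"
proof -
  have "AE \<omega> in M. \<forall>x\<in>Lam n. N x 0 \<omega> = 0 \<and> mono_on {0..} (\<lambda>t. N x t \<omega>) \<and> (\<forall>t\<ge>0. continuous (at_right t) (\<lambda>u. N x u \<omega>))"
    using clock by (intro AE_finite_allI) (auto simp: poisson_clock_def)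
  moreover have "AE \<omega> in M. \<forall>x\<in>Lam n.
        H 0 \<omega> x = h0 x \<and>
        (\<forall>s t. 0 \<le> s \<and> s \<le> t \<and> N x s \<omega> = N x t \<omega> \<longrightarrow> H s \<omega> x = H t \<omega> x) \<and>
        (\<forall>t>0. rings (\<lambda>u. N x u \<omega>) t \<longrightarrow>
           H t \<omega> x = (\<Sum>y | adj x y. Lim (at_left t) (\<lambda>u. zero_ext n (H u \<omega>) y)) / 4
                       + Z x (N x t \<omega>) \<omega>)"
    using glauber unfolding glauber_dynamics_def by (elim conjE)
  ultimately show ?thesis unfolding regular_def by eventually_elim blast
qed

lemma clock_value:
  assumes r: "regular \<omega>" and \<omega>: "\<omega> \<in> word_event xs" and x: "x \<in> Lam n" and i: "i \<le> m"
  shows "N x (tick i) \<omega> = cnt xs i x"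
  using i
proof (induction i)
  case 0
  then show ?case using r x by (simp add: regular_def cnt_def tick)
next
  case (Suc i)
  have "mono_on {0..} (\<lambda>t. N x t \<omega>)" using r x by (simp add: regular_def)
  then have "N x (tick i) \<omega> \<le> N x (tick (Suc i)) \<omega>"
    by (rule mono_onD) (use tick in auto)
  moreover have "N x (tick (Suc i)) \<omega> - N x (tick i) \<omega> = jump xs x i"
    using \<omega> x Suc.prems by (auto simp: word_event_def clock_event_def)
  ultimately show ?case using Suc by (simp add: cnt_Suc)
qed

text \<open>The averaging part of the height update is moved onto the dual state, leaving only the
  noise. Over all intervals this telescopes: the last dual state is the ground state, and the first
  one is paired with \<open>h0\<close>.\<close>

lemma pairing_step:
  assumes r: "regular \<omega>" and \<omega>: "\<omega> \<in> word_event xs" and xs: "xs \<in> words n m" and i: "i < m"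
  shows "(\<Sum>y\<in>Lam n. evolve n (drop (Suc i) xs) y * H (tick (Suc i)) \<omega> y) =
    (\<Sum>y\<in>Lam n. evolve n (drop i xs) y * H (tick i) \<omega> y) + noise xs i \<omega>"
proof -
  have dr: "drop i xs = xs ! i # drop (Suc i) xs"
    using i xs by (simp add: words_def Cons_nth_drop_Suc)
  have still: "H (tick (Suc i)) \<omega> y = H (tick i) \<omega> y" if "y \<in> Lam n" "xs ! i \<noteq> Some y" for y
  proof -
    have "N y (tick (Suc i)) \<omega> = N y (tick i) \<omega>"
      using clock_value[OF r \<omega> that(1)] i that by (simp add: cnt_Suc jump_def)
    moreover have "\<forall>s t. 0 \<le> s \<and> s \<le> t \<and> N y s \<omega> = N y t \<omega> \<longrightarrow> H s \<omega> y = H t \<omega> y"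
      using r that(1) by (simp add: regular_def)
    ultimately show ?thesis using tick(1,2)[of i] by metis
  qed
  have "xs ! i \<in> insert None (Some ` Lam n)" using words_nth[OF xs] i by simp
  then consider "xs ! i = None" | x where "x \<in> Lam n" "xs ! i = Some x" by auto
  then show ?thesis
  proof cases
    case 1
    then show ?thesis using still by (simp add: dr noise_def)
  next
    case 2
    let ?\<psi> = "evolve n (drop (Suc i) xs)"
    have cv: "N y (tick j) \<omega> = cnt xs j y" if "y \<in> Lam n" "j \<le> m" for y j
      using clock_value[OF r \<omega> that] .
    have "H (tick (Suc i)) \<omega> x = (\<Sum>y | adj x y. zero_ext n (H (tick i) \<omega>) y) / 4 + Z x (N x (tick (Suc i)) \<omega>) \<omega>"
    proof (rule single_ring_update[where N = "\<lambda>x u. N x u \<omega>" and H = "\<lambda>u. H u \<omega>" and z = "\<lambda>x k. Z x k \<omega>"])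
      show "N x (tick (Suc i)) \<omega> = Suc (N x (tick i) \<omega>)"
        using 2 i by (simp add: cv cnt_Suc jump_def)
      show "N y (tick (Suc i)) \<omega> = N y (tick i) \<omega>" if "y \<in> Lam n" "y \<noteq> x" for y
        using 2 i that by (simp add: cv cnt_Suc jump_def)
    qed (use r 2 tick in \<open>auto simp: regular_def\<close>)
    then have Hx: "H (tick (Suc i)) \<omega> x = (\<Sum>y | adj x y. zero_ext n (H (tick i) \<omega>) y) / 4 + Z x (cnt xs (Suc i) x) \<omega>"
      using 2 i cv by simp
    have "(\<Sum>y\<in>Lam n. ?\<psi> y * H (tick (Suc i)) \<omega> y) = ?\<psi> x * H (tick (Suc i)) \<omega> x + (\<Sum>y\<in>Lam n - {x}. ?\<psi> y * H (tick (Suc i)) \<omega> y)"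
      using 2 by (intro sum.remove) auto
    also have "(\<Sum>y\<in>Lam n - {x}. ?\<psi> y * H (tick (Suc i)) \<omega> y) = (\<Sum>y\<in>Lam n - {x}. ?\<psi> y * H (tick i) \<omega> y)"
      using 2 by (intro sum.cong refl) (auto simp: still)
    also have "\<dots> = (\<Sum>y\<in>Lam n. ?\<psi> y * H (tick i) \<omega> y) - ?\<psi> x * H (tick i) \<omega> x"
      using 2 by (simp add: sum.remove[of "Lam n" x "\<lambda>y. ?\<psi> y * H (tick i) \<omega> y"])
    finally have new: "(\<Sum>y\<in>Lam n. ?\<psi> y * H (tick (Suc i)) \<omega> y) =
      ?\<psi> x * H (tick (Suc i)) \<omega> x + ((\<Sum>y\<in>Lam n. ?\<psi> y * H (tick i) \<omega> y) - ?\<psi> x * H (tick i) \<omega> x)" .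
    have "evolve n (drop i xs) = upd n x ?\<psi>" using 2 by (simp add: dr)
    then show ?thesis
      unfolding new using 2 by (simp only: sum_upd) (simp add: noise_def Hx algebra_simps)
  qed
qed

lemma mass_decomposition:
  assumes r: "regular \<omega>" and \<omega>: "\<omega> \<in> word_event xs" and xs: "xs \<in> words n m"
  shows "mass (H t \<omega>) = mean xs + (\<Sum>i<m. noise xs i \<omega>)"
proof -
  have "(\<Sum>y\<in>Lam n. evolve n (drop i xs) y * H (tick i) \<omega> y) = mean xs + (\<Sum>j<i. noise xs j \<omega>)" if "i \<le> m" for i
    using that
  proof (induction i)
    case 0
    then show ?case using r by (simp add: mean_def tick regular_def)
  next
    case (Suc i)
    then show ?case using pairing_step[OF r \<omega> xs, of i] by simp
  qed
  from this[of m] show ?thesis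
    using xs by (simp add: words_def tick mass_def coef_def mult.commute)
qed

definition amp :: "site option list \<Rightarrow> nat \<Rightarrow> real" where
  "amp xs i = (case xs ! i of None \<Rightarrow> 0 | Some x \<Rightarrow> evolve n (drop (Suc i) xs) x)"

text \<open>The Green energy telescopes from the last interval back to the first. It starts at the
  stationary variance, pays one squared amplitude per ring, and what is left over is
  nonnegative.\<close>

lemma sum_amp_sq:
  assumes xs: "xs \<in> words n m"
  shows "(\<Sum>i<m. (amp xs i)\<^sup>2) \<le> msq n / gap n"
proof -
  have "green n (evolve n (drop i xs)) + (\<Sum>j\<in>{i..<m}. (amp xs j)\<^sup>2) = msq n / gap n" if "i \<le> m" for i
    using that
  proof (induction i rule: inc_induct)
    case base
    then show ?case using xs by (simp add: words_def green_ground)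
  next
    case (step i)
    have dr: "drop i xs = xs ! i # drop (Suc i) xs"
      using step xs by (simp add: words_def Cons_nth_drop_Suc)
    have "xs ! i \<in> insert None (Some ` Lam n)" using words_nth[OF xs] step by simp
    then have "green n (evolve n (drop i xs)) = green n (evolve n (drop (Suc i) xs)) - (amp xs i)\<^sup>2"
      unfolding dr by (auto simp: amp_def green_upd)
    moreover have "(\<Sum>j\<in>{i..<m}. (amp xs j)\<^sup>2) = (amp xs i)\<^sup>2 + (\<Sum>j\<in>{Suc i..<m}. (amp xs j)\<^sup>2)"
      using step by (simp add: sum.atLeast_Suc_lessThan)
    ultimately show ?case using step by simp
  qed
  from this[of 0] show ?thesis using green_nonneg[of n "evolve n xs"] by (simp add: atLeast0LessThan)
qed

lemma Z_distributed: "x \<in> Lam n \<Longrightarrow> distributed M lborel (Z x k) std_normal_density"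
  using glauber by (simp add: glauber_dynamics_def)

lemma Z_measurable [measurable]: "x \<in> Lam n \<Longrightarrow> Z x k \<in> borel_measurable M"
  using Z_distributed[of x k] by (simp add: distributed_def)

lemma indep_Z: "indep_vars (\<lambda>_. borel) (\<lambda>(x, k). Z x k) (Lam n \<times> UNIV)"
  unfolding indep_vars_def2
proof (intro conjI ballI)
  show "random_variable borel (case q of (x, k) \<Rightarrow> Z x k)" if "q \<in> Lam n \<times> UNIV" for q
    using that by auto
  show "indep_sets (\<lambda>q. {(case q of (x, k) \<Rightarrow> Z x k) -` A \<inter> space M |A. A \<in> sets borel}) (Lam n \<times> UNIV)"
  proof (rule indep_setsI)
    show "{(case q of (x, k) \<Rightarrow> Z x k) -` A \<inter> space M |A. A \<in> sets borel} \<subseteq> events" if "q \<in> Lam n \<times> UNIV" for q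
      using that by (auto intro!: measurable_sets[OF Z_measurable])
    fix A J assume J: "J \<noteq> {}" "J \<subseteq> Lam n \<times> UNIV" "finite J"
      "\<forall>q\<in>J. A q \<in> {(case q of (x, k) \<Rightarrow> Z x k) -` A \<inter> space M |A. A \<in> sets borel}"
    let ?A = "case_sum (\<lambda>_. {}) A :: site + site \<times> nat \<Rightarrow> 'w set"
    have "prob (\<Inter>j\<in>Inr ` J. ?A j) = (\<Prod>j\<in>Inr ` J. prob (?A j))"
      by (rule indep_setsD[OF indep_sources]) (use J in \<open>auto simp: variable_sets_def split: prod.splits\<close>)
    then show "prob (\<Inter>j\<in>J. A j) = (\<Prod>j\<in>J. prob (A j))"
      by (simp add: prod.reindex)
  qed
qed

text \<open>On the event of a fixed word the noise is a deterministic linear combination of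
  Gaussians that are independent of all clocks, so the probability factorises.\<close>

lemma prob_word_and_noise:
  assumes xs: "xs \<in> words n m" and d: "d \<ge> 0"
  shows "prob (word_event xs \<inter> {\<omega> \<in> space M. - d \<le> (\<Sum>i<m. noise xs i \<omega>)})
    \<ge> weight rate_none rate_one xs * measure (gauss (sqrt (msq n / gap n))) {- d..}"
proof -
  define R where "R = {i. i < m \<and> xs ! i \<noteq> None}"
  have R: "finite R" by (simp add: R_def)
  define \<iota> where "\<iota> i = (the (xs ! i), cnt xs (Suc i) (the (xs ! i)))" for i
  have site: "the (xs ! i) \<in> Lam n" if "i \<in> R" for i
  proof -
    have "xs ! i \<in> insert None (Some ` Lam n)" using words_nth[OF xs] that by (simp add: R_def)
    then show ?thesis using that by (auto simp: R_def)
  qed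
  \<comment> \<open>Different rings use different noise variables, because the ring count at a site
    has strictly increased by its next ring. Otherwise the squared amplitudes would not add up to
    the variance.\<close>
  have inj: "inj_on \<iota> R"
  proof (rule inj_onI)
    have aux: False if "i \<in> R" "j \<in> R" "\<iota> i = \<iota> j" "i < j" for i j
    proof -
      define x where "x = the (xs ! i)"
      have "the (xs ! j) = x" using \<open>\<iota> i = \<iota> j\<close> by (simp add: \<iota>_def x_def)
      then have x: "xs ! i = Some x" "xs ! j = Some x" using that(1,2) by (auto simp: R_def x_def)
      have "{k. k < Suc i \<and> xs ! k = Some x} \<subset> {k. k < Suc j \<and> xs ! k = Some x}"
      proof (rule psubsetI)
        have "j \<in> {k. k < Suc j \<and> xs ! k = Some x}" "j \<notin> {k. k < Suc i \<and> xs ! k = Some x}"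
          using \<open>i < j\<close> x(2) by auto
        then show "{k. k < Suc i \<and> xs ! k = Some x} \<noteq> {k. k < Suc j \<and> xs ! k = Some x}" by metis
      qed (use \<open>i < j\<close> in auto)
      then have "cnt xs (Suc i) x < cnt xs (Suc j) x"
        unfolding cnt_def by (intro psubset_card_mono) auto
      moreover have "cnt xs (Suc i) x = cnt xs (Suc j) x" using \<open>\<iota> i = \<iota> j\<close> x by (simp add: \<iota>_def)
      ultimately show False by simp
    qed
    show "i = j" if "i \<in> R" "j \<in> R" "\<iota> i = \<iota> j" for i j
      using aux[of i j] aux[of j i] that by (cases i j rule: linorder_cases) auto
  qed
  define b where "b q = amp xs (inv_into R \<iota> q)" for q
  have b: "b (\<iota> i) = amp xs i" if "i \<in> R" for i using inj that by (simp add: b_def)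
  let ?X = "\<lambda>(x, k). Z x k"
  have noise_eq: "(\<Sum>i<m. noise xs i \<omega>) = (\<Sum>q\<in>\<iota> ` R. b q * ?X q \<omega>)" for \<omega>
  proof -
    have "(\<Sum>q\<in>\<iota> ` R. b q * ?X q \<omega>) = (\<Sum>i\<in>R. noise xs i \<omega>)"
      unfolding sum.reindex[OF inj] by (intro sum.cong refl) (auto simp: b, auto simp: amp_def noise_def \<iota>_def R_def)
    also have "\<dots> = (\<Sum>i<m. noise xs i \<omega>)"
      by (rule sum.mono_neutral_left) (auto simp: R_def noise_def split: option.splits)
    finally show ?thesis by simp
  qed
  have sub: "\<iota> ` R \<subseteq> Lam n \<times> UNIV" using site by (auto simp: \<iota>_def)
  define S where "S = {\<omega> \<in> space M. - d \<le> (\<Sum>i<m. noise xs i \<omega>)}"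
  have PS: "prob S \<ge> measure (gauss (sqrt (msq n / gap n))) {- d..}"
    unfolding S_def noise_eq
  proof (rule gaussian_sum_tail)
    show "indep_vars (\<lambda>_. borel) ?X (\<iota> ` R)" using indep_Z sub by (rule indep_vars_subset)
    show "distributed M lborel (?X q) std_normal_density" if "q \<in> \<iota> ` R" for q
      using that site by (auto simp: \<iota>_def intro: Z_distributed)
    have "(\<Sum>q\<in>\<iota> ` R. (b q)\<^sup>2) = (\<Sum>i\<in>R. (amp xs i)\<^sup>2)"
      unfolding sum.reindex[OF inj] by (intro sum.cong refl) (simp add: b)
    also have "\<dots> \<le> (\<Sum>i<m. (amp xs i)\<^sup>2)" by (intro sum_mono2) (auto simp: R_def)
    also have "\<dots> \<le> (sqrt (msq n / gap n))\<^sup>2" using sum_amp_sq[OF xs] msq_pos gap_pos by simp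
    finally show "(\<Sum>q\<in>\<iota> ` R. (b q)\<^sup>2) \<le> (sqrt (msq n / gap n))\<^sup>2" .
  qed (use R d msq_pos gap_pos in auto)
  have "prob (word_event xs \<inter> S) = prob (word_event xs) * prob S"
  proof -
    \<comment> \<open>The independent sources are grouped into all clocks and all noise variables;
      the word event belongs to the first generated sigma-algebra and the noise event to the
      second.\<close>
    let ?I = "case_bool (Inl ` Lam n) (Inr ` (Lam n \<times> UNIV)) :: bool \<Rightarrow> (site + site \<times> nat) set"
    have U: "(\<Union>j\<in>UNIV. ?I j) = Lam n <+> (Lam n \<times> UNIV)" by (auto simp: UNIV_bool Plus_def)
    have "indep_sets (\<lambda>j. sigma_sets (space M) (\<Union>i\<in>?I j. sources i)) UNIV"
    proof (rule indep_sets_collect_sigma)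
      show "indep_sets sources (\<Union>j\<in>UNIV. ?I j)" unfolding U by (rule indep_sources)
      show "disjoint_family ?I" by (auto simp: disjoint_family_on_def split: bool.splits)
      have iv: "Int_stable {f -` A \<inter> \<Omega> |A. A \<in> sets L}" for f :: "'w \<Rightarrow> 'c" and \<Omega> and L :: "'c measure"
      proof (rule Int_stableI, clarify)
        fix A B assume "A \<in> sets L" "B \<in> sets L"
        then show "\<exists>C. f -` A \<inter> \<Omega> \<inter> (f -` B \<inter> \<Omega>) = f -` C \<inter> \<Omega> \<and> C \<in> sets L"
          by (intro exI[of _ "A \<inter> B"]) auto
      qed
      show "Int_stable (sources i)" for i
        by (cases i) (auto simp: process_sets_def variable_sets_def iv)
    qed
    then have ind: "indep_sets (case_bool (sigma_sets (space M) (\<Union>i\<in>?I True. sources i)) (sigma_sets (space M) (\<Union>i\<in>?I False. sources i))) UNIV"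
      by (rule indep_sets_cong[THEN iffD1, rotated -1]) (auto split: bool.split)
    interpret A1: sigma_algebra "space M" "sigma_sets (space M) (\<Union>i\<in>?I True. sources i)"
      by (rule sigma_algebra_sigma_sets) (auto simp: process_sets_def)
    have W: "word_event xs \<in> sigma_sets (space M) (\<Union>i\<in>?I True. sources i)"
      unfolding word_event_def
    proof (rule A1.finite_INT)
      fix x assume "x \<in> Lam n"
      then show "clock_event xs x \<in> sigma_sets (space M) (\<Union>i\<in>?I True. sources i)"
        by (intro sigma_sets.Basic) (auto intro!: bexI[of _ x] clock_event_process_sets)
    qed (use one_in in auto)
    let ?G = "sigma (space M) (\<Union>i\<in>?I False. sources i)"
    have subP: "(\<Union>i\<in>?I False. sources i) \<subseteq> Pow (space M)" by (auto simp: variable_sets_def)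
    have ZG: "Z x k \<in> borel_measurable ?G" if "x \<in> Lam n" for x k
    proof (rule measurableI)
      fix A :: "real set" assume "A \<in> sets borel"
      then have "Z x k -` A \<inter> space M \<in> variable_sets M (Z x k)" by (auto simp: variable_sets_def)
      then have "Z x k -` A \<inter> space M \<in> sigma_sets (space M) (\<Union>i\<in>?I False. sources i)"
        using that by (intro sigma_sets.Basic) (auto intro!: bexI[of _ x] exI[of _ k])
      then show "Z x k -` A \<inter> space ?G \<in> sets ?G" using subP by (simp add: sets_measure_of space_measure_of)
    qed simp
    have "(\<lambda>\<omega>. \<Sum>q\<in>\<iota> ` R. b q * ?X q \<omega>) \<in> borel_measurable ?G"
    proof (intro borel_measurable_sum borel_measurable_times borel_measurable_const)
      fix q assume "q \<in> \<iota> ` R"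
      then show "?X q \<in> borel_measurable ?G" using sub ZG by auto
    qed
    then have "{\<omega> \<in> space ?G. - d \<le> (\<Sum>q\<in>\<iota> ` R. b q * ?X q \<omega>)} \<in> sets ?G" by measurable
    then have SS: "S \<in> sigma_sets (space M) (\<Union>i\<in>?I False. sources i)"
      using subP unfolding S_def noise_eq by (simp add: sets_measure_of space_measure_of)
    show ?thesis
      using indep_setD[unfolded indep_set_def, OF ind W SS] .
  qed
  also have "\<dots> \<ge> weight rate_none rate_one xs * measure (gauss (sqrt (msq n / gap n))) {- d..}"
    unfolding prob_word_event[OF xs]
    using PS t by (intro mult_left_mono weight_nonneg) (auto simp: rate_none_def rate_one_def)
  finally show ?thesis unfolding S_def .
qed

lemma H_measurable: "H t \<in> M \<rightarrow>\<^sub>M height_space n"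
  using glauber t by (simp add: glauber_dynamics_def)

lemma word_event_sets: "word_event xs \<in> events"
  unfolding word_event_def clock_event_def
proof (rule sets.finite_INT)
  fix x assume [measurable]: "x \<in> Lam n"
  note [measurable] = clock_measurable[OF \<open>x \<in> Lam n\<close> tick(1)]
  show "{\<omega> \<in> space M. \<forall>i<m. N x (tick (Suc i)) \<omega> - N x (tick i) \<omega> = jump xs x i} \<in> events"
    by measurable
qed (use one_in in auto)

lemma word_event_disjoint:
  assumes "xs \<in> words n m" "ys \<in> words n m" "xs \<noteq> ys"
  shows "word_event xs \<inter> word_event ys = {}"
proof -
  obtain i where i: "i < m" "xs ! i \<noteq> ys ! i"
    using assms by (auto simp: words_def list_eq_iff_nth_eq)
  have "xs ! i \<in> insert None (Some ` Lam n)" "ys ! i \<in> insert None (Some ` Lam n)"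
    using words_nth[OF assms(1) i(1)] words_nth[OF assms(2) i(1)] by auto
  then obtain x where x: "x \<in> Lam n" "jump xs x i \<noteq> jump ys x i"
    using i by (auto simp: jump_def)
  then show ?thesis using i by (fastforce simp: word_event_def clock_event_def)
qed

text \<open>The level \<open>c\<close> lies halfway between the stationary centre 0 and a
  conditional mean of at least \<open>2 * c\<close>, so noise above \<open>- c\<close> suffices.
  Distinct words have disjoint events, hence the contributions add up.\<close>

lemma prob_mass_ge:
  assumes c: "c \<ge> 0"
  shows "prob {\<omega> \<in> space M. c \<le> mass (H t \<omega>)} \<ge>
    (\<Sum>xs | xs \<in> words n m \<and> 2 * c \<le> mean xs. weight rate_none rate_one xs) * measure (gauss (sqrt (msq n / gap n))) {- c..}"
proof -
  let ?G = "{xs \<in> words n m. 2 * c \<le> mean xs}"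
  let ?E = "{\<omega> \<in> space M. c \<le> mass (H t \<omega>)}"
  have mH [measurable]: "(\<lambda>\<omega>. mass (H t \<omega>)) \<in> borel_measurable M"
    using mass_measurable(2) H_measurable by (rule measurable_compose[rotated])
  have E: "?E \<in> events" by measurable
  have "(\<Sum>xs\<in>?G. weight rate_none rate_one xs * measure (gauss (sqrt (msq n / gap n))) {- c..})
    \<le> (\<Sum>xs\<in>?G. prob (word_event xs \<inter> ?E))"
  proof (rule sum_mono)
    fix xs assume xs: "xs \<in> ?G"
    have "weight rate_none rate_one xs * measure (gauss (sqrt (msq n / gap n))) {- c..}
      \<le> prob (word_event xs \<inter> {\<omega> \<in> space M. - c \<le> (\<Sum>i<m. noise xs i \<omega>)})"
      using xs c by (intro prob_word_and_noise) auto
    also have "\<dots> \<le> prob (word_event xs \<inter> ?E)"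
    proof (rule finite_measure_mono_AE)
      show "AE \<omega> in M. \<omega> \<in> word_event xs \<inter> {\<omega> \<in> space M. - c \<le> (\<Sum>i<m. noise xs i \<omega>)} \<longrightarrow> \<omega> \<in> word_event xs \<inter> ?E"
        using AE_regular by eventually_elim (use xs mass_decomposition in auto)
    qed (use word_event_sets E in auto)
    finally show "weight rate_none rate_one xs * measure (gauss (sqrt (msq n / gap n))) {- c..} \<le> prob (word_event xs \<inter> ?E)" .
  qed
  also have "\<dots> = prob (\<Union>xs\<in>?G. word_event xs \<inter> ?E)"
  proof (rule finite_measure_finite_Union[symmetric])
    show "disjoint_family_on (\<lambda>xs. word_event xs \<inter> ?E) ?G"
      using word_event_disjoint by (fastforce simp: disjoint_family_on_def)
  qed (use word_event_sets E in auto)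
  also have "\<dots> \<le> prob ?E" by (intro finite_measure_mono E) auto
  finally show ?thesis by (simp add: sum_distrib_right)
qed

end

subsection \<open>Total variation\<close>

lemma (in prob_space) tv_dist_le_1:
  assumes "prob_space \<nu>" shows "tv_dist M \<nu> \<le> 1"
proof -
  interpret N: prob_space \<nu> by fact
  show ?thesis
    unfolding tv_dist_def
  proof (rule cSUP_least)
    show "\<bar>prob A - N.prob A\<bar> \<le> 1" for A
      using prob_le_1[of A] N.prob_le_1[of A] measure_nonneg[of M A] measure_nonneg[of \<nu> A] by linarith
  qed (use sets.top in blast)
qed

lemma (in prob_space) tv_dist_ge:
  assumes "prob_space \<nu>" "A \<in> events"
  shows "tv_dist M \<nu> \<ge> prob A - measure \<nu> A"
proof -
  interpret N: prob_space \<nu> by fact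
  have "\<bar>prob A - N.prob A\<bar> \<le> tv_dist M \<nu>"
    unfolding tv_dist_def
  proof (rule cSUP_upper[OF assms(2)])
    show "bdd_above ((\<lambda>A. \<bar>prob A - N.prob A\<bar>) ` events)"
    proof (rule bdd_aboveI2)
      show "\<bar>prob A - N.prob A\<bar> \<le> 1" for A
        using prob_le_1[of A] N.prob_le_1[of A] measure_nonneg[of M A] measure_nonneg[of \<nu> A] by linarith
    qed
  qed
  then show ?thesis by linarith
qed

context glauber_run begin

text \<open>With \<open>y\<close> the expected number of rings of the whole box in one interval, the
  total is exp(-y)(1 + y), the probability that a Poisson variable is at most 1. Both bounds on it
  come from exp(z) being at least 1 + z.\<close>

lemma rates: "0 \<le> rate_none" "0 \<le> rate_one" "rate_none + rate_one * card (Lam n) \<le> 1"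
    "m * rate_one \<le> t" "rate_none + rate_one * card (Lam n) \<ge> 1 - (t / m * card (Lam n))\<^sup>2"
proof -
  define y where "y = t / m * card (Lam n)"
  have y: "y \<ge> 0" using t by (simp add: y_def)
  have total: "rate_none + rate_one * card (Lam n) = exp (- y) * (1 + y)"
    by (simp add: rate_none_def rate_one_def y_def algebra_simps)
  show "0 \<le> rate_none" "0 \<le> rate_one" using t by (auto simp: rate_none_def rate_one_def)
  have "exp (- y) * (1 + y) \<le> exp (- y) * exp y" by (intro mult_left_mono exp_ge_add_one_self) auto
  then show "rate_none + rate_one * card (Lam n) \<le> 1" unfolding total by (simp flip: exp_add)
  have "t * exp (- y) \<le> t * 1" using t y by (intro mult_left_mono) auto
  then show "m * rate_one \<le> t" using m by (simp add: rate_one_def y_def)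
  have "(1 + - y) * (1 + y) \<le> exp (- y) * (1 + y)"
    using y exp_ge_add_one_self[of "- y"] by (intro mult_right_mono) auto
  then show "rate_none + rate_one * card (Lam n) \<ge> 1 - (t / m * card (Lam n))\<^sup>2"
    unfolding total y_def[symmetric] by (simp add: algebra_simps power2_eq_square)
qed

text \<open>Two comparisons with the lazy chain: bad words weigh no more than they do there, and the
  weight missing from the true words is the discretisation error
  \<open>t\<^sup>2 * (card (Lam n))\<^sup>2 / m\<close>. The premise \<open>good\<close> isolates
  all that is needed of the initial state.\<close>

lemma prob_mass_ge_coarse:
  assumes v: "v > 0" and K: "finite K" "K \<subseteq> Lam n - {(1, 1)}" and \<epsilon>: "\<epsilon> > 0" and c: "c \<ge> 0"
    and good: "\<And>\<psi>. admissible \<psi> \<Longrightarrow> msq n * exp (- v - t * gap n) \<le> mass \<psi> \<Longrightarrow>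
      (\<And>k. k \<in> K \<Longrightarrow> \<bar>coef n \<psi> k\<bar> \<le> \<epsilon> * mass \<psi>) \<Longrightarrow> 2 * c \<le> (\<Sum>y\<in>Lam n. \<psi> y * h0 y)"
    and large: "t / m * card (Lam n) \<le> 1"
  shows "prob {\<omega> \<in> space M. c \<le> mass (H t \<omega>)} \<ge> measure (gauss (sqrt (msq n / gap n))) {- c..}
    - (20 * gap n / msq n + t * (60 * (gap n)\<^sup>2 / msq n)) / (exp (- v) - 1 + v)
    - (\<Sum>k\<in>K. 6000 * (eig n k)\<^sup>2 / (gap n * msq n)) / \<epsilon>\<^sup>2 - t\<^sup>2 * (card (Lam n))\<^sup>2 / m"
proof -
  define p where "p = rate_one"
  interpret W: box_walk n p
    by unfold_locales (use rates in \<open>auto simp: p_def\<close>)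
  define \<Gamma> where "\<Gamma> = measure (gauss (sqrt (msq n / gap n))) {- c..}"
  interpret S: prob_space "gauss (sqrt (msq n / gap n))"
    by (rule prob_space_normal_density) (use msq_pos gap_pos in simp)
  have \<Gamma>: "0 \<le> \<Gamma>" "\<Gamma> \<le> 1" by (auto simp: \<Gamma>_def)
  define ok where "ok xs \<longleftrightarrow> msq n * exp (- v - m * p * gap n) \<le> mass (evolve n xs) \<and>
        (\<forall>k\<in>K. \<bar>coef n (evolve n xs) k\<bar> \<le> \<epsilon> * mass (evolve n xs))" for xs
  define bad where "bad = (20 * gap n / msq n + t * (60 * (gap n)\<^sup>2 / msq n)) / (exp (- v) - 1 + v)
    + (\<Sum>k\<in>K. 6000 * (eig n k)\<^sup>2 / (gap n * msq n)) / \<epsilon>\<^sup>2"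
  \<comment> \<open>The chain is governed by \<open>m * p\<close>, which does not exceed
    \<open>t\<close>. The level in \<open>good\<close> is thus the lower one and is met by every
    word that is \<open>ok\<close>.\<close>
  have mp: "m * p * gap n \<le> t * gap n" using rates(4) gap_pos by (intro mult_right_mono) (auto simp: p_def)
  have sub: "{xs \<in> words n m. ok xs} \<subseteq> {xs. xs \<in> words n m \<and> 2 * c \<le> mean xs}"
  proof safe
    fix xs assume xs: "xs \<in> words n m" "ok xs"
    have "msq n * exp (- v - t * gap n) \<le> msq n * exp (- v - m * p * gap n)"
      using mp msq_pos by (intro mult_left_mono) auto
    then show "2 * c \<le> mean xs"
      unfolding mean_def using xs W.admissible_evolve[OF xs(1)] by (intro good) (auto simp: ok_def)
  qed
  have h: "exp (- v) - 1 + v > 0" by (rule exp_minus_gt[OF v])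
  have bad_le: "(\<Sum>xs | xs \<in> words n m \<and> \<not> ok xs. weight rate_none p xs) \<le> bad"
  proof -
    have "(\<Sum>xs | xs \<in> words n m \<and> \<not> ok xs. weight rate_none p xs) \<le>
      (\<Sum>xs | xs \<in> words n m \<and> \<not> ok xs. weight (1 - p * card (Lam n)) p xs)"
      using rates by (intro sum_mono weight_mono) (auto simp: p_def)
    also have "\<dots> \<le> (20 * gap n / msq n + m * p * (60 * (gap n)\<^sup>2 / msq n)) / (exp (- v) - 1 + v)
      + (\<Sum>k\<in>K. 6000 * (eig n k)\<^sup>2 / (gap n * msq n)) / \<epsilon>\<^sup>2"
      unfolding ok_def by (rule W.weight_bad_words[OF v K \<epsilon>])
    also have "\<dots> \<le> bad"
      unfolding bad_def using rates(4) h msq_pos gap_pos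
      by (intro add_mono divide_right_mono mult_right_mono) (auto simp: p_def)
    finally show ?thesis .
  qed
  \<comment> \<open>Bernoulli's inequality: \<open>m\<close> intervals each lose at most the square
    of a quantity of order 1/m.\<close>
  have "1 - t\<^sup>2 * (card (Lam n))\<^sup>2 / m \<le> (1 + - (t / m * card (Lam n))\<^sup>2) ^ m"
  proof -
    have "(t / m * card (Lam n))\<^sup>2 \<le> 1"
      using large t by (intro power_le_one) auto
    then have "1 + m * (- (t / m * card (Lam n))\<^sup>2) \<le> (1 + - (t / m * card (Lam n))\<^sup>2) ^ m"
      by (intro Bernoulli_inequality) auto
    then show ?thesis using m by (simp add: power2_eq_square field_simps)
  qed
  also have "\<dots> \<le> (rate_none + rate_one * card (Lam n)) ^ m"
  proof (rule power_mono)
    show "0 \<le> 1 + - (t / m * card (Lam n))\<^sup>2"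
      using large t power_le_one[of "t / m * card (Lam n)" 2] by simp
  qed (use rates(5) in simp)
  also have "\<dots> = (\<Sum>xs\<in>words n m. weight rate_none p xs)"
    by (simp add: sum_weight p_def)
  also have "\<dots> = (\<Sum>xs | xs \<in> words n m \<and> ok xs. weight rate_none p xs) + (\<Sum>xs | xs \<in> words n m \<and> \<not> ok xs. weight rate_none p xs)"
  proof -
    have "words n m = {xs \<in> words n m. ok xs} \<union> {xs \<in> words n m. \<not> ok xs}" by auto
    then show ?thesis by (metis (no_types, lifting) sum.union_disjoint finite_words finite_Un disjoint_iff mem_Collect_eq)
  qed
  finally have tot: "(\<Sum>xs | xs \<in> words n m \<and> ok xs. weight rate_none p xs) \<ge> 1 - t\<^sup>2 * (card (Lam n))\<^sup>2 / m - bad"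
    using bad_le by linarith
  have "(\<Sum>xs | xs \<in> words n m \<and> ok xs. weight rate_none p xs) \<le> (\<Sum>xs | xs \<in> words n m \<and> 2 * c \<le> mean xs. weight rate_none p xs)"
    using sub rates by (intro sum_mono2 weight_nonneg) (auto simp: p_def)
  with tot have "1 - t\<^sup>2 * (card (Lam n))\<^sup>2 / m - bad \<le> (\<Sum>xs | xs \<in> words n m \<and> 2 * c \<le> mean xs. weight rate_none p xs)"
    by linarith
  then have "(1 - (t\<^sup>2 * (card (Lam n))\<^sup>2 / m + bad)) * \<Gamma> \<le> (\<Sum>xs | xs \<in> words n m \<and> 2 * c \<le> mean xs. weight rate_none p xs) * \<Gamma>"
    using \<Gamma> by (intro mult_right_mono) auto
  moreover have "(\<Sum>xs | xs \<in> words n m \<and> 2 * c \<le> mean xs. weight rate_none p xs) * \<Gamma> \<le> prob {\<omega> \<in> space M. c \<le> mass (H t \<omega>)}"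
    using prob_mass_ge[OF c] by (simp add: \<Gamma>_def p_def)
  moreover have "\<Gamma> - (t\<^sup>2 * (card (Lam n))\<^sup>2 / m + bad) \<le> (1 - (t\<^sup>2 * (card (Lam n))\<^sup>2 / m + bad)) * \<Gamma>"
  proof -
    have "bad \<ge> 0"
    proof -
      have "0 \<le> 20 * gap n / msq n + t * (60 * (gap n)\<^sup>2 / msq n)"
        using msq_pos gap_pos t by (intro add_nonneg_nonneg) auto
      moreover have "0 \<le> (\<Sum>k\<in>K. 6000 * (eig n k)\<^sup>2 / (gap n * msq n)) / \<epsilon>\<^sup>2"
        using msq_pos gap_pos by (intro divide_nonneg_nonneg sum_nonneg) auto
      ultimately show ?thesis unfolding bad_def using h by simp
    qed
    then have "(t\<^sup>2 * (card (Lam n))\<^sup>2 / m + bad) * \<Gamma> \<le> (t\<^sup>2 * (card (Lam n))\<^sup>2 / m + bad) * 1"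
      using \<Gamma> by (intro mult_left_mono) auto
    then show ?thesis by (simp add: algebra_simps)
  qed
  ultimately show ?thesis by (simp add: \<Gamma>_def bad_def)
qed

end

context box begin

text \<open>The dynamics does not know the subdivision, so the discretisation error can be made
  smaller than any \<open>e\<close> by refining it.\<close>

lemma glauber_prob_mass_ge:
  assumes gl: "glauber_dynamics M n h0 N Z H" and t: "t > 0"
    and v: "v > 0" and K: "finite K" "K \<subseteq> Lam n - {(1, 1)}" and \<epsilon>: "\<epsilon> > 0" and c: "c \<ge> 0"
    and good: "\<And>\<psi>. admissible \<psi> \<Longrightarrow> msq n * exp (- v - t * gap n) \<le> mass \<psi> \<Longrightarrow>
      (\<And>k. k \<in> K \<Longrightarrow> \<bar>coef n \<psi> k\<bar> \<le> \<epsilon> * mass \<psi>) \<Longrightarrow> 2 * c \<le> (\<Sum>y\<in>Lam n. \<psi> y * h0 y)"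
  shows "measure M {\<omega> \<in> space M. c \<le> mass (H t \<omega>)} \<ge> measure (gauss (sqrt (msq n / gap n))) {- c..}
    - (20 * gap n / msq n + t * (60 * (gap n)\<^sup>2 / msq n)) / (exp (- v) - 1 + v)
    - (\<Sum>k\<in>K. 6000 * (eig n k)\<^sup>2 / (gap n * msq n)) / \<epsilon>\<^sup>2" (is "?R \<le> ?L")
proof (rule field_le_epsilon)
  fix e :: real assume e: "e > 0"
  define C where "C = real (card (Lam n))"
  obtain m where m: "real m > max (t * C) (t\<^sup>2 * C\<^sup>2 / e)" using reals_Archimedean2 by blast
  have "t * C \<ge> 0" using t by (simp add: C_def)
  then have m0: "m > 0" using m by (metis max_less_iff_conj of_nat_0_less_iff order_le_less_trans)
  interpret R: glauber_run n M h0 N Z H t m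
    by unfold_locales (use gl t m0 in auto)
  have "t / m * C \<le> 1" using m m0 by (simp add: field_simps)
  then have large: "t / m * card (Lam n) \<le> 1" by (simp only: C_def)
  have "?R - t\<^sup>2 * C\<^sup>2 / m \<le> ?L"
    using R.prob_mass_ge_coarse[OF v K \<epsilon> c good large] by (simp only: C_def of_nat_power)
  moreover have "t\<^sup>2 * C\<^sup>2 / m \<le> e" using m m0 e by (simp add: field_simps)
  ultimately show "?R \<le> ?L + e" by linarith
qed

text \<open>The test set is the half-line above \<open>sqrt 2 * x\<close> stationary standard
  deviations. The two Gaussian tails differ by the mass of the symmetric interval, and rescaling to
  variance 1/2 turns this into \<open>erf x\<close>.\<close>

lemma glauber_tv_ge:
  assumes gl: "glauber_dynamics M n h0 N Z H" and t: "t > 0"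
    and v: "v > 0" and K: "finite K" "K \<subseteq> Lam n - {(1, 1)}" and \<epsilon>: "\<epsilon> > 0" and x: "x \<ge> 0"
    and good: "\<And>\<psi>. admissible \<psi> \<Longrightarrow> msq n * exp (- v - t * gap n) \<le> mass \<psi> \<Longrightarrow>
      (\<And>k. k \<in> K \<Longrightarrow> \<bar>coef n \<psi> k\<bar> \<le> \<epsilon> * mass \<psi>) \<Longrightarrow>
      2 * (sqrt 2 * x * sqrt (msq n / gap n)) \<le> (\<Sum>y\<in>Lam n. \<psi> y * h0 y)"
  shows "tv_dist (distr M (height_space n) (H t)) (dgff n) \<ge> erf x
    - (20 * gap n / msq n + t * (60 * (gap n)\<^sup>2 / msq n)) / (exp (- v) - 1 + v)
    - (\<Sum>k\<in>K. 6000 * (eig n k)\<^sup>2 / (gap n * msq n)) / \<epsilon>\<^sup>2"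
proof -
  define \<sigma> where "\<sigma> = sqrt (msq n / gap n)"
  have \<sigma>: "\<sigma> > 0" using msq_pos gap_pos by (simp add: \<sigma>_def)
  define c where "c = sqrt 2 * x * \<sigma>"
  have c: "c \<ge> 0" using x \<sigma> by (simp add: c_def)
  have c\<sigma>: "c / \<sigma> = sqrt 2 * x" "- c / \<sigma> = - (sqrt 2 * x)" using \<sigma> by (auto simp: c_def)
  interpret M: prob_space M using gl by (simp add: glauber_dynamics_def)
  have Hm: "H t \<in> M \<rightarrow>\<^sub>M height_space n" using gl t by (simp add: glauber_dynamics_def)
  interpret P: prob_space "distr M (height_space n) (H t)" by (rule M.prob_space_distr[OF Hm])
  interpret D: prob_space "dgff n" by (rule prob_space_dgff)
  interpret S: prob_space "gauss 1" by (rule prob_space_normal_density) simp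
  define A where "A = {h \<in> space (height_space n). c \<le> mass h}"
  have A: "A \<in> sets (height_space n)" unfolding A_def by measurable
  have "measure (distr M (height_space n) (H t)) A = measure M {\<omega> \<in> space M. c \<le> mass (H t \<omega>)}"
    using A measurable_space[OF Hm] by (subst measure_distr[OF Hm]) (auto simp: A_def intro!: arg_cong[where f = "measure M"])
  moreover have "measure (dgff n) A = measure (gauss 1) {c / \<sigma>..}"
  proof -
    have md: "mass \<in> borel_measurable (dgff n)" by measurable
    have "measure (dgff n) A = measure (distr (dgff n) borel mass) {c..}"
      by (subst measure_distr[OF md])
         (auto simp: A_def sets_eq_imp_space_eq[OF sets_dgff] intro!: arg_cong[where f = "measure (dgff n)"])
    then show ?thesis by (simp add: dgff_mass_law measure_gauss_atLeast[OF \<sigma>] flip: \<sigma>_def)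
  qed
  moreover have "tv_dist (distr M (height_space n) (H t)) (dgff n) \<ge> measure (distr M (height_space n) (H t)) A - measure (dgff n) A"
    by (rule P.tv_dist_ge[OF prob_space_dgff]) (use A in simp)
  moreover have "measure M {\<omega> \<in> space M. c \<le> mass (H t \<omega>)} \<ge> measure (gauss \<sigma>) {- c..}
    - (20 * gap n / msq n + t * (60 * (gap n)\<^sup>2 / msq n)) / (exp (- v) - 1 + v)
    - (\<Sum>k\<in>K. 6000 * (eig n k)\<^sup>2 / (gap n * msq n)) / \<epsilon>\<^sup>2"
    unfolding \<sigma>_def using good
    by (intro glauber_prob_mass_ge[OF gl t v K \<epsilon> c]) (auto simp: c_def \<sigma>_def)
  moreover have "measure (gauss \<sigma>) {- c..} = measure (gauss 1) {- c / \<sigma>..}" by (rule measure_gauss_atLeast[OF \<sigma>])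
  moreover have "measure (gauss 1) {- c / \<sigma>..} - measure (gauss 1) {c / \<sigma>..} = erf x"
  proof -
    define d where "d = sqrt 2 * x"
    have d: "d \<ge> 0" using x by (simp add: d_def)
    have "measure (gauss 1) {- d..} = measure (gauss 1) ({- d..d} \<union> {d<..})"
      using d by (intro arg_cong[where f = "measure (gauss 1)"]) auto
    also have "\<dots> = measure (gauss 1) {- d..d} + measure (gauss 1) {d<..}"
      by (intro S.finite_measure_Union) auto
    also have "measure (gauss 1) {d<..} = measure (gauss 1) {d..}"
    proof -
      have "AE y in gauss 1. y \<noteq> d"
        by (subst AE_density) (use AE_lborel_singleton[of d] in \<open>auto elim: eventually_mono\<close>)
      then show ?thesis by (intro S.finite_measure_eq_AE) (auto elim!: eventually_mono)
    qed
    also have "measure (gauss 1) {- d..d} = erf x"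
    proof -
      have "(\<lambda>y. sqrt (1 / 2) * y) -` {- x..x} = {- d..d}"
        by (auto simp: d_def real_sqrt_divide field_simps)
      then show ?thesis unfolding erf_def by (subst measure_gauss_scale) auto
    qed
    finally show ?thesis by (simp add: c\<sigma> d_def)
  qed
  ultimately show ?thesis by linarith
qed

end

text \<open>Left-continuity of erf, from exhausting an open interval by closed ones. It buys a
  strict inequality in the argument.\<close>

lemma erf_left_approx:
  assumes "y < erf x" "x > 0"
  obtains x' where "0 < x'" "x' < x" "y < erf x'"
proof -
  let ?g = "gauss (sqrt (1 / 2))"
  interpret S: prob_space ?g by (rule prob_space_normal_density) simp
  define X where "X k = x * (1 - 1 / (real k + 2))" for k :: nat
  have X: "0 < X k" "X k < x" for k using assms(2) by (auto simp: X_def field_simps add_pos_nonneg)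
  have "incseq X" using assms(2) by (auto simp: incseq_def X_def intro!: frac_le)
  then have inc: "incseq (\<lambda>k. {- X k..X k})"
    by (auto simp: incseq_def intro: order_trans)
  have lim: "X \<longlonglongrightarrow> x" unfolding X_def by real_asymp
  have "(\<Union>k. {- X k..X k}) = {- x<..<x}"
  proof (intro set_eqI iffI)
    fix z assume "z \<in> (\<Union>k. {- X k..X k})"
    then obtain k where "- X k \<le> z" "z \<le> X k" by auto
    then show "z \<in> {- x<..<x}" using X[of k] by auto
  next
    fix z assume "z \<in> {- x<..<x}"
    then have "\<bar>z\<bar> < x" by auto
    then have "eventually (\<lambda>k. \<bar>z\<bar> < X k) sequentially" using order_tendstoD(1)[OF lim] by blast
    then obtain k where "\<bar>z\<bar> < X k" by (auto simp: eventually_sequentially)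
    then show "z \<in> (\<Union>k. {- X k..X k})" by (auto intro!: exI[of _ k])
  qed
  moreover have "(\<lambda>k. measure ?g {- X k..X k}) \<longlonglongrightarrow> measure ?g (\<Union>k. {- X k..X k})"
    using inc by (intro S.finite_Lim_measure_incseq) auto
  moreover have "measure ?g {- x<..<x} = erf x"
  proof -
    have ae: "AE z in ?g. z \<noteq> x \<and> z \<noteq> - x"
      by (subst AE_density) (use AE_lborel_singleton[of x] AE_lborel_singleton[of "- x"] in \<open>auto elim: eventually_elim2\<close>)
    show ?thesis
      unfolding erf_def
    proof (rule S.finite_measure_eq_AE)
      show "AE z in ?g. (z \<in> {- x<..<x}) = (z \<in> {- x..x})" using ae by eventually_elim auto
    qed auto
  qed
  ultimately have "(\<lambda>k. erf (X k)) \<longlonglongrightarrow> erf x" by (simp add: erf_def)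
  then have "eventually (\<lambda>k. y < erf (X k)) sequentially" using order_tendstoD(1) assms(1) by blast
  then obtain k where "y < erf (X k)" by (auto simp: eventually_sequentially)
  then show thesis using that X by blast
qed

subsection \<open>Asymptotics\<close>

text \<open>The function exp(-w) - 1 + w is convex and vanishes at 0, so its quotient by w does not
  decrease. Hence it outgrows a fixed multiple of w, which is needed because the Jensen defect grows
  linearly in \<open>t\<close>.\<close>

lemma exp_tail_linear:
  fixes v w :: real
  assumes "0 < v" "v \<le> w"
  shows "(exp (- v) - 1 + v) / v * w \<le> exp (- w) - 1 + w"
proof -
  define h where "h = exp (- v) - 1 + v"
  have "exp (- v) * (1 + - (w - v)) \<le> exp (- v) * exp (- (w - v))"
    by (intro mult_left_mono exp_ge_add_one_self) auto
  also have "\<dots> = exp (- w)" by (simp flip: exp_add)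
  finally have 1: "exp (- w) - 1 + w \<ge> h + (w - v) * (1 - exp (- v))"
    by (simp add: h_def algebra_simps)
  have "exp (- v) * (1 + v) \<le> exp (- v) * exp v" by (intro mult_left_mono exp_ge_add_one_self) auto
  then have "exp (- v) * (1 + v) \<le> 1" by (simp flip: exp_add)
  then have "h \<le> (1 - exp (- v)) * v" by (simp add: h_def algebra_simps)
  then have "h / v \<le> 1 - exp (- v)" using assms by (simp only: pos_divide_le_eq)
  then have "(w - v) * (h / v) \<le> (w - v) * (1 - exp (- v))" using assms by (intro mult_left_mono) auto
  moreover have "h / v * w = h + (w - v) * (h / v)" using assms by (simp add: field_simps)
  ultimately show ?thesis using 1 by (simp add: h_def)
qed

lemma eig_le:
  assumes "n > 0"
  shows "eig n k \<le> 5 / 2 * ((real_of_int (fst k))\<^sup>2 + (real_of_int (snd k))\<^sup>2) / (real n)\<^sup>2"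
proof -
  have c: "1 - cos (pi * of_int i / n) \<le> 5 * (real_of_int i)\<^sup>2 / (real n)\<^sup>2" for i
  proof -
    have "pi\<^sup>2 \<le> (3.15::real)\<^sup>2" using pi_approx by (intro power_mono) auto
    then have "pi\<^sup>2 / 2 \<le> 5" by (simp add: power2_eq_square)
    then have "pi\<^sup>2 / 2 * ((real_of_int i)\<^sup>2 / (real n)\<^sup>2) \<le> 5 * ((real_of_int i)\<^sup>2 / (real n)\<^sup>2)"
      by (intro mult_right_mono) auto
    moreover have "(pi * of_int i / n)\<^sup>2 / 2 = pi\<^sup>2 / 2 * ((real_of_int i)\<^sup>2 / (real n)\<^sup>2)"
      by (simp add: power_divide power_mult_distrib)
    ultimately show ?thesis using cos_ge_quadratic[of "pi * of_int i / n"] by simp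
  qed
  show ?thesis using c[of "fst k"] c[of "snd k"] by (simp add: eig_def add_divide_distrib distrib_left)
qed

lemma pairing_trig_square:
  "(\<Sum>x\<in>Lam n. \<psi> x * ((\<Sum>j\<in>{1..J}. c j * sin (real j * (pi * of_int (fst x) / n))) *
        (\<Sum>j\<in>{1..J}. c j * sin (real j * (pi * of_int (snd x) / n))))) =
   (\<Sum>(i, j)\<in>{1..J} \<times> {1..J}. c i * c j * coef n \<psi> (int i, int j))"
proof -
  have "(\<Sum>x\<in>Lam n. \<psi> x * ((\<Sum>j\<in>{1..J}. c j * sin (real j * (pi * of_int (fst x) / n))) *
        (\<Sum>j\<in>{1..J}. c j * sin (real j * (pi * of_int (snd x) / n))))) =
    (\<Sum>x\<in>Lam n. \<Sum>(i, j)\<in>{1..J} \<times> {1..J}. c i * c j * (\<psi> x * mode n (int i, int j) x))"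
  proof (rule sum.cong[OF refl])
    fix x
    show "\<psi> x * ((\<Sum>j\<in>{1..J}. c j * sin (real j * (pi * of_int (fst x) / n))) *
        (\<Sum>j\<in>{1..J}. c j * sin (real j * (pi * of_int (snd x) / n)))) =
      (\<Sum>(i, j)\<in>{1..J} \<times> {1..J}. c i * c j * (\<psi> x * mode n (int i, int j) x))"
      unfolding sum_product sum.cartesian_product
      unfolding sum_distrib_left
      by (intro sum.cong refl) (auto simp: mode_def mult_ac)
  qed
  also have "\<dots> = (\<Sum>(i, j)\<in>{1..J} \<times> {1..J}. c i * c j * coef n \<psi> (int i, int j))"
    by (subst sum.swap) (simp add: coef_def sum_distrib_left case_prod_unfold)
  finally show ?thesis .
qed

context box begin

lemma trig_square_ge:
  fixes c :: "nat \<Rightarrow> real" and J :: nat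
  assumes J: "J \<ge> 1" and \<psi>: "mass \<psi> \<ge> 0" and \<epsilon>: "\<epsilon> \<ge> 0"
    and small: "\<And>i j. i \<in> {1..J} \<Longrightarrow> j \<in> {1..J} \<Longrightarrow> (i, j) \<noteq> (1, 1) \<Longrightarrow> \<bar>coef n \<psi> (int i, int j)\<bar> \<le> \<epsilon> * mass \<psi>"
  shows "(\<Sum>(i, j)\<in>{1..J} \<times> {1..J}. c i * c j * coef n \<psi> (int i, int j))
    \<ge> ((c 1)\<^sup>2 - \<epsilon> * (\<Sum>(i, j)\<in>{1..J} \<times> {1..J}. \<bar>c i * c j\<bar>)) * mass \<psi>"
proof -
  let ?S = "{1..J} \<times> {1..J}"
  have fin: "finite ?S" and mem: "(1, 1) \<in> ?S" using J by auto
  have "(\<Sum>q\<in>?S - {(1, 1)}. - (\<bar>c (fst q) * c (snd q)\<bar> * (\<epsilon> * mass \<psi>))) \<le>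
    (\<Sum>q\<in>?S - {(1, 1)}. c (fst q) * c (snd q) * coef n \<psi> (int (fst q), int (snd q)))"
  proof (rule sum_mono)
    fix q assume q: "q \<in> ?S - {(1, 1)}"
    have "\<bar>coef n \<psi> (int (fst q), int (snd q))\<bar> \<le> \<epsilon> * mass \<psi>"
      by (rule small) (use q in auto)
    then have "\<bar>c (fst q) * c (snd q)\<bar> * \<bar>coef n \<psi> (int (fst q), int (snd q))\<bar> \<le> \<bar>c (fst q) * c (snd q)\<bar> * (\<epsilon> * mass \<psi>)"
      by (intro mult_left_mono) auto
    then show "- (\<bar>c (fst q) * c (snd q)\<bar> * (\<epsilon> * mass \<psi>)) \<le> c (fst q) * c (snd q) * coef n \<psi> (int (fst q), int (snd q))"
      by (metis abs_le_D2 abs_mult minus_le_iff)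
  qed
  moreover have "(\<Sum>q\<in>?S - {(1, 1)}. - (\<bar>c (fst q) * c (snd q)\<bar> * (\<epsilon> * mass \<psi>))) \<ge>
     - ((\<epsilon> * (\<Sum>q\<in>?S. \<bar>c (fst q) * c (snd q)\<bar>)) * mass \<psi>)"
  proof -
    have "(\<Sum>q\<in>?S - {(1, 1)}. \<bar>c (fst q) * c (snd q)\<bar>) \<le> (\<Sum>q\<in>?S. \<bar>c (fst q) * c (snd q)\<bar>)"
      by (intro sum_mono2) auto
    then have "(\<Sum>q\<in>?S - {(1, 1)}. \<bar>c (fst q) * c (snd q)\<bar>) * (\<epsilon> * mass \<psi>) \<le> (\<Sum>q\<in>?S. \<bar>c (fst q) * c (snd q)\<bar>) * (\<epsilon> * mass \<psi>)"
      using \<psi> \<epsilon> by (intro mult_right_mono) auto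
    then show ?thesis
      unfolding sum_negf sum_distrib_right[symmetric] by (simp add: mult_ac)
  qed
  moreover have "(\<Sum>q\<in>?S. c (fst q) * c (snd q) * coef n \<psi> (int (fst q), int (snd q))) =
    (c 1)\<^sup>2 * mass \<psi> + (\<Sum>q\<in>?S - {(1, 1)}. c (fst q) * c (snd q) * coef n \<psi> (int (fst q), int (snd q)))"
    by (subst sum.remove[OF fin mem]) (simp add: mass_def power2_eq_square)
  ultimately show ?thesis by (simp add: case_prod_unfold left_diff_distrib)
qed

text \<open>Allowing a logarithmic loss of \<open>v + t / real n ^ 4\<close> makes the denominator
  at least a multiple of that sum, against a numerator of order n^-4 + t n^-6. The quotient is of
  order n^-2 uniformly in \<open>t\<close>, so no upper bound on log a_n is required.\<close>

lemma error_bound: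
  fixes J :: nat
  assumes v: "v > 0" and t: "t > 0" and J: "real n > J" and lower: "gap n \<ge> 1 / (real n)\<^sup>2"
    and K: "finite K" "K \<subseteq> {1..int J} \<times> {1..int J}" and \<epsilon>: "\<epsilon> > 0"
  defines "h \<equiv> exp (- v) - 1 + v"
  shows "(20 * gap n / msq n + t * (60 * (gap n)\<^sup>2 / msq n)) / (exp (- (v + t / real n ^ 4)) - 1 + (v + t / real n ^ 4))
    + (\<Sum>k\<in>K. 6000 * (eig n k)\<^sup>2 / (gap n * msq n)) / \<epsilon>\<^sup>2
    \<le> 400 / (real n ^ 4 * h) + 6000 * v / (h * (real n)\<^sup>2) + card K * (600000 * real J ^ 4 / real n ^ 4) / \<epsilon>\<^sup>2"
proof -
  define r where "r = real n"
  have r: "r > 0" using n_ge by (simp add: r_def)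
  have N: "msq n = r\<^sup>2 / 4" "msq n > 0" using msq_pos by (auto simp: msq_def r_def)
  have g: "gap n \<le> 5 / r\<^sup>2" "gap n > 0" "gap n \<ge> 1 / r\<^sup>2"
    using eig_le[of n "(1, 1)"] n_ge gap_pos lower by (auto simp: r_def)
  have h: "h > 0" unfolding h_def by (rule exp_minus_gt[OF v])
  define w where "w = v + t / r ^ 4"
  have w: "v \<le> w" "w > 0" using t r v by (auto simp: w_def add_pos_pos)
  have hw: "h / v * w \<le> exp (- w) - 1 + w" unfolding h_def by (rule exp_tail_linear[OF v w(1)])
  have hvw: "h / v * w > 0" using h v w by simp
  have "20 * gap n / msq n \<le> 400 / r ^ 4"
  proof -
    have "20 * gap n / msq n \<le> 20 * (5 / r\<^sup>2) / msq n"
      using g N r by (intro divide_right_mono mult_left_mono) auto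
    then show ?thesis by (simp add: N power2_eq_square power4_eq_xxxx)
  qed
  moreover have "60 * (gap n)\<^sup>2 / msq n \<le> 6000 / r ^ 6"
  proof -
    have "(gap n)\<^sup>2 \<le> (5 / r\<^sup>2)\<^sup>2" using g by (intro power_mono) auto
    then have "60 * (gap n)\<^sup>2 / msq n \<le> 60 * (5 / r\<^sup>2)\<^sup>2 / msq n"
      using N r by (intro divide_right_mono mult_left_mono) auto
    also have "\<dots> = 6000 / r ^ 6" by (simp add: N power_divide eval_nat_numeral)
    finally show ?thesis .
  qed
  ultimately have "20 * gap n / msq n + t * (60 * (gap n)\<^sup>2 / msq n) \<le> 400 / r ^ 4 + t * (6000 / r ^ 6)"
    using t by (intro add_mono mult_left_mono) auto
  then have "(20 * gap n / msq n + t * (60 * (gap n)\<^sup>2 / msq n)) / (exp (- w) - 1 + w) \<le> (400 / r ^ 4 + t * (6000 / r ^ 6)) / (h / v * w)"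
    using hw hvw t r by (intro frac_le add_nonneg_nonneg) auto
  also have "\<dots> = 400 / r ^ 4 / (h / v * w) + t * (6000 / r ^ 6) / (h / v * w)" by (rule add_divide_distrib)
  also have "\<dots> \<le> 400 / r ^ 4 / h + t * (6000 / r ^ 6) / (h / v * (t / r ^ 4))"
  proof (rule add_mono)
    have "h \<le> h / v * w" using h v w by (simp add: pos_le_divide_eq)
    then show "400 / r ^ 4 / (h / v * w) \<le> 400 / r ^ 4 / h" using h r v w(2) by (intro divide_left_mono mult_pos_pos) auto
    have "h / v * (t / r ^ 4) \<le> h / v * w" using h v by (intro mult_left_mono) (auto simp: w_def)
    then show "t * (6000 / r ^ 6) / (h / v * w) \<le> t * (6000 / r ^ 6) / (h / v * (t / r ^ 4))"
      using h v t r w hvw by (intro divide_left_mono mult_pos_pos) auto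
  qed
  also have "t * (6000 / r ^ 6) / (h / v * (t / r ^ 4)) = 6000 * v / (h * r\<^sup>2)"
    using t r h v by (simp add: eval_nat_numeral)
  finally have 1: "(20 * gap n / msq n + t * (60 * (gap n)\<^sup>2 / msq n)) / (exp (- w) - 1 + w) \<le> 400 / (r ^ 4 * h) + 6000 * v / (h * r\<^sup>2)"
    by simp
  have "(\<Sum>k\<in>K. 6000 * (eig n k)\<^sup>2 / (gap n * msq n)) \<le> (\<Sum>k\<in>K. 600000 * real J ^ 4 / r ^ 4)"
  proof (rule sum_mono)
    fix k assume k: "k \<in> K"
    then have k1: "1 \<le> fst k" "fst k \<le> int J" "1 \<le> snd k" "snd k \<le> int J" using K by auto
    have sq: "(real_of_int i)\<^sup>2 \<le> (real J)\<^sup>2" if "1 \<le> i" "i \<le> int J" for i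
      using that by (intro power_mono) auto
    have "eig n k \<le> 5 / 2 * ((real_of_int (fst k))\<^sup>2 + (real_of_int (snd k))\<^sup>2) / r\<^sup>2"
      using eig_le[of n k] n_ge by (simp add: r_def)
    also have "\<dots> \<le> 5 / 2 * ((real J)\<^sup>2 + (real J)\<^sup>2) / r\<^sup>2"
      using sq k1 r by (intro divide_right_mono mult_left_mono add_mono) auto
    finally have "eig n k \<le> 5 * (real J)\<^sup>2 / r\<^sup>2" by simp
    moreover have "eig n k \<ge> 0"
      using J k1 by (intro less_imp_le eig_pos) (auto simp: Lam_def mem_Times_iff)
    ultimately have "(eig n k)\<^sup>2 \<le> (5 * (real J)\<^sup>2 / r\<^sup>2)\<^sup>2" by (intro power_mono)
    moreover have "1 / 4 \<le> gap n * msq n"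
    proof -
      have "1 / r\<^sup>2 * msq n \<le> gap n * msq n" using g N by (intro mult_right_mono) auto
      then show ?thesis using r by (simp add: N)
    qed
    ultimately have "6000 * (eig n k)\<^sup>2 / (gap n * msq n) \<le> 6000 * (5 * (real J)\<^sup>2 / r\<^sup>2)\<^sup>2 / (1 / 4)"
      by (intro frac_le mult_left_mono) auto
    also have "\<dots> = 600000 * real J ^ 4 / r ^ 4"
      by (simp add: power_divide power_mult_distrib eval_nat_numeral)
    finally show "6000 * (eig n k)\<^sup>2 / (gap n * msq n) \<le> 600000 * real J ^ 4 / r ^ 4" .
  qed
  also have "\<dots> = card K * (600000 * real J ^ 4 / r ^ 4)" by simp
  finally have "(\<Sum>k\<in>K. 6000 * (eig n k)\<^sup>2 / (gap n * msq n)) / \<epsilon>\<^sup>2 \<le> card K * (600000 * real J ^ 4 / r ^ 4) / \<epsilon>\<^sup>2"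
    by (intro divide_right_mono) auto
  with 1 show ?thesis by (simp only: r_def w_def)
qed

end

lemma worst_tv_ge:
  assumes glauber: "\<And>h0. h0 \<in> extensional (Lam n) \<Longrightarrow> glauber_dynamics (M h0) n h0 (N h0) (Z h0) (H h0)"
    and n: "n \<ge> 25" and t: "t > 0" and h: "h \<in> extensional (Lam n)" "\<And>x. x \<in> Lam n \<Longrightarrow> \<bar>h x\<bar> \<le> a"
  shows "worst_tv n a (\<lambda>h0. distr (M h0) (height_space n) (H h0 t)) \<ge> tv_dist (distr (M h) (height_space n) (H h t)) (dgff n)"
proof -
  interpret box n by unfold_locales (rule n)
  have "tv_dist (distr (M h0) (height_space n) (H h0 t)) (dgff n) \<le> 1" if "h0 \<in> extensional (Lam n)" for h0
  proof -
    interpret prob_space "M h0" using glauber[OF that] by (simp add: glauber_dynamics_def)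
    have "H h0 t \<in> M h0 \<rightarrow>\<^sub>M height_space n" using glauber[OF that] t by (simp add: glauber_dynamics_def)
    then interpret P: prob_space "distr (M h0) (height_space n) (H h0 t)" by (rule prob_space_distr)
    show ?thesis by (rule P.tv_dist_le_1[OF prob_space_dgff])
  qed
  then show ?thesis
    unfolding worst_tv_def using h by (intro cSUP_upper bdd_aboveI2[of _ _ 1]) auto
qed

lemma eventually_worst_tv_ge:
  fixes a :: "nat \<Rightarrow> real" and s x e :: real
  assumes a: "filterlim a at_top sequentially"
    and glauber: "\<And>n h0. h0 \<in> extensional (Lam n) \<Longrightarrow>
          glauber_dynamics (M n h0) n h0 (N n h0) (Z n h0) (H n h0)"
    and x: "0 < x" "x < 2 / pi * exp (- (pi\<^sup>2 * s / 2))" and e: "e > 0"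
  shows "eventually (\<lambda>n. worst_tv n (a n)
             (\<lambda>h0. distr (M n h0) (height_space n) (H n h0 (t_star n (a n) + s * (real n)\<^sup>2))) \<ge> erf x - e) sequentially"
proof -
  define E where "E = exp (- (pi\<^sup>2 * s / 2))"
  have E: "E > 0" by (simp add: E_def)
  \<comment> \<open>The ground amplitude at which the conditional mean would asymptotically be
    exactly twice the cut. The assumption on \<open>x\<close> says that it lies below (4/pi)^2,
    which leaves room for all approximations.\<close>
  define \<theta> where "\<theta> = x * 8 / (pi * E)"
  have \<theta>: "0 < \<theta>" using x E by (simp add: \<theta>_def)
  have "x < 2 / pi * E" using x by (simp only: E_def)
  then have "\<theta> < 16 / pi\<^sup>2"
    using E by (simp add: \<theta>_def field_simps power2_eq_square)
  then have "sqrt \<theta> < sqrt ((4 / pi)\<^sup>2)" by (simp add: power_divide)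
  then have sq: "sqrt \<theta> < 4 / pi" by simp
  define \<delta> where "\<delta> = min (1 / 2) ((4 / pi - sqrt \<theta>) / 2)"
  have "\<delta> \<le> (4 / pi - sqrt \<theta>) / 2" unfolding \<delta>_def by (rule min.cobounded2)
  then have \<delta>: "0 < \<delta>" "\<delta> < 1" "sqrt \<theta> < 4 / pi - \<delta>" using sq by (auto simp: \<delta>_def)
  obtain J c where c: "\<And>\<theta>::real. \<bar>\<Sum>j\<in>{1..J}. c j * sin (real j * \<theta>)\<bar> \<le> 1" "c 1 \<ge> 4 / pi - \<delta>" "J \<ge> 1"
    using square_wave_approximation[OF \<delta>(1,2)] by metis
  define q where "q = (c 1)\<^sup>2"
  have q: "q > \<theta>"
  proof -
    have "sqrt \<theta> < c 1" using c(2) \<delta> by linarith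
    then have "(sqrt \<theta>)\<^sup>2 < (c 1)\<^sup>2" using \<theta> by (intro power_strict_mono) auto
    then show ?thesis using \<theta> by (simp add: q_def)
  qed
  define B where "B = (\<Sum>(i, j)\<in>{1..J} \<times> {1..J}. \<bar>c i * c j\<bar>)"
  have B: "B \<ge> 0" unfolding B_def by (intro sum_nonneg) auto
  \<comment> \<open>The other modes may cost at most half of the slack \<open>q - \<theta>\<close>,
    whence the midpoint \<open>\<theta>'\<close>; the summand 1 guards against
    \<open>B = 0\<close>.\<close>
  define \<epsilon> where "\<epsilon> = (q - \<theta>) / (2 * (B + 1))"
  have \<epsilon>: "\<epsilon> > 0" using q B by (simp add: \<epsilon>_def)
  define \<theta>' where "\<theta>' = (q + \<theta>) / 2"
  have \<theta>': "\<theta>' > \<theta>" using q by (simp add: \<theta>'_def)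
  have qB: "q - \<epsilon> * B \<ge> \<theta>'"
  proof -
    have "\<epsilon> * B \<le> \<epsilon> * (B + 1)" using \<epsilon> by (intro mult_left_mono) auto
    also have "\<dots> = (q - \<theta>) / 2" using B by (simp add: \<epsilon>_def field_simps)
    finally show ?thesis by (simp add: \<theta>'_def field_simps)
  qed
  \<comment> \<open>Half of the logarithmic slack, so that a loss of exp(-v) still leaves an
    amplitude above \<theta>.\<close>
  define v where "v = ln (\<theta>' / \<theta>) / 2"
  have v: "v > 0" using \<theta> \<theta>' by (simp add: v_def)
  have ev: "exp (- v) * \<theta>' > \<theta>"
  proof -
    have "exp (- v) > exp (- (2 * v))" using v by simp
    also have "exp (- (2 * v)) = \<theta> / \<theta>'" using \<theta> \<theta>' by (simp add: v_def exp_minus)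
    finally show ?thesis using \<theta> \<theta>' by (simp add: field_simps)
  qed
  define K where "K = {1..int J} \<times> {1..int J} - {(1, 1)}"
  define h where "h = exp (- v) - 1 + v"

  have "eventually (\<lambda>n. n \<ge> 25 \<and> real n > J) sequentially"
    using eventually_ge_at_top[of 25] eventually_gt_at_top[of J] by eventually_elim auto
  moreover have "eventually (\<lambda>n. a n > 0 \<and> 2 / pi\<^sup>2 * ln (a n) + s > 0) sequentially"
  proof -
    have "filterlim (\<lambda>n. 2 / pi\<^sup>2 * ln (a n) + s) at_top sequentially"
    proof (rule filterlim_compose[OF _ a])
      show "filterlim (\<lambda>y. 2 / pi\<^sup>2 * ln y + s) at_top at_top" by real_asymp
    qed
    then have "eventually (\<lambda>n. 2 / pi\<^sup>2 * ln (a n) + s > 0) sequentially" by (simp add: filterlim_at_top_dense)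
    moreover have "eventually (\<lambda>n. a n > 0) sequentially" using a by (simp add: filterlim_at_top_dense)
    ultimately show ?thesis by eventually_elim simp
  qed
  moreover have "eventually (\<lambda>n. 1 - cos (pi / real n) \<le> pi\<^sup>2 / (2 * (real n)\<^sup>2) - 1 / real n ^ 4) sequentially"
  proof -
    \<comment> \<open>The fourth-order Taylor coefficient is 1/24; the weaker 1/81 is convenient
      because pi^4 > 81 turns it into the deficit 1/n^4.\<close>
    have "eventually (\<lambda>y::real. 1 - cos y \<le> y\<^sup>2 / 2 - y ^ 4 / 81) (at_right 0)" by real_asymp
    moreover have "filterlim (\<lambda>n. pi / real n) (at_right 0) sequentially" by real_asymp
    ultimately have ev: "eventually (\<lambda>n. 1 - cos (pi / real n) \<le> (pi / real n)\<^sup>2 / 2 - (pi / real n) ^ 4 / 81) sequentially"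
      by (rule eventually_compose_filterlim)
    have bound: "1 / real n ^ 4 \<le> (pi / real n) ^ 4 / 81" for n
    proof -
      have "(3::real) ^ 4 \<le> pi ^ 4" using pi_gt3 by (intro power_mono) auto
      then have "81 / real n ^ 4 \<le> pi ^ 4 / real n ^ 4" by (intro divide_right_mono) auto
      then show ?thesis by (simp add: power_divide)
    qed
    from ev show ?thesis
    proof eventually_elim
      case (elim n)
      have "(pi / real n)\<^sup>2 / 2 = pi\<^sup>2 / (2 * (real n)\<^sup>2)" by (simp add: power_divide)
      then show ?case using elim bound[of n] by linarith
    qed
  qed
  moreover have "eventually (\<lambda>n. 1 - cos (pi / real n) \<ge> 1 / (real n)\<^sup>2) sequentially"
  proof -
    have "(\<lambda>n. (real n)\<^sup>2 * (1 - cos (pi / real n))) \<longlonglongrightarrow> pi * pi / 2" by real_asymp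
    moreover have "1 < pi * pi / 2"
      using mult_strict_mono[of 3 pi 3 pi] pi_gt3 by simp
    ultimately have "eventually (\<lambda>n. 1 < (real n)\<^sup>2 * (1 - cos (pi / real n))) sequentially"
      by (rule order_tendstoD(1))
    with eventually_gt_at_top[of 0] show ?thesis
      by eventually_elim (simp add: pos_divide_le_eq mult.commute)
  qed
  moreover have "eventually (\<lambda>n. 2 * sqrt 2 * x < sqrt ((real n)\<^sup>2 / 4 * (1 - cos (pi / real n))) * (exp (- v) * \<theta>' * E)) sequentially"
  proof -
    have "(\<lambda>n. (real n)\<^sup>2 / 4 * (1 - cos (pi / real n))) \<longlonglongrightarrow> pi\<^sup>2 / 8"
      unfolding power2_eq_square[of pi] by real_asymp
    then have "(\<lambda>n. sqrt ((real n)\<^sup>2 / 4 * (1 - cos (pi / real n))) * (exp (- v) * \<theta>' * E)) \<longlonglongrightarrow> sqrt (pi\<^sup>2 / 8) * (exp (- v) * \<theta>' * E)"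
      by (intro tendsto_mult tendsto_real_sqrt tendsto_const)
    moreover have "2 * sqrt 2 * x < sqrt (pi\<^sup>2 / 8) * (exp (- v) * \<theta>' * E)"
    proof -
      have s8: "sqrt (pi\<^sup>2 / 8) = pi / (2 * sqrt 2)"
        by (rule real_sqrt_unique) (auto simp: power_divide power_mult_distrib)
      have "2 * sqrt 2 * x = sqrt (pi\<^sup>2 / 8) * (\<theta> * E)"
        using E by (simp add: s8 \<theta>_def field_simps)
      also have "\<dots> < sqrt (pi\<^sup>2 / 8) * (exp (- v) * \<theta>' * E)"
        using ev E by (intro mult_strict_left_mono mult_strict_right_mono) auto
      finally show ?thesis .
    qed
    ultimately show ?thesis using order_tendstoD(1) by blast
  qed
  moreover have "eventually (\<lambda>n. 400 / (real n ^ 4 * h) + 6000 * v / (h * (real n)\<^sup>2) + card K * (600000 * real J ^ 4 / real n ^ 4) / \<epsilon>\<^sup>2 < e) sequentially"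
  proof -
    have "(\<lambda>n. 400 / h * (1 / real n ^ 4) + 6000 * v / h * (1 / (real n)\<^sup>2) + card K * (600000 * real J ^ 4) / \<epsilon>\<^sup>2 * (1 / real n ^ 4)) \<longlonglongrightarrow>
      400 / h * 0 + 6000 * v / h * 0 + card K * (600000 * real J ^ 4) / \<epsilon>\<^sup>2 * 0"
      by (intro tendsto_add tendsto_mult tendsto_const) real_asymp+
    then have "eventually (\<lambda>n. 400 / h * (1 / real n ^ 4) + 6000 * v / h * (1 / (real n)\<^sup>2) + card K * (600000 * real J ^ 4) / \<epsilon>\<^sup>2 * (1 / real n ^ 4) < e) sequentially"
      using e order_tendstoD(2) by fastforce
    then show ?thesis by eventually_elim (simp add: field_simps)
  qed
  ultimately show ?thesis
  proof eventually_elim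
    case (elim n)
    interpret box n by unfold_locales (use elim in auto)
    define t where "t = t_star n (a n) + s * (real n)\<^sup>2"
    have n: "real n > 0" using elim by auto
    have t_eq: "t = (2 / pi\<^sup>2 * ln (a n) + s) * (real n)\<^sup>2" by (simp add: t_def t_star_def algebra_simps)
    have t: "t > 0" unfolding t_eq using elim n by (intro mult_pos_pos) auto
    have an: "a n > 0" using elim by auto
    define w where "w \<theta> = (\<Sum>j\<in>{1..J}. c j * sin (real j * \<theta>))" for \<theta>
    define h0 where "h0 = (\<lambda>y\<in>Lam n. a n * (w (pi * of_int (fst y) / n) * w (pi * of_int (snd y) / n)))"
    have h0: "h0 \<in> extensional (Lam n)" by (simp add: h0_def)
    have h0_bound: "\<bar>h0 y\<bar> \<le> a n" if "y \<in> Lam n" for y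
    proof -
      have "\<bar>w u * w u'\<bar> \<le> 1" for u u'
        using c(1) unfolding abs_mult w_def by (intro mult_le_one) auto
      from mult_left_mono[OF this, of "a n"] that an show ?thesis by (simp add: h0_def abs_mult)
    qed
    \<comment> \<open>The extra loss \<open>t / real n ^ 4\<close> cancels in the exponent against
      the deficit of \<open>gap n\<close> below pi^2/(2 n^2), so only exp(-v) is lost in the
      end.\<close>
    define u where "u = v + t / real n ^ 4"
    have u: "u > 0" using v t n by (simp add: u_def add_pos_pos)
    have KL: "finite K" "K \<subseteq> Lam n - {(1, 1)}" using elim by (auto simp: K_def Lam_def)
    have tv: "tv_dist (distr (M n h0) (height_space n) (H n h0 t)) (dgff n) \<ge> erf x
      - (20 * gap n / msq n + t * (60 * (gap n)\<^sup>2 / msq n)) / (exp (- u) - 1 + u)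
      - (\<Sum>k\<in>K. 6000 * (eig n k)\<^sup>2 / (gap n * msq n)) / \<epsilon>\<^sup>2"
    proof (rule glauber_tv_ge[OF glauber[OF h0] t u KL \<epsilon> less_imp_le[OF x(1)]])
      fix \<psi> assume adm: "admissible \<psi>" and big: "msq n * exp (- u - t * gap n) \<le> mass \<psi>"
        and small: "\<And>k. k \<in> K \<Longrightarrow> \<bar>coef n \<psi> k\<bar> \<le> \<epsilon> * mass \<psi>"
      have F: "mass \<psi> > 0" using adm by (simp add: admissible_def)
      have "t * gap n \<le> t * (pi\<^sup>2 / (2 * (real n)\<^sup>2) - 1 / real n ^ 4)"
        using elim t by (intro mult_left_mono) (auto simp: gap_eq)
      also have "\<dots> = ln (a n) + pi\<^sup>2 * s / 2 - t / real n ^ 4"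
        using n by (simp add: t_eq field_simps)
      finally have "- v - ln (a n) - pi\<^sup>2 * s / 2 \<le> - u - t * gap n" by (simp add: u_def)
      then have "msq n * exp (- v - ln (a n) - pi\<^sup>2 * s / 2) \<le> msq n * exp (- u - t * gap n)"
        using msq_pos by (intro mult_left_mono) auto
      with big have "msq n * exp (- v - ln (a n) - pi\<^sup>2 * s / 2) \<le> mass \<psi>" by linarith
      moreover have "exp (- v - ln (a n) - pi\<^sup>2 * s / 2) = exp (- v) * E / a n"
      proof -
        have "- v - ln (a n) - pi\<^sup>2 * s / 2 = (- v + - (pi\<^sup>2 * s / 2)) - ln (a n)" by simp
        then show ?thesis using an by (simp only: exp_diff exp_add exp_ln E_def)
      qed
      ultimately have "msq n * (exp (- v) * E / a n) \<le> mass \<psi>" by (simp only:)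
      then have am: "msq n * (exp (- v) * E) \<le> a n * mass \<psi>"
        using an by (simp add: field_simps)
      have "2 * (sqrt 2 * x * sqrt (msq n / gap n)) = 2 * sqrt 2 * x * sqrt (msq n / gap n)" by simp
      also have "\<dots> \<le> sqrt (msq n * gap n) * (exp (- v) * \<theta>' * E) * sqrt (msq n / gap n)"
        using elim msq_pos gap_pos by (intro mult_right_mono) (auto simp: msq_def gap_eq)
      also have "\<dots> = (sqrt (msq n * gap n) * sqrt (msq n / gap n)) * (exp (- v) * \<theta>' * E)" by (simp only: mult_ac)
      also have "sqrt (msq n * gap n) * sqrt (msq n / gap n) = msq n"
      proof -
        have "msq n * gap n * (msq n / gap n) = (msq n)\<^sup>2" using gap_pos by (simp add: power2_eq_square)
        then have "sqrt (msq n * gap n) * sqrt (msq n / gap n) = sqrt ((msq n)\<^sup>2)"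
          by (simp only: real_sqrt_mult[symmetric])
        then show ?thesis using msq_pos by simp
      qed
      also have "msq n * (exp (- v) * \<theta>' * E) = \<theta>' * (msq n * (exp (- v) * E))" by (simp only: mult_ac)
      also have "\<dots> \<le> \<theta>' * (a n * mass \<psi>)" using am \<theta> \<theta>' by (intro mult_left_mono) auto
      also have "\<dots> \<le> (q - \<epsilon> * B) * (a n * mass \<psi>)" using qB an F by (intro mult_right_mono) auto
      also have "\<dots> = a n * ((q - \<epsilon> * B) * mass \<psi>)" by simp
      also have "\<dots> \<le> a n * (\<Sum>(i, j)\<in>{1..J} \<times> {1..J}. c i * c j * coef n \<psi> (int i, int j))"
      proof (rule mult_left_mono)
        show "(q - \<epsilon> * B) * mass \<psi> \<le> (\<Sum>(i, j)\<in>{1..J} \<times> {1..J}. c i * c j * coef n \<psi> (int i, int j))"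
          unfolding q_def B_def using F \<epsilon> c(3)
          by (intro trig_square_ge small) (auto simp: K_def)
      qed (use an in simp)
      also have "\<dots> = (\<Sum>y\<in>Lam n. \<psi> y * h0 y)"
        unfolding pairing_trig_square[symmetric] w_def[symmetric] sum_distrib_left
        by (intro sum.cong refl) (simp add: h0_def)
      finally show "2 * (sqrt 2 * x * sqrt (msq n / gap n)) \<le> (\<Sum>y\<in>Lam n. \<psi> y * h0 y)" .
    qed
    have "(20 * gap n / msq n + t * (60 * (gap n)\<^sup>2 / msq n)) / (exp (- u) - 1 + u)
      + (\<Sum>k\<in>K. 6000 * (eig n k)\<^sup>2 / (gap n * msq n)) / \<epsilon>\<^sup>2
      \<le> 400 / (real n ^ 4 * h) + 6000 * v / (h * (real n)\<^sup>2) + card K * (600000 * real J ^ 4 / real n ^ 4) / \<epsilon>\<^sup>2"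
      unfolding u_def h_def using elim by (intro error_bound v t \<epsilon> KL(1)) (auto simp: gap_eq K_def)
    also have "\<dots> < e" using elim by simp
    finally have "tv_dist (distr (M n h0) (height_space n) (H n h0 t)) (dgff n) \<ge> erf x - e"
      using tv by linarith
    also have "tv_dist (distr (M n h0) (height_space n) (H n h0 t)) (dgff n) \<le> worst_tv n (a n) (\<lambda>h0. distr (M n h0) (height_space n) (H n h0 t))"
      using elim h0 h0_bound t by (intro worst_tv_ge[OF glauber]) auto
    finally show ?case by (simp only: t_def)
  qed
qed

theorem theorem1p4:
  fixes a :: "nat \<Rightarrow> real" and s :: real
    and M :: "nat \<Rightarrow> height \<Rightarrow> 'w measure"
    and N :: "nat \<Rightarrow> height \<Rightarrow> site \<Rightarrow> real \<Rightarrow> 'w \<Rightarrow> nat"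
    and Z :: "nat \<Rightarrow> height \<Rightarrow> site \<Rightarrow> nat \<Rightarrow> 'w \<Rightarrow> real"
    and H :: "nat \<Rightarrow> height \<Rightarrow> real \<Rightarrow> 'w \<Rightarrow> height"
  assumes a: "filterlim (\<lambda>n. a n / ln (real n)) at_top sequentially"
    and glauber: "\<And>n h0. h0 \<in> extensional (Lam n) \<Longrightarrow>
          glauber_dynamics (M n h0) n h0 (N n h0) (Z n h0) (H n h0)"
  shows "liminf (\<lambda>n. ereal (worst_tv n (a n)
             (\<lambda>h0. distr (M n h0) (height_space n) (H n h0 (t_star n (a n) + s * (real n)\<^sup>2)))))
         \<ge> ereal (erf (2 / pi * exp (- (pi\<^sup>2 * s / 2))))"
proof -
  have a_lim: "filterlim a at_top sequentially"
  proof (rule filterlim_at_top_mono)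
    show "filterlim (\<lambda>n. a n / ln (real n)) at_top sequentially" by (rule a)
    have "eventually (\<lambda>n. a n / ln (real n) \<ge> 0) sequentially" using a by (simp add: filterlim_at_top)
    moreover have "eventually (\<lambda>n. ln (real n) \<ge> 1) sequentially" by real_asymp
    ultimately show "eventually (\<lambda>n. a n / ln (real n) \<le> a n) sequentially"
    proof eventually_elim
      case (elim n)
      have "a n / ln (real n) * 1 \<le> a n / ln (real n) * ln (real n)" using elim by (intro mult_left_mono)
      then show ?case using elim by simp
    qed
  qed
  let ?x = "2 / pi * exp (- (pi\<^sup>2 * s / 2))"
  show ?thesis
    unfolding le_Liminf_iff
  proof (intro allI impI)
    fix y :: ereal assume y: "y < ereal (erf ?x)"
    then obtain r where r: "y < ereal r" "r < erf ?x" using ereal_dense2 less_ereal.simps(1) by metis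
    \<comment> \<open>Two slacks are created: \<open>x'\<close> below the limiting argument absorbs
      the losses in the conditional mean, and \<open>r\<close> below \<open>erf x'\<close> absorbs
      the error probabilities.\<close>
    obtain x' where x': "0 < x'" "x' < ?x" "r < erf x'" by (rule erf_left_approx[OF r(2)]) auto
    from eventually_worst_tv_ge[OF a_lim glauber x'(1,2), where e = "erf x' - r"] x'(3)
    have "eventually (\<lambda>n. worst_tv n (a n)
             (\<lambda>h0. distr (M n h0) (height_space n) (H n h0 (t_star n (a n) + s * (real n)\<^sup>2))) \<ge> r) sequentially"
      by simp
    then show "eventually (\<lambda>n. y < ereal (worst_tv n (a n)
             (\<lambda>h0. distr (M n h0) (height_space n) (H n h0 (t_star n (a n) + s * (real n)\<^sup>2))))) sequentially"
      by eventually_elim (use r(1) less_le_trans in fastforce)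
  qed
qed

end
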